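(* Let $d\ge 1$ and let $\Lambda_\Phi \subset [0,1]^d$ be an irreducible Barański sponge with distinguishable coordinates. Then $$\dim_H(\Lambda_\Phi\cap \mathrm{BA}_d)\ \ge\ \mathrm{DynD}(\Phi),$$ where $\mathrm{DynD}(\Phi)$ is the dynamical dimension of $\Lambda_\Phi$. In particular, if $d=2$ or if $\Lambda_\Phi$ is a Sierpiński sponge, then $\dim_H(\Lambda_\Phi\cap \mathrm{BA}_d)=\dim_H(\Lambda_\Phi)$.
   Context: $\dim_H$ denotes Hausdorff dimension. $\mathrm{BA}_d$ is the set of badly approximable points of $\mathbb{R}^d$: those $\mathbf{x}\in\mathbb{R}^d$ for which there is $c>0$ with $\|\mathbf{x}-\mathbf{p}/q\|\ge c\,q^{-(1+1/d)}$ for all $\mathbf{p}\in\mathbb{Z}^d$ and all integers $q\ge 1$. Diagonal IFS and self-affine sponge. Let $D=\{1,\ldots,d\}$. For each $i\in D$ let $A_i$ be a finite index set and $\Phi_i=(\phi_{i,a})_{a\in A_i}$ a finite collection of contracting similarities $[0,1]\to[0,1]$ (the base IFS in coordinate $i$). Let $A=\prod_{i\in D}A_i$, and for $\mathbf{a}=(a_1,\ldots,a_d)\in A$ let $\phi_{\mathbf{a}}(x_1,\ldots,x_d)=(\phi_{\mathbf{a},1}(x_1),\ldots,\phi_{\mathbf{a},d}(x_d))$, where $\phi_{\mathbf{a},i}:=\phi_{i,a_i}$. The constant $|\phi_{\mathbf{a},i}'|\in(0,1)$ is the contraction ratio of $\phi_{\mathbf{a},i}$. For nonempty $E\subset A$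 the collection $\Phi=(\phi_{\mathbf{a}})_{\mathbf{a}\in E}$ is called a diagonal IFS. Its coding map is $\pi:E^{\mathbb{N}}\to[0,1]^d$, $\pi(\omega)=\lim_{n\to\infty}\phi_{\omega_1}\circ\cdots\circ\phi_{\omega_n}(\mathbf{0})$, and its limit set $\Lambda_\Phi=\pi(E^{\mathbb{N}})$ is called a self-affine sponge. Properties of the data $\Phi$ are, by abuse of language, attributed to $\Lambda_\Phi$. The sponge is Barański if for every $i\in D$ the sets $\phi_{i,a}((0,1))$, $a\in A_i$, are pairwise disjoint. For $i,j\in D$ write $i\prec j$ (equivalently $j\succ i$) if $|\phi_{\mathbf{a},i}'|\ge|\phi_{\mathbf{a},j}'|$ for all $\mathbf{a}\in E$ (so $i\prec i$). The sponge is irreducible if for every $i\in D$ there exist $\mathbf{a},\mathbf{b}\in E$ such that $a_i\ne b_i$ and $\{j\in D: a_j\ne b_j\}\subset\{j\in D: j\succ i\}$. The sponge has distinguishable coordinates if for all $i\ne j$ in $D$ there exists $\mathbf{a}\in E$ with $|\phi_{\mathbf{a},i}'|\ne|\phi_{\mathbf{a},j}'|$. The sponge is a Sierpiński sponge if the coordinatewise rates of contraction are the same for all contractions in the IFS, i.e. for each $i\in D$ the number $|\phi_{\mathbf{a},i}'|$ does not depend on $\mathbf{a}\in E$. The dynamical dimension is $\mathrm{DynD}(\Phi)=\sup_\mu \dim_H(\pi_*[\mu])$, the supremum being over all shift-invariant Borel probability measures $\mu$ on $E^{\mathbb{N}}$, where $\pi_*[\mu]$ is the pushforward and the Hausdorff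 dimension of a measure is the infimum of the Hausdorff dimensions of sets of full measure. *)

theory Defs
  imports "HOL-Probability.Probability"
begin

text \<open>The gauge \<open>(diam U)\<^sup>s\<close> with the usual conventions \<open>diam {} ^ s = 0\<close> and
  \<open>0 ^ 0 = 1\<close> for nonempty sets; note that \<open>0 powr 0 = 0\<close> in the library.\<close>

definition hausdorff_gauge :: "real \<Rightarrow> 'a::metric_space set \<Rightarrow> ennreal" where
  "hausdorff_gauge s U =
     (if U = {} then 0 else if s = 0 then 1 else ennreal (diameter U powr s))"

text \<open>Boundedness is required explicitly because \<^const>\<open>diameter\<close> is meaningless on
  unbounded sets.\<close>

definition hausdorff_content :: "real \<Rightarrow> real \<Rightarrow> 'a::metric_space set \<Rightarrow> ennreal" where
  "hausdorff_content s \<delta> S =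
     (INF U\<in>{U :: nat \<Rightarrow> 'a set. S \<subseteq> (\<Union>n. U n) \<and> (\<forall>n. bounded (U n) \<and> diameter (U n) \<le> \<delta>)}.
        (\<Sum>n. hausdorff_gauge s (U n)))"

definition hausdorff_measure :: "real \<Rightarrow> 'a::metric_space set \<Rightarrow> ennreal" where
  "hausdorff_measure s S = (SUP \<delta>\<in>{0<..}. hausdorff_content s \<delta> S)"

definition hausdorff_dim :: "'a::metric_space set \<Rightarrow> ennreal" where
  "hausdorff_dim S = (INF s\<in>{s. 0 \<le> s \<and> hausdorff_measure s S = 0}. ennreal s)"

definition hausdorff_dim_measure :: "'a::metric_space measure \<Rightarrow> ennreal" where
  "hausdorff_dim_measure \<nu> =
     (INF B\<in>{B \<in> sets \<nu>. emeasure \<nu> (space \<nu> - B) = 0}. hausdorff_dim B)"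

definition badly_approximable :: "(real ^ 'd::finite) set" where
  "badly_approximable =
     {x. \<exists>c>0. \<forall>(p :: int ^ 'd) (q :: int). q \<ge> 1 \<longrightarrow>
        norm (x - (\<chi> i. of_int (p $ i) / of_int q))
          \<ge> c * of_int q powr - (1 + 1 / real CARD('d))}"

text \<open>The coordinates \<open>D\<close> are the elements of the finite type \<open>'d\<close>. All index sets \<open>A i\<close>
  are subsets of one type \<open>'a\<close>, which is no restriction. The maps \<open>\<phi> i a\<close> are total
  functions on the reals, but only their values on \<open>{0..1}\<close> are ever used.\<close>

definition contracting_similarity :: "(real \<Rightarrow> real) \<Rightarrow> bool" where
  "contracting_similarity f \<longleftrightarrow>
     f ` {0..1} \<subseteq> {0..1} \<and>
     (\<exists>r. 0 < r \<and> r < 1 \<and> (\<forall>x\<in>{0..1}. \<forall>y\<in>{0..1}. dist (f x) (f y) = r * dist x y))"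

text \<open>The constant value of \<open>\<bar>f'\<bar>\<close> on \<open>{0..1}\<close>; it is unique, as \<open>x = 0\<close>, \<open>y = 1\<close> shows.\<close>

definition contraction_ratio :: "(real \<Rightarrow> real) \<Rightarrow> real" where
  "contraction_ratio f =
     (THE r. \<forall>x\<in>{0..1}. \<forall>y\<in>{0..1}. dist (f x) (f y) = r * dist x y)"

definition diagonal_IFS ::
    "('d::finite \<Rightarrow> 'a set) \<Rightarrow> ('d \<Rightarrow> 'a \<Rightarrow> real \<Rightarrow> real) \<Rightarrow> ('d \<Rightarrow> 'a) set \<Rightarrow> bool" where
  "diagonal_IFS A \<phi> E \<longleftrightarrow>
     (\<forall>i. finite (A i)) \<and>
     (\<forall>i. \<forall>a\<in>A i. contracting_similarity (\<phi> i a)) \<and>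
     E \<subseteq> (\<Pi>\<^sub>E i\<in>UNIV. A i) \<and> E \<noteq> {}"

definition diag_map ::
    "('d::finite \<Rightarrow> 'a \<Rightarrow> real \<Rightarrow> real) \<Rightarrow> ('d \<Rightarrow> 'a) \<Rightarrow> real ^ 'd \<Rightarrow> real ^ 'd" where
  "diag_map \<phi> a x = (\<chi> i. \<phi> i (a i) (x $ i))"

primrec word_map ::
    "('d::finite \<Rightarrow> 'a \<Rightarrow> real \<Rightarrow> real) \<Rightarrow> (nat \<Rightarrow> 'd \<Rightarrow> 'a) \<Rightarrow> nat \<Rightarrow> real ^ 'd \<Rightarrow> real ^ 'd" where
  "word_map \<phi> \<omega> 0 = id"
| "word_map \<phi> \<omega> (Suc n) = word_map \<phi> \<omega> n \<circ> diag_map \<phi> (\<omega> n)"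

definition coding_map ::
    "('d::finite \<Rightarrow> 'a \<Rightarrow> real \<Rightarrow> real) \<Rightarrow> (nat \<Rightarrow> 'd \<Rightarrow> 'a) \<Rightarrow> real ^ 'd" where
  "coding_map \<phi> \<omega> = lim (\<lambda>n. word_map \<phi> \<omega> n 0)"

definition sponge ::
    "('d::finite \<Rightarrow> 'a \<Rightarrow> real \<Rightarrow> real) \<Rightarrow> ('d \<Rightarrow> 'a) set \<Rightarrow> (real ^ 'd) set" where
  "sponge \<phi> E = coding_map \<phi> ` (\<Pi>\<^sub>E n\<in>UNIV. E)"

definition baranski ::
    "('d::finite \<Rightarrow> 'a set) \<Rightarrow> ('d \<Rightarrow> 'a \<Rightarrow> real \<Rightarrow> real) \<Rightarrow> bool" where
  "baranski A \<phi> \<longleftrightarrow> (\<forall>i. disjoint_family_on (\<lambda>a. \<phi> i a ` {0<..<1}) (A i))"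

definition coord_prec ::
    "('d::finite \<Rightarrow> 'a \<Rightarrow> real \<Rightarrow> real) \<Rightarrow> ('d \<Rightarrow> 'a) set \<Rightarrow> 'd \<Rightarrow> 'd \<Rightarrow> bool" where
  "coord_prec \<phi> E i j \<longleftrightarrow>
     (\<forall>a\<in>E. contraction_ratio (\<phi> i (a i)) \<ge> contraction_ratio (\<phi> j (a j)))"

definition irreducible_sponge ::
    "('d::finite \<Rightarrow> 'a \<Rightarrow> real \<Rightarrow> real) \<Rightarrow> ('d \<Rightarrow> 'a) set \<Rightarrow> bool" where
  "irreducible_sponge \<phi> E \<longleftrightarrow>
     (\<forall>i. \<exists>a\<in>E. \<exists>b\<in>E. a i \<noteq> b i \<and> {j. a j \<noteq> b j} \<subseteq> {j. coord_prec \<phi> E i j})"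

definition distinguishable_coordinates ::
    "('d::finite \<Rightarrow> 'a \<Rightarrow> real \<Rightarrow> real) \<Rightarrow> ('d \<Rightarrow> 'a) set \<Rightarrow> bool" where
  "distinguishable_coordinates \<phi> E \<longleftrightarrow>
     (\<forall>i j. i \<noteq> j \<longrightarrow>
        (\<exists>a\<in>E. contraction_ratio (\<phi> i (a i)) \<noteq> contraction_ratio (\<phi> j (a j))))"

definition sierpinski ::
    "('d::finite \<Rightarrow> 'a \<Rightarrow> real \<Rightarrow> real) \<Rightarrow> ('d \<Rightarrow> 'a) set \<Rightarrow> bool" where
  "sierpinski \<phi> E \<longleftrightarrow>
     (\<forall>i. \<forall>a\<in>E. \<forall>b\<in>E. contraction_ratio (\<phi> i (a i)) = contraction_ratio (\<phi> i (b i)))"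

definition symbol_topology :: "'b set \<Rightarrow> (nat \<Rightarrow> 'b) topology" where
  "symbol_topology E = product_topology (\<lambda>n. discrete_topology E) UNIV"

definition symbol_space :: "'b set \<Rightarrow> (nat \<Rightarrow> 'b) measure" where
  "symbol_space E =
     sigma (topspace (symbol_topology E)) {U. openin (symbol_topology E) U}"

definition shift_map :: "(nat \<Rightarrow> 'b) \<Rightarrow> nat \<Rightarrow> 'b" where
  "shift_map \<omega> n = \<omega> (Suc n)"

definition shift_invariant_measures :: "'b set \<Rightarrow> (nat \<Rightarrow> 'b) measure set" where
  "shift_invariant_measures E =
     {\<mu>. sets \<mu> = sets (symbol_space E) \<and> prob_space \<mu> \<and> distr \<mu> \<mu> shift_map = \<mu>}"

definition dynamical_dim ::
    "('d::finite \<Rightarrow> 'a \<Rightarrow> real \<Rightarrow> real) \<Rightarrow> ('d \<Rightarrow> 'a) set \<Rightarrow> ennreal" where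
  "dynamical_dim \<phi> E =
     (SUP \<mu>\<in>shift_invariant_measures E. hausdorff_dim_measure (distr \<mu> borel (coding_map \<phi>)))"

end

theory Submission
  imports Defs "HOL-Combinatorics.Multiset_Permutations"
begin

text \<open>Lower bound. Fix a multiset \<open>M\<close> of letters in which every letter of \<open>E\<close> occurs, and use its
  permutations as new letters. The resulting sponge is contained in the given one, it contracts the
  \<open>i\<close>-th coordinate by a factor that does not depend on the letter, and all fibres of the
  projections of its alphabet to sets of coordinates have the same size, because permuting the
  positions acts transitively. Hence all cylinders of size about \<open>\<rho>\<close> have the same number of
  subcylinders of size about \<open>\<beta> * \<rho>\<close>. The rationals of suitably bounded denominator near a cylinder
  lie on a hyperplane (simplex lemma), and irreducibility yields a subcylinder of size \<open>c * \<rho>\<close> that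
  stays away from it, with \<open>c\<close> independent of \<open>\<beta>\<close>. Keeping only what lies in that subcylinder costs
  a constant factor at every step, which is negligible in the dimension as \<open>\<beta>\<close> tends to \<open>0\<close>. So
  the badly approximable part of the sponge has at least the dimension of the block sponge, which is
  a combination of numbers \<open>log_count I M / mrate i M\<close>.

  Upper bounds. Applied to the prefixes of a sequence \<open>\<omega>\<close>, the lower bound says that there are
  few words with the letter statistics of \<open>\<omega>\<close>. This gives efficient covers at every scale where the
  letter statistics of \<open>\<omega>\<close> up to the various levels of the cylinder agree well enough. By the
  ergodic theorem this happens almost everywhere for every invariant measure; for Sierpinski sponges
  and in dimension two, a boundedness argument shows that it happens at infinitely many scales for
  every \<open>\<omega>\<close>.\<close>

section \<open>Hausdorff measure and dimension\<close>

text \<open>No entropy and no dimension formula for measures is computed. For every multiset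
  \<open>M\<close> whose letters are exactly those of \<open>E\<close>, the lower bound gives an
  inequality with right-hand side r, the dimension of the badly approximable part. The upper bounds
  use nothing else: the locale \<open>sponge_bound\<close> assumes these inequalities for a number
  \<open>s\<close>, and \<open>s\<close> is r in the end. So \<open>dynamical_dim\<close> and the
  dimension of the sponge are compared with r although none of the three is known.

  Irreducibility offers, for each coordinate, one pair of letters, which is of no use at a position
  occupied by a third letter. Every permutation of \<open>M\<close> contains both, and swapping them
  moves the coordinate inside any block. Other coordinates disturbed by the swap must contract
  strictly faster, so that at small scales they hardly move; the strictness comes from
  distinguishable coordinates once the rates are summed over all of \<open>M\<close>.

  The count of words by letter statistics (method of types) rests on the superadditivity of
  \<open>log_count\<close>, that is, on concatenation of words.\<close>

lemma hausdorff_measure_eq_0D: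
  assumes "hausdorff_measure t S = 0" "0 < \<delta>"
  shows "hausdorff_content t \<delta> S = 0"
proof -
  have "hausdorff_content t \<delta> S \<le> hausdorff_measure t S"
    unfolding hausdorff_measure_def by (rule SUP_upper) (use assms in auto)
  then show ?thesis using assms by simp
qed

lemma hausdorff_content_lessD:
  assumes "hausdorff_content t \<delta> S < e"
  obtains U where "S \<subseteq> (\<Union>n::nat. U n)" "\<And>n. bounded (U n)" "\<And>n. diameter (U n) \<le> \<delta>"
    "(\<Sum>n. hausdorff_gauge t (U n)) < e"
  using assms unfolding hausdorff_content_def INF_less_iff by blast

lemma hausdorff_measure_eq_0I:
  assumes "\<And>e. 0 < e \<Longrightarrow> \<exists>U. S \<subseteq> (\<Union>n::nat. U n) \<and> (\<forall>n. bounded (U n) \<and> diameter (U n) \<le> e) \<and>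
     (\<Sum>n. hausdorff_gauge t (U n)) \<le> ennreal e"
  shows "hausdorff_measure t S = 0"
proof -
  have "hausdorff_content t \<delta> S \<le> 0" if "\<delta> > 0" for \<delta>
  proof (rule ennreal_le_epsilon)
    fix e :: real assume "0 < e"
    define e' where "e' = min e \<delta>"
    have "0 < e'" using \<open>0 < e\<close> that by (simp add: e'_def)
    from assms[OF this] obtain U where U: "S \<subseteq> (\<Union>n::nat. U n)"
      "\<forall>n. bounded (U n) \<and> diameter (U n) \<le> e'" "(\<Sum>n. hausdorff_gauge t (U n)) \<le> ennreal e'"
      by blast
    have "hausdorff_content t \<delta> S \<le> (\<Sum>n. hausdorff_gauge t (U n))"
      unfolding hausdorff_content_def
      by (rule INF_lower) (use U in \<open>auto simp: e'_def\<close>)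
    also have "\<dots> \<le> ennreal e'" by (rule U)
    also have "\<dots> \<le> 0 + ennreal e" by (simp add: e'_def ennreal_leI)
    finally show "hausdorff_content t \<delta> S \<le> 0 + ennreal e" .
  qed
  then show ?thesis unfolding hausdorff_measure_def
    by (metis (no_types, lifting) SUP_bot bot_ennreal greaterThan_iff le_zero_eq SUP_cong)
qed

lemma hausdorff_content_mono:
  assumes "S \<subseteq> T" shows "hausdorff_content t \<delta> S \<le> hausdorff_content t \<delta> T"
  unfolding hausdorff_content_def by (rule INF_superset_mono) (use assms in auto)

lemma hausdorff_measure_subset_null:
  "S \<subseteq> T \<Longrightarrow> hausdorff_measure t T = 0 \<Longrightarrow> hausdorff_measure t S = 0"
proof -
  assume S: "S \<subseteq> T" and T: "hausdorff_measure t T = 0"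
  have "hausdorff_measure t S \<le> hausdorff_measure t T"
    unfolding hausdorff_measure_def by (rule SUP_mono) (use hausdorff_content_mono[OF S] in blast)
  then show ?thesis using T by simp
qed

lemma hausdorff_dim_mono:
  assumes "S \<subseteq> T" shows "hausdorff_dim S \<le> hausdorff_dim T"
  unfolding hausdorff_dim_def
  by (rule INF_superset_mono) (use hausdorff_measure_subset_null[OF assms] in auto)

lemma hausdorff_dim_leI:
  assumes "0 \<le> s" "\<And>t. s < t \<Longrightarrow> hausdorff_measure t S = 0"
  shows "hausdorff_dim S \<le> ennreal s"
proof (rule ennreal_le_epsilon)
  fix e :: real assume "0 < e"
  have "hausdorff_dim S \<le> ennreal (s + e)"
    unfolding hausdorff_dim_def by (rule INF_lower) (use assms \<open>0 < e\<close> in auto)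
  then show "hausdorff_dim S \<le> ennreal s + ennreal e"
    using assms \<open>0 < e\<close> by (simp add: ennreal_plus)
qed

lemma hausdorff_dim_geI:
  assumes "\<And>t. 0 \<le> t \<Longrightarrow> t < s \<Longrightarrow> hausdorff_measure t S \<noteq> 0"
  shows "ennreal s \<le> hausdorff_dim S"
  unfolding hausdorff_dim_def
proof (rule INF_greatest)
  fix t assume "t \<in> {t. 0 \<le> t \<and> hausdorff_measure t S = 0}"
  then show "ennreal s \<le> ennreal t"
    using assms[of t] by (intro ennreal_leI) force
qed

lemma hausdorff_gauge_closure:
  "bounded U \<Longrightarrow> hausdorff_gauge t (closure U) = hausdorff_gauge t U"
  by (simp add: hausdorff_gauge_def diameter_closure)

text \<open>Closing the sets of a cover changes neither diameters nor gauges, and the intersection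
  over \<open>k\<close> of the closed covers with mesh \<open>1 / Suc k\<close> is Borel.\<close>

lemma hausdorff_null_borel_hull:
  assumes "hausdorff_measure t S = 0"
  obtains B where "B \<in> sets borel" "S \<subseteq> B" "hausdorff_measure t B = 0"
proof -
  have "\<exists>U. S \<subseteq> (\<Union>n::nat. U n) \<and> (\<forall>n. bounded (U n) \<and> diameter (U n) \<le> 1 / Suc k) \<and>
      (\<Sum>n. hausdorff_gauge t (U n)) < ennreal (1 / Suc k)" for k :: nat
  proof -
    have "hausdorff_content t (1 / Suc k) S < ennreal (1 / Suc k)"
      using hausdorff_measure_eq_0D[OF assms, of "1 / Suc k"] by simp
    then show ?thesis by (elim hausdorff_content_lessD) blast
  qed
  then obtain U where U: "\<And>k. S \<subseteq> (\<Union>n::nat. U k n)"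
    "\<And>k n. bounded (U k n)" "\<And>k n. diameter (U k n) \<le> 1 / Suc k"
    "\<And>k. (\<Sum>n. hausdorff_gauge t (U k n)) < ennreal (1 / Suc k)" by metis
  define B where "B = (\<Inter>k. \<Union>n. closure (U k n))"
  have "hausdorff_measure t B = 0"
  proof (rule hausdorff_measure_eq_0I)
    fix e :: real assume "0 < e"
    then obtain k where k: "1 / Suc k < e" using nat_approx_posE by blast
    show "\<exists>U. B \<subseteq> (\<Union>n::nat. U n) \<and> (\<forall>n. bounded (U n) \<and> diameter (U n) \<le> e) \<and>
      (\<Sum>n. hausdorff_gauge t (U n)) \<le> ennreal e"
    proof (intro exI conjI allI)
      show "B \<subseteq> (\<Union>n. closure (U k n))" by (auto simp: B_def)
      fix n
      show "bounded (closure (U k n))" by (rule bounded_closure[OF U(2)])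
      show "diameter (closure (U k n)) \<le> e"
        using U(3)[of k n] k unfolding diameter_closure[OF U(2)] by linarith
      have "(\<Sum>n. hausdorff_gauge t (closure (U k n))) \<le> ennreal (1 / Suc k)"
        unfolding hausdorff_gauge_closure[OF U(2)] using U(4)[of k] by (rule less_imp_le)
      also have "\<dots> \<le> ennreal e" using k by (intro ennreal_leI) simp
      finally show "(\<Sum>n. hausdorff_gauge t (closure (U k n))) \<le> ennreal e" .
    qed
  qed
  moreover have "S \<subseteq> B" unfolding B_def
    using U(1) closure_subset by (meson INT_greatest SUP_mono' order_trans)
  moreover have "B \<in> sets borel" unfolding B_def
    by (intro sets.countable_INT'' sets.countable_UN) auto
  ultimately show ?thesis using that by blast
qed

text \<open>Needed because \<open>hausdorff_dim_measure\<close> admits only Borel sets of full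
  measure. The infimum defining the dimension need not be attained, hence the intersection of hulls
  for exponents tending to it.\<close>

lemma hausdorff_dim_borel_hull:
  obtains B where "B \<in> sets borel" "S \<subseteq> B" "hausdorff_dim B \<le> hausdorff_dim S"
proof (cases "hausdorff_dim S = \<top>")
  case True
  then show ?thesis using that[of UNIV] by simp
next
  case False
  have "\<exists>B. B \<in> sets borel \<and> S \<subseteq> B \<and> hausdorff_dim B \<le> hausdorff_dim S + ennreal (1 / Suc k)" for k
  proof -
    have "hausdorff_dim S < hausdorff_dim S + ennreal (1 / Suc k)"
      using False by (simp add: less_top[symmetric] ennreal_add_left_cancel_less[of _ 0, simplified])
    then have "\<exists>t. 0 \<le> t \<and> hausdorff_measure t S = 0 \<and> ennreal t < hausdorff_dim S + ennreal (1 / Suc k)"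
      by (subst (asm) (1) hausdorff_dim_def) (auto simp: INF_less_iff)
    then obtain t where t: "0 \<le> t" "hausdorff_measure t S = 0"
      "ennreal t < hausdorff_dim S + ennreal (1 / Suc k)" by blast
    obtain B where B: "B \<in> sets borel" "S \<subseteq> B" "hausdorff_measure t B = 0"
      using hausdorff_null_borel_hull[OF t(2)] by blast
    have "hausdorff_dim B \<le> ennreal t"
      unfolding hausdorff_dim_def by (rule INF_lower) (use t B in auto)
    then show ?thesis using B t(3) by (intro exI[of _ B]) auto
  qed
  then obtain B where B: "\<And>k. B k \<in> sets borel" "\<And>k. S \<subseteq> B k"
    "\<And>k. hausdorff_dim (B k) \<le> hausdorff_dim S + ennreal (1 / Suc k)" by metis
  show ?thesis
  proof (rule that)
    show "(\<Inter>k. B k) \<in> sets borel" using B by (intro sets.countable_INT'') auto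
    show "S \<subseteq> (\<Inter>k. B k)" using B by blast
    show "hausdorff_dim (\<Inter>k. B k) \<le> hausdorff_dim S"
    proof (rule ennreal_le_epsilon)
      fix e :: real assume "0 < e"
      then obtain k where k: "1 / Suc k < e" using nat_approx_posE by blast
      have "hausdorff_dim (\<Inter>k. B k) \<le> hausdorff_dim (B k)" by (rule hausdorff_dim_mono) auto
      also have "\<dots> \<le> hausdorff_dim S + ennreal (1 / Suc k)" by (rule B)
      also have "\<dots> \<le> hausdorff_dim S + ennreal e"
        using k by (intro add_left_mono ennreal_leI) simp
      finally show "hausdorff_dim (\<Inter>k. B k) \<le> hausdorff_dim S + ennreal e" .
    qed
  qed
qed

text \<open>The digit sequences \<kappa> carry the uniform product measure. A set of diameter
  between \<open>rad (Suc m)\<close> and \<open>rad m\<close> meets at most \<open>C\<close>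
  cylinders of depth \<open>m\<close>, so by \<open>mass\<close> they have measure at most
  \<open>B\<close> times its gauge. A cover of small total gauge would thus have total mass below 1.
  The measure is applied to these cylinders, not to the preimage of the set, which may fail to be
  measurable.\<close>

lemma mass_distribution:
  fixes \<Psi> :: "(nat \<Rightarrow> nat) \<Rightarrow> 'a::metric_space" and K :: "nat \<Rightarrow> nat" and rad :: "nat \<Rightarrow> real"
  assumes K: "\<And>m. 1 \<le> K m" and t: "0 \<le> t"
    and rad: "\<And>m. 0 < rad m" "rad \<longlonglongrightarrow> 0"
    and hit: "\<And>U m. bounded U \<Longrightarrow> diameter U \<le> rad m \<Longrightarrow>
      card ((\<lambda>\<kappa>. restrict \<kappa> {..<m}) ` {\<kappa> \<in> (\<Pi>\<^sub>E l\<in>UNIV. {..<K l}). \<Psi> \<kappa> \<in> U}) \<le> C"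
    and mass: "\<And>m. real C / (\<Prod>l<m. real (K l)) \<le> B * rad (Suc m) powr t"
    and B: "0 < B"
  shows "hausdorff_measure t (\<Psi> ` (\<Pi>\<^sub>E l\<in>UNIV. {..<K l})) \<noteq> 0"
proof
  define X where "X = (\<Pi>\<^sub>E l\<in>(UNIV::nat set). {..<K l})"
  assume 0: "hausdorff_measure t (\<Psi> ` (\<Pi>\<^sub>E l\<in>UNIV. {..<K l})) = 0"
  have "hausdorff_content t (rad 0) (\<Psi> ` X) < ennreal (1 / (4 * B))"
    using hausdorff_measure_eq_0D[OF 0 rad(1)[of 0]] B by (simp add: X_def)
  then obtain U where U: "\<Psi> ` X \<subseteq> (\<Union>n::nat. U n)" "\<And>n. bounded (U n)" "\<And>n. diameter (U n) \<le> rad 0"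
    "(\<Sum>n. hausdorff_gauge t (U n)) < ennreal (1 / (4 * B))" by (elim hausdorff_content_lessD) blast
  define \<mu> where "\<mu> l = uniform_count_measure {..<K l}" for l
  interpret \<mu>: prob_space "\<mu> l" for l
    unfolding \<mu>_def using K[of l] by (intro prob_space_uniform_count_measure) (auto simp: lessThan_empty_iff bot_nat_def)
  interpret P: product_prob_space \<mu> UNIV by standard
  let ?P = "PiM UNIV \<mu>"
  have spP: "space ?P = X" by (simp add: space_PiM X_def \<mu>_def space_uniform_count_measure)
  have KX: "finite (PiE {..<m} (\<lambda>l. {..<K l}))" for m by (intro finite_PiE) auto
  define Z where "Z m w = {\<kappa> \<in> X. restrict \<kappa> {..<m} = w}" for m w
  have Z: "Z m w \<in> sets ?P \<and> emeasure ?P (Z m w) = ennreal (1 / (\<Prod>l<m. real (K l)))"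
    if "w \<in> PiE {..<m} (\<lambda>l. {..<K l})" for m w
  proof -
    have *: "Z m w = prod_emb UNIV \<mu> {..<m} (PiE {..<m} (\<lambda>l. {w l}))"
      using that unfolding Z_def prod_emb_def X_def
      by (auto simp: \<mu>_def space_uniform_count_measure PiE_iff extensional_def restrict_def fun_eq_iff)
    have mem: "{w l} \<in> sets (\<mu> l)" if "l \<in> {..<m}" for l
      using that \<open>w \<in> _\<close> by (auto simp: \<mu>_def sets_uniform_count_measure)
    have "emeasure ?P (Z m w) = (\<Prod>l<m. emeasure (\<mu> l) {w l})"
      unfolding * using mem by (intro P.emeasure_PiM_emb) auto
    also have "\<dots> = (\<Prod>l<m. ennreal (1 / real (K l)))"
    proof (rule prod.cong[OF refl])
      fix l assume "l \<in> {..<m}"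
      then have "{w l} \<subseteq> {..<K l}" using that by auto
      then show "emeasure (\<mu> l) {w l} = ennreal (1 / real (K l))"
        unfolding \<mu>_def by (subst emeasure_uniform_count_measure) auto
    qed
    also have "\<dots> = ennreal (\<Prod>l<m. 1 / real (K l))" by (rule prod_ennreal) auto
    also have "(\<Prod>l<m. 1 / real (K l)) = 1 / (\<Prod>l<m. real (K l))" by (simp add: prod_dividef)
    finally show ?thesis using sets_PiM_I[of "{..<m}" UNIV "\<lambda>l. {w l}" \<mu>] mem unfolding * by simp
  qed
  have small: "\<exists>m. B * rad (Suc m) powr t \<le> e" if "e > 0" "t > 0" for e
  proof -
    have "(\<lambda>m. rad (Suc m) powr t) \<longlonglongrightarrow> 0 powr t"
      by (rule tendsto_powr2[OF LIMSEQ_Suc[OF rad(2)] tendsto_const])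
         (use rad(1) \<open>t > 0\<close> in \<open>auto simp: less_imp_le\<close>)
    then have "(\<lambda>m. B * rad (Suc m) powr t) \<longlonglongrightarrow> B * 0 powr t" by (rule tendsto_mult_left)
    then have "(\<lambda>m. B * rad (Suc m) powr t) \<longlonglongrightarrow> 0" using that by simp
    then have "eventually (\<lambda>m. B * rad (Suc m) powr t < e) sequentially"
      using that by (auto simp: order_tendsto_iff)
    then have "\<exists>m. B * rad (Suc m) powr t < e" by (rule eventually_happens'[rotated]) simp
    then show ?thesis using less_imp_le by blast
  qed
  \<comment> \<open>The additive error absorbs sets of diameter 0, whose gauge vanishes for
    \<open>t > 0\<close>. The errors add up to 1/2 and the gauges, multiplied by \<open>B\<close>,
    to at most 1/4.\<close>
  have "\<exists>m. diameter (U n) \<le> rad m \<and>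
     (U n \<noteq> {} \<longrightarrow> ennreal (B * rad (Suc m) powr t) \<le> ennreal B * hausdorff_gauge t (U n) + ennreal (1/4 * (1/2)^n))" for n
  proof (cases "t = 0 \<or> U n = {}")
    case True
    then show ?thesis using U(3)[of n] B rad(1)[of "Suc 0"]
      by (intro exI[of _ 0]) (auto simp: hausdorff_gauge_def)
  next
    case False
    then have t: "t > 0" using t by simp
    show ?thesis
    proof (cases "diameter (U n) = 0")
      case True
      then show ?thesis using small[of "1/4 * (1/2)^n"] t rad(1)
        by (auto intro!: add_increasing ennreal_leI simp: less_imp_le)
    next
      case False
      then have pos: "0 < diameter (U n)" using diameter_ge_0[OF U(2)[of n]] by simp
      have "eventually (\<lambda>m. rad m < diameter (U n)) sequentially"
        using rad(2) pos by (auto simp: order_tendsto_iff)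
      then have ex: "\<exists>m. rad m < diameter (U n)" by (metis eventually_sequentially order_refl)
      \<comment> \<open>As \<open>diameter (U n) \<le> rad 0\<close>, this index is positive; its
        predecessor is the depth at which \<open>U n\<close> is measured.\<close>
      define m where "m = (LEAST m. rad m < diameter (U n))"
      have m: "rad m < diameter (U n)" unfolding m_def using ex by (rule LeastI_ex)
      then obtain m' where m': "m = Suc m'" using U(3)[of n] by (cases m) auto
      then have "\<not> rad m' < diameter (U n)" using not_less_Least[of m' "\<lambda>m. rad m < diameter (U n)"]
        by (auto simp: m_def)
      moreover have "B * rad (Suc m') powr t \<le> B * diameter (U n) powr t"
        using m m' B rad(1)[of m] t by (intro mult_left_mono powr_mono2) (auto simp: less_imp_le)
      ultimately show ?thesis
        using \<open>\<not> (t = 0 \<or> U n = {})\<close> B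
        by (intro exI[of _ m'])
           (auto simp: hausdorff_gauge_def ennreal_mult' [symmetric] intro!: add_increasing2 ennreal_leI)
    qed
  qed
  then obtain m where m: "\<And>n. diameter (U n) \<le> rad (m n)"
    "\<And>n. U n \<noteq> {} \<Longrightarrow> ennreal (B * rad (Suc (m n)) powr t) \<le> ennreal B * hausdorff_gauge t (U n) + ennreal (1/4 * (1/2)^n)"
    by metis
  define W where "W n = (\<lambda>\<kappa>. restrict \<kappa> {..<m n}) ` {\<kappa> \<in> X. \<Psi> \<kappa> \<in> U n}" for n
  have W: "W n \<subseteq> PiE {..<m n} (\<lambda>l. {..<K l})" for n
    by (auto simp: W_def X_def PiE_iff extensional_def split: if_splits)
  have finW: "finite (W n)" for n using W KX finite_subset by blast
  have cardW: "card (W n) \<le> C" for n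
    unfolding W_def X_def by (rule hit[OF U(2) m(1)])
  define V where "V n = (\<Union>w\<in>W n. Z (m n) w)" for n
  have V: "V n \<in> sets ?P" for n
    unfolding V_def using Z W finW by (intro sets.finite_UN) blast+
  have "emeasure ?P (V n) \<le> ennreal B * hausdorff_gauge t (U n) + ennreal (1/4 * (1/2)^n)" for n
  proof (cases "U n = {}")
    case True
    then show ?thesis by (simp add: V_def W_def)
  next
    case False
    have pK: "0 < (\<Prod>l<m n. real (K l))" using K by (intro prod_pos) (auto simp: Suc_le_eq)
    have "emeasure ?P (V n) \<le> (\<Sum>w\<in>W n. emeasure ?P (Z (m n) w))"
      unfolding V_def using Z W finW by (intro emeasure_subadditive_finite) blast+
    also have "\<dots> = (\<Sum>w\<in>W n. ennreal (1 / (\<Prod>l<m n. real (K l))))"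
      using Z W by (intro sum.cong refl) blast
    also have "\<dots> = ennreal (real (card (W n)) / (\<Prod>l<m n. real (K l)))"
      using pK by (simp add: ennreal_of_nat_eq_real_of_nat ennreal_mult'[symmetric])
    also have "\<dots> \<le> ennreal (real C / (\<Prod>l<m n. real (K l)))"
      using cardW[of n] pK by (intro ennreal_leI divide_right_mono) auto
    also have "\<dots> \<le> ennreal (B * rad (Suc (m n)) powr t)" by (intro ennreal_leI mass)
    also have "\<dots> \<le> ennreal B * hausdorff_gauge t (U n) + ennreal (1/4 * (1/2)^n)" by (rule m(2)[OF False])
    finally show ?thesis .
  qed
  then have le: "(\<Sum>n. emeasure ?P (V n)) \<le> (\<Sum>n. ennreal B * hausdorff_gauge t (U n) + ennreal (1/4 * (1/2)^n))"
    by (intro suminf_le) auto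
  have "X \<subseteq> (\<Union>n. V n)"
    using U(1) by (fastforce simp: V_def W_def Z_def)
  then have "1 \<le> emeasure ?P (\<Union>n. V n)"
    using V by (metis P.emeasure_space_1 emeasure_mono spP sets.countable_UN'' sets.top spP UNIV_I countableI_type)
  also have "\<dots> \<le> (\<Sum>n. emeasure ?P (V n))" using V by (intro emeasure_subadditive_countably) auto
  also note le
  also have "(\<Sum>n. ennreal B * hausdorff_gauge t (U n) + ennreal (1/4 * (1/2)^n)) =
     ennreal B * (\<Sum>n. hausdorff_gauge t (U n)) + (\<Sum>n. ennreal (1/4 * (1/2)^n))"
    by (subst suminf_add[symmetric]) auto
  also have "(\<Sum>n. ennreal (1/4 * (1/2)^n)) = ennreal (1/2)"
    using sums_mult[OF geometric_sums[of "1/2::real"], of "1/4"] by (intro suminf_ennreal_eq) auto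
  also have "ennreal B * (\<Sum>n. hausdorff_gauge t (U n)) \<le> ennreal B * ennreal (1 / (4 * B))"
    using U(4) by (intro mult_left_mono) auto
  also have "ennreal B * ennreal (1 / (4 * B)) = ennreal (1/4)"
    using B by (simp add: ennreal_mult'[symmetric])
  also have "ennreal (1/4) + ennreal (1/2) = ennreal (3/4)" by (subst ennreal_plus[symmetric]) auto
  finally show False by simp
qed

section \<open>The pointwise ergodic theorem\<close>

text \<open>The Katznelson--Weiss argument: every orbit splits into blocks of bounded length on which the
  average of \<open>f\<close> is almost \<open>F\<close>, except for visits to a set of small measure, where \<open>f\<close> is increased
  by \<open>1\<close>.\<close>

lemma birkhoff_limsup_le:
  fixes f :: "'b \<Rightarrow> real"
  assumes "prob_space M" and T: "T \<in> measurable M M" "distr M M T = M"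
    and f: "f \<in> borel_measurable M" "\<And>x. 0 \<le> f x" "\<And>x. f x \<le> 1"
    and F_def: "\<And>x. F x = real_of_ereal (limsup (\<lambda>n. ereal ((\<Sum>k<n. f ((T ^^ k) x)) / n)))"
  shows "F \<in> borel_measurable M" "\<And>x. 0 \<le> F x" "\<And>x. F x \<le> 1"
    "integral\<^sup>L M F \<le> integral\<^sup>L M f"
    "\<And>x. ereal (F x) = limsup (\<lambda>n. ereal ((\<Sum>k<n. f ((T ^^ k) x)) / n))"
proof -
  interpret prob_space M by fact
  define S where "S n x = (\<Sum>k<n. f ((T ^^ k) x))" for n x
  have Tk: "T ^^ k \<in> measurable M M" for k by (induction k) (use T(1) in auto)
  have S_meas [measurable]: "S n \<in> borel_measurable M" for n
    unfolding S_def using measurable_compose[OF Tk f(1)] by (intro borel_measurable_sum) auto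
  have S0: "0 \<le> S n x" for n x unfolding S_def using f by (intro sum_nonneg) auto
  have S1: "S n x \<le> n" for n x
  proof -
    have "S n x \<le> (\<Sum>k<n. 1)" unfolding S_def by (intro sum_mono f)
    then show ?thesis by simp
  qed
  have T_add: "(T ^^ (m + n)) x = (T ^^ n) ((T ^^ m) x)" for m n x
    by (metis add.commute comp_apply funpow_add)
  have S_add: "S (m + n) x = S m x + S n ((T ^^ m) x)" for m n x
    by (induction n) (auto simp: S_def T_add)
  define L where "L x = limsup (\<lambda>n. ereal (S n x / n))" for x
  have L0: "0 \<le> L x" for x
    unfolding L_def using S0 by (intro le_Limsup) (auto intro!: always_eventually divide_nonneg_nonneg)
  have L1: "L x \<le> 1" for x
    unfolding L_def using S1 by (intro Limsup_bounded) (auto intro!: always_eventually simp: divide_le_eq_1)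
  have FL: "F x = real_of_ereal (L x)" for x by (simp add: F_def L_def S_def)
  have eF: "ereal (F x) = L x" for x
    using L0[of x] L1[of x] by (cases "L x") (auto simp: FL)
  show "\<And>x. 0 \<le> F x" "\<And>x. F x \<le> 1"
    using L0 L1 by (auto simp: eF[symmetric] zero_ereal_def one_ereal_def)
  then have F0: "0 \<le> F x" and F1: "F x \<le> 1" for x by auto
  show "\<And>x. ereal (F x) = limsup (\<lambda>n. ereal ((\<Sum>k<n. f ((T ^^ k) x)) / n))"
    using eF by (simp add: L_def S_def)
  have L_meas [measurable]: "L \<in> borel_measurable M" unfolding L_def[abs_def] by measurable
  show F_meas [measurable]: "F \<in> borel_measurable M" unfolding FL[abs_def] by measurable
  \<comment> \<open>The averages along the orbits of \<open>x\<close> and \<open>T x\<close> differ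
    by at most \<open>2 / Suc n\<close>.\<close>
  have F_inv: "F (T x) = F x" for x
  proof -
    have S_Suc: "S (Suc n) x = f x + S n (T x)" for n using S_add[of 1 n x] by (simp add: S_def)
    have lim0: "(\<lambda>n. S n (T x) / n - S (Suc n) x / Suc n) \<longlonglongrightarrow> 0"
    proof (rule Lim_null_comparison)
      show "eventually (\<lambda>n. norm (S n (T x) / n - S (Suc n) x / Suc n) \<le> 2 / Suc n) sequentially"
        using eventually_gt_at_top[of "0::nat"]
      proof eventually_elim
        case (elim n)
        have "S n (T x) / n - S (Suc n) x / Suc n = (S n (T x) / n) / Suc n - f x / Suc n"
          unfolding S_Suc using elim by (simp add: divide_simps) (simp add: algebra_simps)
        moreover have "\<bar>S n (T x) / n\<bar> \<le> 1" using S0[of n "T x"] S1[of n "T x"] elim by simp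
        then have "\<bar>S n (T x) / n\<bar> / Suc n \<le> 1 / Suc n" by (rule divide_right_mono) simp
        then have "\<bar>(S n (T x) / n) / Suc n\<bar> \<le> 1 / Suc n" by (subst abs_divide) simp
        moreover have "\<bar>f x\<bar> / Suc n \<le> 1 / Suc n" using f(2,3)[of x] by (intro divide_right_mono) auto
        then have "\<bar>f x / Suc n\<bar> \<le> 1 / Suc n" by (subst abs_divide) simp
        ultimately show ?case by (simp only: real_norm_def)
      qed
      show "(\<lambda>n. 2 / real (Suc n)) \<longlonglongrightarrow> 0" by real_asymp
    qed
    have "L (T x) = limsup (\<lambda>n. ereal (S n (T x) / n - S (Suc n) x / Suc n) + ereal (S (Suc n) x / Suc n))"
      unfolding L_def by simp
    also have "\<dots> = 0 + limsup (\<lambda>n. ereal (S (Suc n) x / Suc n))"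
      using lim0 by (intro ereal_limsup_lim_add) (auto simp: zero_ereal_def)
    also have "\<dots> = L x" unfolding L_def
      using limsup_shift[of "\<lambda>n. ereal (S n x / n)"] by simp
    finally show ?thesis by (simp add: FL)
  qed
  then have F_inv: "F ((T ^^ k) x) = F x" for k x by (induction k) auto
  show "integral\<^sup>L M F \<le> integral\<^sup>L M f"
  proof (rule field_le_epsilon)
    fix e :: real assume "0 < e"
    define \<epsilon> where "\<epsilon> = e / 2"
    have \<epsilon>: "0 < \<epsilon>" using \<open>0 < e\<close> by (simp add: \<epsilon>_def)
    \<comment> \<open>Subtracting \<epsilon> makes the value an average over some finite time,
      although \<open>F\<close> is only a limsup; the truncation makes \<open>(n - m') * G x\<close>
      nonpositive for short orbits.\<close>
    define G where "G x = max (F x - \<epsilon>) 0" for x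
    have G: "0 \<le> G x" "G x \<le> 1" "F x - \<epsilon> \<le> G x" for x using F1[of x] \<epsilon> by (auto simp: G_def)
    have G_meas [measurable]: "G \<in> borel_measurable M" unfolding G_def[abs_def] by measurable
    have G_inv: "G ((T ^^ k) x) = G x" for k x by (simp add: G_def F_inv)
    have ex: "\<exists>n\<ge>1. real n * G x \<le> S n x" for x
    proof (cases "F x - \<epsilon> \<le> 0")
      case True
      then show ?thesis using S0[of 1 x] by (intro exI[of _ 1]) (auto simp: G_def)
    next
      case False
      have "ereal (F x - \<epsilon>) < L x" using \<epsilon> by (simp flip: eF)
      have "frequently (\<lambda>n. ereal (F x - \<epsilon>) < ereal (S n x / n)) sequentially"
      proof (rule ccontr)
        assume "\<not> ?thesis"
        then have "eventually (\<lambda>n. ereal (S n x / n) \<le> ereal (F x - \<epsilon>)) sequentially"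
          by (simp add: not_frequently not_less)
        then have "L x \<le> ereal (F x - \<epsilon>)" unfolding L_def by (rule Limsup_bounded)
        then show False using \<open>ereal (F x - \<epsilon>) < L x\<close> by simp
      qed
      then have "frequently (\<lambda>n. ereal (F x - \<epsilon>) < ereal (S n x / n) \<and> n \<ge> 1) sequentially"
        using eventually_ge_at_top[of 1] by (rule frequently_eventually_frequently)
      then obtain n where "F x - \<epsilon> < S n x / n" "n \<ge> 1" by (auto dest!: frequently_ex)
      then show ?thesis using False by (intro exI[of _ n]) (auto simp: G_def field_simps)
    qed
    \<comment> \<open>Points whose orbit does not reach the average \<open>G\<close> within
      \<open>m\<close> steps. By \<open>ex\<close> these sets decrease to the empty set, so some
      \<open>m\<close> makes the measure less than \<epsilon>.\<close>
    define B where "B m = {x \<in> space M. \<forall>n\<in>{1..m}. S n x < real n * G x}" for m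
    have B_meas [measurable]: "B m \<in> sets M" for m unfolding B_def by measurable
    have "(\<lambda>m. measure M (B m)) \<longlonglongrightarrow> measure M (\<Inter>m. B m)"
      by (intro finite_Lim_measure_decseq) (auto simp: B_def decseq_def)
    moreover have "(\<Inter>m. B m) = {}" using ex by (fastforce simp: B_def not_less[symmetric])
    ultimately have "(\<lambda>m. measure M (B m)) \<longlonglongrightarrow> 0" by simp
    then have "eventually (\<lambda>m. measure M (B m) < \<epsilon>) sequentially" using \<epsilon> by (auto simp: order_tendsto_iff)
    then have "\<exists>m. measure M (B m) < \<epsilon>" by (rule eventually_happens'[rotated]) simp
    then obtain m where m: "measure M (B m) < \<epsilon>" by blast
    \<comment> \<open>On \<open>B m\<close> this gives \<open>f' \<ge> 1 \<ge> G\<close>, so a block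
      of length 1 suffices there.\<close>
    define f' where "f' x = f x + indicator (B m) x" for x
    have f'_meas [measurable]: "f' \<in> borel_measurable M"
      unfolding f'_def[abs_def] using f(1) by measurable
    have f': "f x \<le> f' x" "0 \<le> f' x" "f' x \<le> 2" for x
      using f(2,3)[of x] by (auto simp: f'_def indicator_def)
    define S' where "S' n x = (\<Sum>k<n. f' ((T ^^ k) x))" for n x
    have S'0: "0 \<le> S' n x" for n x unfolding S'_def using f' by (intro sum_nonneg) auto
    have S'_add: "S' (m + n) x = S' m x + S' n ((T ^^ m) x)" for m n x
      by (induction n) (auto simp: S'_def T_add)
    have SS': "S n x \<le> S' n x" for n x unfolding S_def S'_def using f' by (intro sum_mono) auto
    have step: "\<exists>n\<in>{1..max m 1}. real n * G x \<le> S' n x" if xM: "x \<in> space M" for x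
    proof (cases "x \<in> B m")
      case True
      then have "G x \<le> S' 1 x" using G(2)[of x] f(2)[of x] by (simp add: S'_def f'_def)
      then show ?thesis by (intro bexI[of _ 1]) auto
    next
      case False
      then obtain n where "n \<in> {1..m}" "real n * G x \<le> S n x" using xM by (auto simp: B_def not_less)
      then show ?thesis using SS'[of n x] by (intro bexI[of _ n]) auto
    qed
    define m' where "m' = max m 1"
    \<comment> \<open>Blocks are cut off the front of the orbit, along which \<open>G\<close> is
      constant; the incomplete block at the end causes the loss of \<open>m'\<close>.\<close>
    have lower: "(real n - m') * G x \<le> S' n x" if "x \<in> space M" for n x
      using that
    proof (induction n arbitrary: x rule: less_induct)
      case (less n)
      show ?case
      proof (cases "n < m'")
        case True
        then show ?thesis using S'0[of n x] G(1)[of x]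
          by (meson diff_le_0_iff_le less_imp_le mult_nonpos_nonneg of_nat_le_iff order_trans)
      next
        case False
        obtain k where k: "k \<in> {1..m'}" "real k * G x \<le> S' k x" using step[OF less.prems] by (auto simp: m'_def)
        have Tx: "(T ^^ k) x \<in> space M" using Tk less.prems by (rule measurable_space)
        have "(real (n - k) - m') * G ((T ^^ k) x) \<le> S' (n - k) ((T ^^ k) x)"
          using k False by (intro less.IH Tx) auto
        moreover have "S' n x = S' k x + S' (n - k) ((T ^^ k) x)"
          using S'_add[of k "n - k" x] k False by simp
        moreover have "real (n - k) = real n - real k" using k False by simp
        ultimately show ?thesis using k(2) by (simp add: G_inv algebra_simps)
      qed
    qed
    have bint: "integrable M h" if "h \<in> borel_measurable M" "\<And>x. \<bar>h x\<bar> \<le> c" for h :: "'b \<Rightarrow> real" and c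
      using that by (intro integrable_const_bound[of _ c]) auto
    have intf: "integrable M f" using f by (intro bint[of f 1]) auto
    have intf': "integrable M f'" using f' by (intro bint[of f' 2]) auto
    have intG: "integrable M G" using G by (intro bint[of G 1]) auto
    have intF: "integrable M F" using F0 F1 by (intro bint[of F 1]) auto
    have int_inv: "integrable M (\<lambda>x. f' ((T ^^ k) x)) \<and> (\<integral>x. f' ((T ^^ k) x) \<partial>M) = (\<integral>x. f' x \<partial>M)" for k
    proof (induction k)
      case 0 then show ?case using intf' by simp
    next
      case (Suc k)
      have "(\<lambda>x. f' ((T ^^ k) x)) \<in> borel_measurable M" using measurable_compose[OF Tk f'_meas] by simp
      then show ?case
        using Suc integrable_distr_eq[OF T(1), of "\<lambda>x. f' ((T ^^ k) x)"]
          integral_distr[OF T(1), of "\<lambda>x. f' ((T ^^ k) x)"] unfolding T(2)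
        by (simp add: funpow_swap1)
    qed
    have intS': "(\<integral>x. S' n x \<partial>M) = n * (\<integral>x. f' x \<partial>M)" "integrable M (S' n)" for n
      unfolding S'_def using int_inv by (simp_all)
    have ineq: "(real n - m') * integral\<^sup>L M G \<le> n * integral\<^sup>L M f'" for n
    proof -
      have "(\<integral>x. (real n - m') * G x \<partial>M) \<le> (\<integral>x. S' n x \<partial>M)"
        using intG intS' lower by (intro integral_mono) auto
      then show ?thesis using intS' by simp
    qed
    have "integral\<^sup>L M G \<le> integral\<^sup>L M f'"
    proof (rule tendsto_upperbound)
      show "(\<lambda>n. (real n - m') / n * integral\<^sup>L M G) \<longlonglongrightarrow> integral\<^sup>L M G"
      proof -
        have "(\<lambda>n. (real n - m') / n) \<longlonglongrightarrow> 1" by real_asymp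
        from tendsto_mult_right[OF this, of "integral\<^sup>L M G"] show ?thesis by simp
      qed
      show "eventually (\<lambda>n. (real n - m') / n * integral\<^sup>L M G \<le> integral\<^sup>L M f') sequentially"
        using eventually_gt_at_top[of 0]
      proof eventually_elim
        case (elim n)
        then show ?case using ineq[of n] by (simp add: divide_le_eq mult.commute)
      qed
    qed simp
    also have "integral\<^sup>L M f' = integral\<^sup>L M f + measure M (B m)"
      unfolding f'_def using intf by (subst Bochner_Integration.integral_add) (auto intro!: bint[of "indicator (B m)" 1] simp: indicator_def)
    also have "\<dots> \<le> integral\<^sup>L M f + \<epsilon>" using m by simp
    finally have "integral\<^sup>L M G \<le> integral\<^sup>L M f + \<epsilon>" .
    moreover have "integral\<^sup>L M F - \<epsilon> = (\<integral>x. F x - \<epsilon> \<partial>M)" using intF by (simp add: prob_space)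
    moreover have "\<dots> \<le> integral\<^sup>L M G" using intF intG G by (intro integral_mono) auto
    ultimately show "integral\<^sup>L M F \<le> integral\<^sup>L M f + e" by (simp add: \<epsilon>_def)
  qed
qed

text \<open>Applied to \<open>f\<close> and to \<open>1 - f\<close>, the preceding bound shows that
  limsup minus liminf has integral at most 0; being nonnegative, it vanishes almost
  everywhere.\<close>

lemma birkhoff_AE_convergent:
  fixes f :: "'b \<Rightarrow> real"
  assumes "prob_space M" and T: "T \<in> measurable M M" "distr M M T = M"
    and f: "f \<in> borel_measurable M" "\<And>x. 0 \<le> f x" "\<And>x. f x \<le> 1"
  shows "AE x in M. convergent (\<lambda>n. (\<Sum>k<n. f ((T ^^ k) x)) / n)"
proof -
  interpret prob_space M by fact
  define A where "A n x = (\<Sum>k<n. f ((T ^^ k) x)) / n" for n x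
  define A' where "A' n x = (\<Sum>k<n. 1 - f ((T ^^ k) x)) / n" for n x
  define F where "F x = real_of_ereal (limsup (\<lambda>n. ereal (A n x)))" for x
  define F' where "F' x = real_of_ereal (limsup (\<lambda>n. ereal (A' n x)))" for x
  note F = birkhoff_limsup_le[OF assms, of F, OF F_def[unfolded A_def]]
  have f': "(\<lambda>x. 1 - f x) \<in> borel_measurable M" "\<And>x. 0 \<le> 1 - f x" "\<And>x. 1 - f x \<le> 1" using f by auto
  note F' = birkhoff_limsup_le[OF assms(1-3) f', of F', OF F'_def[unfolded A'_def]]
  have AA': "ereal (A' n x) = ereal 1 + - ereal (A n x)" if "n > 0" for n x
    using that by (simp add: A_def A'_def sum_subtractf diff_divide_distrib)
  have L: "ereal (F' x) = 1 - liminf (\<lambda>n. ereal (A n x))" for x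
  proof -
    have "ereal (F' x) = limsup (\<lambda>n. ereal (A' n x))" using F'(5)[of x] by (simp add: A'_def)
    also have "\<dots> = limsup (\<lambda>n. ereal 1 + - ereal (A n x))"
      by (intro Limsup_eq) (intro eventually_mono[OF eventually_gt_at_top[of 0]], rule AA')
    also have "\<dots> = ereal 1 + limsup (\<lambda>n. - ereal (A n x))"
      by (intro ereal_limsup_lim_add) auto
    also have "\<dots> = 1 - liminf (\<lambda>n. ereal (A n x))"
      by (simp only: ereal_Limsup_uminus minus_ereal_def one_ereal_def)
    finally show ?thesis .
  qed
  have FF': "1 \<le> F x + F' x" for x
  proof -
    have "liminf (\<lambda>n. ereal (A n x)) \<le> limsup (\<lambda>n. ereal (A n x))" by (rule Liminf_le_Limsup) simp
    then show ?thesis using L[of x] F(5)[of x, folded A_def, symmetric]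
      by (cases "liminf (\<lambda>n. ereal (A n x))") (auto simp: one_ereal_def)
  qed
  have bint: "integrable M h" if "h \<in> borel_measurable M" "\<And>x. \<bar>h x\<bar> \<le> c" for h :: "'b \<Rightarrow> real" and c
    using that by (intro integrable_const_bound[of _ c]) auto
  have int: "integrable M F" "integrable M F'" "integrable M f"
    using F(1-3) F'(1-3) f by (auto intro!: bint[of _ 1])
  have "(\<integral>x. F x + F' x - 1 \<partial>M) \<le> 0"
    using int F(4) F'(4) by (simp add: prob_space)
  moreover have "integrable M (\<lambda>x. F x + F' x - 1)" using int by auto
  ultimately have "AE x in M. F x + F' x - 1 = 0"
    using FF' by (subst integral_nonneg_eq_0_iff_AE[symmetric])
      (auto intro!: antisym Bochner_Integration.integral_nonneg)
  then show ?thesis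
  proof eventually_elim
    case (elim x)
    have "liminf (\<lambda>n. ereal (A n x)) = limsup (\<lambda>n. ereal (A n x))"
      using L[of x] F(5)[of x, folded A_def, symmetric] elim
      by (cases "liminf (\<lambda>n. ereal (A n x))") (auto simp: one_ereal_def)
    then have "(\<lambda>n. ereal (A n x)) \<longlonglongrightarrow> ereal (F x)"
      using F(5)[of x, folded A_def] by (intro Liminf_eq_Limsup) auto
    then show ?case unfolding A_def by (auto simp: convergent_def)
  qed
qed

section \<open>Rational points near a point\<close>

text \<open>The simplex lemma: \<open>d + 1\<close> of the integer vectors \<open>(p, q)\<close> have an integral determinant of
  absolute value less than \<open>1\<close>, so they are linearly dependent.\<close>

lemma rational_points_on_hyperplane:
  fixes x :: "real ^ 'd::finite" and r Q :: real
  assumes r: "0 \<le> r" and Q: "0 \<le> Q"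
    and small: "fact (CARD('d) + 1) * Q ^ (CARD('d) + 1) * r ^ CARD('d) < 1"
  shows "\<exists>(v :: real ^ 'd) t. norm v = 1 \<and> (\<forall>(p :: int ^ 'd) (q :: int). 1 \<le> q \<longrightarrow> of_int q \<le> Q \<longrightarrow>
      (\<forall>i. \<bar>of_int (p $ i) / of_int q - x $ i\<bar> \<le> r) \<longrightarrow>
      v \<bullet> (\<chi> i. of_int (p $ i) / of_int q) = t)"
proof -
  define P where "P p q \<longleftrightarrow> 1 \<le> q \<and> of_int q \<le> Q \<and> (\<forall>i. \<bar>of_int (p $ i) / of_int q - x $ i\<bar> \<le> r)"
    for p :: "int ^ 'd" and q :: int
  define vec :: "int ^ 'd \<Rightarrow> int \<Rightarrow> real ^ 'd option"
    where "vec p q = (\<chi> k. case k of None \<Rightarrow> of_int q | Some i \<Rightarrow> of_int (p $ i))" for p q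
  define V where "V = {vec p q | p q. P p q}"
  have UNIV_sum: "(\<Sum>k\<in>UNIV. g k) = g None + (\<Sum>i\<in>UNIV. g (Some i))" for g :: "'d option \<Rightarrow> real"
    unfolding UNIV_option_conv by (subst sum.insert) (auto simp: sum.reindex)
  have UNIV_prod: "(\<Prod>k\<in>UNIV. g k) = g None * (\<Prod>i\<in>UNIV. g (Some i))" for g :: "'d option \<Rightarrow> real"
    unfolding UNIV_option_conv by (subst prod.insert) (auto simp: prod.reindex)
  have card_opt: "CARD('d option) = CARD('d) + 1" by simp
  have "dim V < DIM(real ^ 'd option)"
  proof (rule ccontr)
    assume "\<not> ?thesis"
    then have dimV: "dim V = CARD('d option)" using dim_subset_UNIV[of V] by simp
    obtain B where B: "B \<subseteq> V" "independent B" "card B = CARD('d option)"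
      using basis_exists[of V] dimV by metis
    have "finite B" using B(2) by (rule independent_bound_general[THEN conjunct1])
    then obtain f where f: "bij_betw f (UNIV :: 'd option set) B"
      using B(3) finite_same_card_bij[of "UNIV :: 'd option set" B] by auto
    define M :: "real ^ 'd option ^ 'd option" where "M = (\<chi> k. f k)"
    have "\<forall>k. \<exists>p q. P p q \<and> f k = vec p q"
      using f B(1) by (force simp: bij_betw_def V_def)
    then obtain p q where pq: "\<And>k. P (p k) (q k)" "\<And>k. f k = vec (p k) (q k)" by metis
    have det0: "det M \<noteq> 0"
    proof -
      have "c k = 0" if "(\<Sum>k\<in>UNIV. c k *s row k M) = 0" for c k
      proof -
        have inj: "inj f" and img: "range f = B" using f by (auto simp: bij_betw_def)
        have "(\<Sum>k\<in>UNIV. c k *s row k M) = (\<Sum>k\<in>UNIV. c k *\<^sub>R f k)"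
          by (simp add: M_def row_def scalar_mult_eq_scaleR)
        also have "\<dots> = (\<Sum>b\<in>B. c (inv f b) *\<^sub>R b)"
          using inj unfolding img[symmetric] by (subst sum.reindex) auto
        finally have "(\<Sum>b\<in>B. c (inv f b) *\<^sub>R b) = 0" using that by simp
        then have "c (inv f (f k)) = 0"
          using B(2) \<open>finite B\<close> img independentD[of B B "\<lambda>b. c (inv f b)" "f k"] by auto
        then show ?thesis using inj by simp
      qed
      then show ?thesis
        unfolding invertible_det_nz[symmetric] invertible_right_inverse
          matrix_right_invertible_independent_rows by blast
    qed
    have M_Ints: "M $ k $ l \<in> \<int>" for k l
      by (auto simp: M_def pq(2) vec_def split: option.split)
    have "det M \<in> \<int>" unfolding det_def
      by (intro Ints_sum Ints_mult Ints_prod M_Ints) auto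
    then have det1: "1 \<le> \<bar>det M\<bar>" using det0 by (rule Ints_nonzero_abs_ge1)
    \<comment> \<open>Right multiplication by this unitriangular matrix subtracts
      \<open>x $ i\<close> times the column of denominators from the \<open>i\<close>-th column of
      numerators. The determinant stays, but the numerator columns now have entries of size at most
      \<open>Q * r\<close>.\<close>
    define U :: "real ^ 'd option ^ 'd option"
      where "U = (\<chi> k l. if k = l then 1 else case (k, l) of (None, Some i) \<Rightarrow> - x $ i | _ \<Rightarrow> 0)"
    have detU: "det U = 1"
    proof -
      have "(\<Prod>k\<in>UNIV. U $ k $ \<sigma> k) = 0" if "\<sigma> permutes UNIV" "\<sigma> \<noteq> id" for \<sigma>
      proof -
        have "\<exists>i. \<sigma> (Some i) \<noteq> Some i"
        proof (rule ccontr)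
          assume "\<not> ?thesis"
          then have *: "\<sigma> (Some i) = Some i" for i by simp
          have "\<sigma> None = None"
          proof (cases "\<sigma> None")
            case (Some i)
            then show ?thesis using * permutes_inj[OF that(1)] by (metis injD option.distinct(1))
          qed
          then have "\<sigma> k = k" for k using * by (cases k) auto
          then show False using that(2) by auto
        qed
        then obtain i where "\<sigma> (Some i) \<noteq> Some i" by blast
        then have "U $ Some i $ \<sigma> (Some i) = 0" by (auto simp: U_def)
        then show ?thesis by (metis UNIV_I finite prod_zero)
      qed
      then have "det U = (\<Sum>\<sigma>\<in>{id}. of_int (sign \<sigma>) * (\<Prod>k\<in>UNIV. U $ k $ \<sigma> k))"
        unfolding det_def by (intro sum.mono_neutral_right) (auto simp: permutes_id finite_permutations)
      then show ?thesis by (simp add: U_def)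
    qed
    define N where "N = M ** U"
    have detN: "det N = det M" by (simp add: N_def det_mul detU)
    have N_None: "N $ k $ None = of_int (q k)" for k
      by (simp add: N_def matrix_matrix_mult_def UNIV_sum U_def M_def pq(2) vec_def)
    have N_Some: "N $ k $ Some i = of_int (p k $ i) - of_int (q k) * x $ i" for k i
    proof -
      have "N $ k $ Some i = - of_int (q k) * x $ i + (\<Sum>j\<in>UNIV. of_int (p k $ j) * (if j = i then 1 else 0))"
        by (auto simp: N_def matrix_matrix_mult_def UNIV_sum U_def M_def pq(2) vec_def intro!: sum.cong)
      also have "(\<Sum>j\<in>UNIV. of_int (p k $ j) * (if j = i then 1 else 0)) = (of_int (p k $ i) :: real)"
        by (simp add: if_distrib[of "(*) _"] cong: if_cong)
      finally show ?thesis by simp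
    qed
    define g :: "'d option \<Rightarrow> real" where "g k = (case k of None \<Rightarrow> Q | Some i \<Rightarrow> Q * r)" for k
    have g0: "0 \<le> g k" for k using r Q by (auto simp: g_def split: option.split)
    have Ng: "\<bar>N $ k $ l\<bar> \<le> g l" for k l
    proof (cases l)
      case None
      then show ?thesis using pq(1)[of k] by (simp add: N_None g_def P_def)
    next
      case (Some i)
      have q: "1 \<le> q k" "of_int (q k) \<le> Q" "\<bar>of_int (p k $ i) / of_int (q k) - x $ i\<bar> \<le> r"
        using pq(1)[of k] by (auto simp: P_def)
      have "N $ k $ Some i = of_int (q k) * (of_int (p k $ i) / of_int (q k) - x $ i)"
        using q(1) by (simp add: N_Some right_diff_distrib)
      then have "\<bar>N $ k $ Some i\<bar> = of_int (q k) * \<bar>of_int (p k $ i) / of_int (q k) - x $ i\<bar>"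
        using q(1) by (simp add: abs_mult)
      also have "\<dots> \<le> Q * r" using q Q by (intro mult_mono) auto
      finally show ?thesis using Some by (simp add: g_def)
    qed
    \<comment> \<open>In the Leibniz formula every product contains one factor of size at most
      \<open>Q\<close> and \<open>CARD('d)\<close> factors of size at most
      \<open>Q * r\<close>.\<close>
    have "\<bar>det N\<bar> \<le> (\<Sum>\<sigma>\<in>{\<sigma>. \<sigma> permutes (UNIV :: 'd option set)}. Q * (Q * r) ^ CARD('d))"
      unfolding det_def
    proof (rule order_trans[OF sum_abs], rule sum_mono)
      fix \<sigma> :: "'d option \<Rightarrow> 'd option" assume "\<sigma> \<in> {\<sigma>. \<sigma> permutes UNIV}"
      then have \<sigma>: "\<sigma> permutes UNIV" by simp
      have "\<bar>of_int (sign \<sigma>) * (\<Prod>k\<in>UNIV. N $ k $ \<sigma> k)\<bar> = (\<Prod>k\<in>UNIV. \<bar>N $ k $ \<sigma> k\<bar>)"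
        by (simp add: abs_mult abs_prod sign_def)
      also have "\<dots> \<le> (\<Prod>k\<in>UNIV. g (\<sigma> k))" using Ng by (intro prod_mono) auto
      also have "\<dots> = (\<Prod>k\<in>UNIV. g k)" using prod.permute[OF \<sigma>, of g] by (simp add: o_def)
      also have "\<dots> = Q * (Q * r) ^ CARD('d)" unfolding UNIV_prod by (simp add: g_def)
      finally show "\<bar>of_int (sign \<sigma>) * (\<Prod>k\<in>UNIV. N $ k $ \<sigma> k)\<bar> \<le> Q * (Q * r) ^ CARD('d)" .
    qed
    also have "\<dots> = fact (CARD('d) + 1) * Q ^ (CARD('d) + 1) * r ^ CARD('d)"
      using card_permutations[OF card_opt] by (simp add: power_mult_distrib algebra_simps)
    also have "\<dots> < 1" by (rule small)
    finally show False using det1 detN by simp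
  qed
  then obtain a where a: "a \<noteq> 0" "span V \<subseteq> {y. a \<bullet> y = 0}" using lowdim_subset_hyperplane by blast
  define v :: "real ^ 'd" where "v = (\<chi> i. a $ Some i)"
  have aV: "v \<bullet> (\<chi> i. of_int (p $ i) / of_int q) = - (a $ None)" if "P p q" for p q
  proof -
    have "a \<bullet> vec p q = 0" using a(2) that span_base[of "vec p q" V] by (auto simp: V_def)
    then have "a $ None * of_int q + (\<Sum>i\<in>UNIV. a $ Some i * of_int (p $ i)) = 0"
      by (simp add: inner_vec_def UNIV_sum vec_def)
    moreover have "v \<bullet> (\<chi> i. of_int (p $ i) / of_int q) = (\<Sum>i\<in>UNIV. a $ Some i * of_int (p $ i)) / of_int q"
      by (simp add: inner_vec_def v_def sum_divide_distrib)
    moreover have "of_int q \<noteq> (0::real)" using that by (simp add: P_def)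
    ultimately show ?thesis by (simp add: divide_eq_eq)
  qed
  show ?thesis
  \<comment> \<open>If \<open>a\<close> sees only the denominator, any admissible point would force
    \<open>a = 0\<close>. So there are no such points and every unit vector will do.\<close>
  proof (cases "v = 0")
    case True
    have "\<not> P p q" for p q
    proof
      assume P: "P p q"
      have "a $ k = 0" for k
        using aV[OF P] True by (cases k) (simp, simp add: v_def vec_eq_iff)
      then show False using a(1) by (simp add: vec_eq_iff)
    qed
    then show ?thesis unfolding P_def
      by (intro exI[of _ "axis undefined 1"] exI[of _ 0]) (auto simp: norm_axis_1)
  next
    case False
    show ?thesis
    proof (rule exI[of _ "v /\<^sub>R norm v"], rule exI[of _ "- (a $ None) / norm v"], intro conjI allI impI)
      show "norm (v /\<^sub>R norm v) = 1" using False by simp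
      fix p :: "int ^ 'd" and q :: int
      assume "1 \<le> q" "of_int q \<le> Q" "\<forall>i. \<bar>of_int (p $ i) / of_int q - x $ i\<bar> \<le> r"
      then have "P p q" by (simp add: P_def)
      from aV[OF this] show "(v /\<^sub>R norm v) \<bullet> (\<chi> i. of_int (p $ i) / of_int q) = - (a $ None) / norm v"
        by (simp add: divide_inverse)
    qed
  qed
qed

section \<open>Cylinders of a sponge\<close>

definition scales :: "real \<Rightarrow> (real \<Rightarrow> real) \<Rightarrow> bool" where
  "scales r f \<longleftrightarrow> (\<forall>x\<in>{0..1}. \<forall>y\<in>{0..1}. dist (f x) (f y) = r * dist x y)"

lemma contraction_ratio_eqI:
  assumes "scales r f" shows "contraction_ratio f = r"
  unfolding contraction_ratio_def
proof (rule the_equality)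
  show "\<forall>x\<in>{0..1}. \<forall>y\<in>{0..1}. dist (f x) (f y) = r * dist x y" using assms by (simp add: scales_def)
  fix r' assume "\<forall>x\<in>{0..1}. \<forall>y\<in>{0..1}. dist (f x) (f y) = r' * dist x y"
  then have "dist (f 0) (f 1) = r' * dist (0::real) 1" by (metis atLeastAtMost_iff order_refl zero_le_one)
  moreover have "dist (f 0) (f 1) = r * dist (0::real) 1" using assms unfolding scales_def
    by (metis atLeastAtMost_iff order_refl zero_le_one)
  ultimately show "r' = r" by simp
qed

lemma contracting_similarityD:
  assumes "contracting_similarity f"
  shows "scales (contraction_ratio f) f" "0 < contraction_ratio f" "contraction_ratio f < 1"
    "\<And>x. x \<in> {0..1} \<Longrightarrow> f x \<in> {0..1}"
proof -
  obtain r where r: "0 < r" "r < 1" "scales r f" using assms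
    unfolding contracting_similarity_def scales_def by blast
  have "contraction_ratio f = r" using r(3) by (rule contraction_ratio_eqI)
  with r show "scales (contraction_ratio f) f" "0 < contraction_ratio f" "contraction_ratio f < 1" by auto
  show "\<And>x. x \<in> {0..1} \<Longrightarrow> f x \<in> {0..1}" using assms unfolding contracting_similarity_def by blast
qed

text \<open>The distances of \<open>f x\<close> to \<open>f 0\<close> and to \<open>f 1\<close>
  leave only one possibility for \<open>f x\<close>; the sign of \<open>d\<close> records the
  orientation.\<close>

lemma scales_affine:
  assumes "scales r f" "0 < r"
  obtains d where "\<bar>d\<bar> = r" "\<And>x. x \<in> {0..1} \<Longrightarrow> f x = f 0 + d * x"
proof (rule that)
  have s: "\<bar>f x - f y\<bar> = r * \<bar>x - y\<bar>" if "x \<in> {0..1}" "y \<in> {0..1}" for x y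
    using assms(1) that by (auto simp: scales_def dist_real_def)
  show d: "\<bar>f 1 - f 0\<bar> = r" using s[of 1 0] by simp
  fix x :: real assume x: "x \<in> {0..1}"
  have 1: "\<bar>f x - f 0\<bar> = r * x" using s[of x 0] x by simp
  have 2: "\<bar>f x - f 1\<bar> = r - r * x" using s[of x 1] x by (simp add: right_diff_distrib)
  have 3: "0 \<le> r * x" "r * x \<le> r" using x assms(2) by (auto simp: mult_le_cancel_left1)
  show "f x = f 0 + (f 1 - f 0) * x"
  proof (cases "f 1 - f 0 = r")
    case True
    then have "f x - f 0 = r * x" using 1 2 3 by linarith
    then show ?thesis using True by simp
  next
    case False
    then have *: "f 1 - f 0 = - r" using d assms(2) by linarith
    then have "f x - f 0 = - (r * x)" using 1 2 3 by linarith
    then show ?thesis using * by simp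
  qed
qed

text \<open>Balls about the image of the midpoint describe the image without a distinction between
  the two orientations.\<close>

lemma scales_image_ball:
  assumes "scales r f" "0 < r"
  shows "f ` {0<..<1} = ball (f (1/2)) (r / 2)" "f ` {0..1} = cball (f (1/2)) (r / 2)"
proof -
  obtain d where d: "\<bar>d\<bar> = r" "\<And>x. x \<in> {0..1} \<Longrightarrow> f x = f 0 + d * x"
    using scales_affine[OF assms] by metis
  have c: "f (1/2) = f 0 + d / 2" using d(2)[of "1/2"] by simp
  have d0: "d \<noteq> 0" using d(1) assms(2) by auto
  have dist: "dist (f (1/2)) (f x) = r * \<bar>1/2 - x\<bar>" if "x \<in> {0..1}" for x
    using assms(1) that unfolding scales_def by (auto simp: dist_real_def)
  have inv: "\<exists>x. z = f 0 + d * x \<and> r * \<bar>1/2 - x\<bar> = dist (f (1/2)) z" for z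
  proof (intro exI conjI)
    show eq: "z = f 0 + d * ((z - f 0) / d)" using d0 by simp
    have "dist (f (1/2)) z = \<bar>d * (1/2 - (z - f 0) / d)\<bar>"
      unfolding c dist_real_def by (subst (1) eq) (simp add: right_diff_distrib)
    then show "r * \<bar>1/2 - (z - f 0) / d\<bar> = dist (f (1/2)) z" by (simp only: abs_mult d(1))
  qed
  have lt: "r * y < r / 2 \<longleftrightarrow> y < 1/2" for y
    using mult_less_cancel_left_pos[OF assms(2), of y "1/2"] by simp
  have le: "r * y \<le> r / 2 \<longleftrightarrow> y \<le> 1/2" for y
    using mult_le_cancel_left_pos[OF assms(2), of y "1/2"] by simp
  show "f ` {0<..<1} = ball (f (1/2)) (r / 2)"
  proof (intro equalityI subsetI)
    fix z assume "z \<in> f ` {0<..<1}"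
    then obtain x where x: "x \<in> {0<..<1}" "z = f x" by blast
    then have "r * \<bar>1/2 - x\<bar> < r / 2" unfolding lt by (auto simp: abs_if)
    then show "z \<in> ball (f (1/2)) (r / 2)" using dist[of x] x unfolding mem_ball by auto
  next
    fix z assume z: "z \<in> ball (f (1/2)) (r / 2)"
    obtain x where x: "z = f 0 + d * x" "r * \<bar>1/2 - x\<bar> = dist (f (1/2)) z" using inv by blast
    then have "r * \<bar>1/2 - x\<bar> < r / 2" using z by simp
    then have "x \<in> {0<..<1}" unfolding lt by (auto simp: abs_if split: if_splits)
    moreover from this have "z = f x" using d(2)[of x] x(1) by auto
    ultimately show "z \<in> f ` {0<..<1}" by blast
  qed
  show "f ` {0..1} = cball (f (1/2)) (r / 2)"
  proof (intro equalityI subsetI)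
    fix z assume "z \<in> f ` {0..1}"
    then obtain x where x: "x \<in> {0..1}" "z = f x" by blast
    then have "r * \<bar>1/2 - x\<bar> \<le> r / 2" unfolding le by (auto simp: abs_if)
    then show "z \<in> cball (f (1/2)) (r / 2)" using dist[of x] x unfolding mem_cball by auto
  next
    fix z assume z: "z \<in> cball (f (1/2)) (r / 2)"
    obtain x where x: "z = f 0 + d * x" "r * \<bar>1/2 - x\<bar> = dist (f (1/2)) z" using inv by blast
    then have "r * \<bar>1/2 - x\<bar> \<le> r / 2" using z by simp
    then have "x \<in> {0..1}" unfolding le by (auto simp: abs_if split: if_splits)
    moreover from this have "z = f x" using d(2)[of x] x(1) by auto
    ultimately show "z \<in> f ` {0..1}" by blast
  qed
qed

lemma scales_comp:
  assumes "scales r f" "scales s g" "\<And>x. x \<in> {0..1} \<Longrightarrow> g x \<in> {0..1}"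
  shows "scales (r * s) (f \<circ> g)"
  using assms by (simp add: scales_def)

text \<open>The image of the open interval is open and contained in \<open>{0..1}\<close>, hence in
  its interior.\<close>

lemma contracting_similarity_open_interval:
  assumes "contracting_similarity f" "x \<in> {0<..<1}"
  shows "f x \<in> {0<..<1}"
proof -
  note f = contracting_similarityD[OF assms(1)]
  have "f ` {0<..<1} \<subseteq> {0..1}"
  proof (rule image_subsetI)
    fix y :: real assume "y \<in> {0<..<1}"
    then have "y \<in> {0..1}" by auto
    then show "f y \<in> {0..1}" by (rule f(4))
  qed
  moreover have "open (f ` {0<..<1})" unfolding scales_image_ball(1)[OF f(1,2)] by simp
  ultimately have "f ` {0<..<1} \<subseteq> interior {0..1}" by (rule interior_maximal)
  then have "f x \<in> interior {0..1}" using assms(2) by blast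
  then show ?thesis by simp
qed

primrec coord_map :: "('a \<Rightarrow> real \<Rightarrow> real) \<Rightarrow> (nat \<Rightarrow> 'a) \<Rightarrow> nat \<Rightarrow> real \<Rightarrow> real" where
  "coord_map f w 0 = id"
| "coord_map f w (Suc n) = coord_map f w n \<circ> f (w n)"

lemma word_map_nth: "word_map \<phi> \<omega> n x $ i = coord_map (\<phi> i) (\<lambda>l. \<omega> l i) n (x $ i)"
  by (induction n arbitrary: x) (auto simp: diag_map_def)

lemma coord_map_cong: "(\<And>l. l < n \<Longrightarrow> w l = w' l) \<Longrightarrow> coord_map f w n = coord_map f w' n"
  by (induction n) auto

lemma coord_map_add: "coord_map f w (n + m) = coord_map f w n \<circ> coord_map f (\<lambda>l. w (n + l)) m"
  by (induction m) (auto simp: o_assoc)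

lemma coord_map_in:
  assumes "\<And>l. contracting_similarity (f (w l))" "x \<in> {0..1}"
  shows "coord_map f w n x \<in> {0..1}"
  using assms(2)
proof (induction n arbitrary: x)
  case (Suc n)
  then show ?case using contracting_similarityD(4)[OF assms(1)[of n]] by simp
qed simp

lemma coord_map_scales:
  assumes "\<And>l. contracting_similarity (f (w l))"
  shows "scales (\<Prod>l<n. contraction_ratio (f (w l))) (coord_map f w n)"
proof (induction n)
  case 0 show ?case by (simp add: scales_def)
next
  case (Suc n)
  show ?case
    using scales_comp[OF Suc contracting_similarityD(1,4)[OF assms(1)[of n]]] by (simp add: comp_def)
qed

text \<open>Up to the first difference both words define the same injective map, which preserves the
  disjointness of the one-letter images; further letters only shrink the images.\<close>

lemma coord_map_disjoint:
  assumes sim: "\<And>a. a \<in> A \<Longrightarrow> contracting_similarity (f a)"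
    and dj: "disjoint_family_on (\<lambda>a. f a ` {0<..<1}) A"
    and w: "\<And>l. w l \<in> A" "\<And>l. w' l \<in> A"
  shows "\<exists>l<n. w l \<noteq> w' l \<Longrightarrow> coord_map f w n ` {0<..<1} \<inter> coord_map f w' n ` {0<..<1} = {}"
proof (induction n)
  case (Suc n)
  have in01: "f (v n) ` {0<..<1} \<subseteq> {0<..<1}" if "v n \<in> A" for v
    using contracting_similarity_open_interval[OF sim[OF that]] by blast
  show ?case
  proof (cases "\<exists>l<n. w l \<noteq> w' l")
    case True
    have "coord_map f w (Suc n) ` {0<..<1} \<subseteq> coord_map f w n ` {0<..<1}"
      "coord_map f w' (Suc n) ` {0<..<1} \<subseteq> coord_map f w' n ` {0<..<1}"
      using in01[of w] in01[of w'] w by (auto simp: image_comp[symmetric])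
    then show ?thesis using Suc.IH[OF True] by blast
  next
    case False
    have eq: "coord_map f w' n = coord_map f w n" by (rule coord_map_cong) (use False in auto)
    have ne: "w n \<noteq> w' n" using Suc.prems False less_Suc_eq by blast
    have disj: "f (w n) ` {0<..<1} \<inter> f (w' n) ` {0<..<1} = {}"
      using dj w ne by (auto simp: disjoint_family_on_def)
    have inj: "inj_on (coord_map f w n) {0..1}"
    proof (rule inj_onI)
      fix x y :: real assume xy: "x \<in> {0..1}" "y \<in> {0..1}" "coord_map f w n x = coord_map f w n y"
      have "dist (coord_map f w n x) (coord_map f w n y) = (\<Prod>l<n. contraction_ratio (f (w l))) * dist x y"
        using coord_map_scales[of f w n, OF sim[OF w(1)]] xy(1,2) unfolding scales_def by blast
      then have "(\<Prod>l<n. contraction_ratio (f (w l))) * dist x y = 0" using xy(3) by simp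
      moreover have "(\<Prod>l<n. contraction_ratio (f (w l))) \<noteq> 0"
        using contracting_similarityD(2)[OF sim[OF w(1)]] by (metis less_irrefl prod_pos)
      ultimately show "x = y" by simp
    qed
    have sub: "f (w n) ` {0<..<1} \<subseteq> {0..1}" "f (w' n) ` {0<..<1} \<subseteq> {0..1}"
      by (rule order_trans[OF in01], use w in simp, rule greaterThanLessThan_subseteq_atLeastAtMost_iff[THEN iffD2], simp)+
    have "coord_map f w n ` (f (w n) ` {0<..<1}) \<inter> coord_map f w n ` (f (w' n) ` {0<..<1}) = {}"
      unfolding inj_on_image_Int[OF inj sub, symmetric] disj by (rule image_empty)
    then show ?thesis unfolding coord_map.simps eq image_comp[symmetric] .
  qed
qed simp

locale sponge_ifs =
  fixes A :: "'d::finite \<Rightarrow> 'a set" and \<phi> :: "'d \<Rightarrow> 'a \<Rightarrow> real \<Rightarrow> real" and E :: "('d \<Rightarrow> 'a) set"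
  assumes ifs: "diagonal_IFS A \<phi> E"
begin

definition rate :: "'d \<Rightarrow> ('d \<Rightarrow> 'a) \<Rightarrow> real" where
  "rate i a = - ln (contraction_ratio (\<phi> i (a i)))"

definition rsum :: "'d \<Rightarrow> (nat \<Rightarrow> 'd \<Rightarrow> 'a) \<Rightarrow> nat \<Rightarrow> real" where
  "rsum i \<omega> n = (\<Sum>l<n. rate i (\<omega> l))"

abbreviation seqs :: "(nat \<Rightarrow> 'd \<Rightarrow> 'a) set" where "seqs \<equiv> \<Pi>\<^sub>E n\<in>UNIV. E"

lemma seqs_iff: "\<omega> \<in> seqs \<longleftrightarrow> (\<forall>l. \<omega> l \<in> E)" by (auto simp: PiE_iff)

lemma seqsD: "\<omega> \<in> seqs \<Longrightarrow> \<omega> l \<in> E" by auto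

lemma E_A: "a \<in> E \<Longrightarrow> a i \<in> A i"
  using ifs by (auto simp: diagonal_IFS_def PiE_iff)

lemma sim_A: "a \<in> A i \<Longrightarrow> contracting_similarity (\<phi> i a)"
  using ifs by (auto simp: diagonal_IFS_def)

lemma sim: "a \<in> E \<Longrightarrow> contracting_similarity (\<phi> i (a i))"
  using E_A sim_A by blast

lemma finite_E: "finite E"
proof -
  have "finite (\<Pi>\<^sub>E i\<in>UNIV. A i)" using ifs by (intro finite_PiE) (auto simp: diagonal_IFS_def)
  then show ?thesis using ifs finite_subset by (auto simp: diagonal_IFS_def)
qed

lemma E_ne: "E \<noteq> {}" using ifs by (simp add: diagonal_IFS_def)

lemma ratio_eq: "a \<in> E \<Longrightarrow> contraction_ratio (\<phi> i (a i)) = exp (- rate i a)"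
  using contracting_similarityD(2)[OF sim] by (simp add: rate_def)

lemma rate_pos: "a \<in> E \<Longrightarrow> 0 < rate i a"
  using contracting_similarityD(2,3)[OF sim] by (simp add: rate_def)

lemma rate_bounds: obtains c C where "0 < c" "c \<le> C" "\<And>i a. a \<in> E \<Longrightarrow> c \<le> rate i a \<and> rate i a \<le> C"
proof -
  let ?R = "(\<lambda>(i, a). rate i a) ` (UNIV \<times> E)"
  have R: "finite ?R" "?R \<noteq> {}" using finite_E E_ne by auto
  have "Min ?R \<in> ?R" using R by (rule Min_in)
  then have "0 < Min ?R" using rate_pos by auto
  moreover have "Min ?R \<le> rate i a \<and> rate i a \<le> Max ?R" if "a \<in> E" for i a
    using R that by (auto intro!: Min_le Max_ge)
  moreover have "Min ?R \<le> Max ?R" using R by (meson Max_ge Min_in)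
  ultimately show ?thesis using that by blast
qed

lemma coord_scales:
  assumes "\<omega> \<in> seqs"
  shows "scales (exp (- rsum i \<omega> n)) (coord_map (\<phi> i) (\<lambda>l. \<omega> l i) n)"
proof -
  have "(\<Prod>l<n. contraction_ratio (\<phi> i (\<omega> l i))) = exp (- rsum i \<omega> n)"
    using seqsD[OF assms] by (simp add: ratio_eq rsum_def exp_sum sum_negf[symmetric])
  then show ?thesis using coord_map_scales[of "\<phi> i" "\<lambda>l. \<omega> l i" n] sim seqsD[OF assms] by simp
qed

lemma rsum_tendsto:
  assumes "\<omega> \<in> seqs"
  shows "filterlim (rsum i \<omega>) at_top sequentially"
proof -
  obtain c C where c: "0 < c" "\<And>i a. a \<in> E \<Longrightarrow> c \<le> rate i a \<and> rate i a \<le> C" using rate_bounds by metis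
  have "real n * c \<le> rsum i \<omega> n" for n
    using sum_mono[of "{..<n}" "\<lambda>_. c" "\<lambda>l. rate i (\<omega> l)"] c seqsD[OF assms] by (simp add: rsum_def)
  moreover have "filterlim (\<lambda>n. real n * c) at_top sequentially"
    using c(1) by real_asymp
  ultimately show ?thesis by (auto intro: filterlim_at_top_mono)
qed

lemma coord_map_Cauchy:
  assumes "\<omega> \<in> seqs"
  shows "Cauchy (\<lambda>n. coord_map (\<phi> i) (\<lambda>l. \<omega> l i) n 0)"
proof (rule metric_CauchyI)
  let ?g = "coord_map (\<phi> i) (\<lambda>l. \<omega> l i)"
  fix e :: real assume "0 < e"
  have "((\<lambda>n. exp (- rsum i \<omega> n)) \<longlongrightarrow> 0) sequentially"
    using rsum_tendsto[OF assms] by (intro filterlim_compose[OF exp_at_bot])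
      (simp add: filterlim_uminus_at_bot)
  then have "eventually (\<lambda>n. exp (- rsum i \<omega> n) < e / 2) sequentially"
    using \<open>0 < e\<close> by (intro order_tendstoD) auto
  then obtain N where N: "\<And>n. n \<ge> N \<Longrightarrow> exp (- rsum i \<omega> n) < e / 2" by (auto simp: eventually_sequentially)
  have close: "dist (?g n 0) (?g N 0) < e / 2" if "n \<ge> N" for n
  proof -
    define y where "y = coord_map (\<phi> i) (\<lambda>l. \<omega> (N + l) i) (n - N) 0"
    have y: "y \<in> {0..1}" unfolding y_def using sim seqsD[OF assms] by (intro coord_map_in) auto
    have "?g n 0 = ?g N y" using coord_map_add[of "\<phi> i" "\<lambda>l. \<omega> l i" N "n - N"] that by (simp add: y_def)
    then have "dist (?g n 0) (?g N 0) = exp (- rsum i \<omega> N) * dist y 0"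
      using coord_scales[OF assms, of i N] y by (simp add: scales_def)
    also have "\<dots> \<le> exp (- rsum i \<omega> N) * 1" using y by (intro mult_left_mono) auto
    finally show ?thesis using N[of N] by simp
  qed
  show "\<exists>M. \<forall>m\<ge>M. \<forall>n\<ge>M. dist (?g m 0) (?g n 0) < e"
  proof (intro exI[of _ N] allI impI)
    fix m n assume "N \<le> m" "N \<le> n"
    then show "dist (?g m 0) (?g n 0) < e" using close dist_triangle_half_l by blast
  qed
qed

lemma coding_map_LIMSEQ:
  assumes "\<omega> \<in> seqs"
  shows "(\<lambda>n. word_map \<phi> \<omega> n 0) \<longlonglongrightarrow> coding_map \<phi> \<omega>"
proof -
  have "\<exists>L. (\<lambda>n. coord_map (\<phi> i) (\<lambda>l. \<omega> l i) n 0) \<longlonglongrightarrow> L" for i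
    using coord_map_Cauchy[OF assms] by (simp add: Cauchy_convergent_iff convergent_def)
  then obtain L where "\<And>i. (\<lambda>n. coord_map (\<phi> i) (\<lambda>l. \<omega> l i) n 0) \<longlonglongrightarrow> L i" by metis
  then have "(\<lambda>n. word_map \<phi> \<omega> n 0) \<longlonglongrightarrow> (\<chi> i. L i)"
    by (intro vec_tendstoI) (simp add: word_map_nth)
  then show ?thesis unfolding coding_map_def by (simp add: limI)
qed

lemma coding_map_in:
  assumes "\<omega> \<in> seqs"
  shows "coding_map \<phi> \<omega> $ i \<in> coord_map (\<phi> i) (\<lambda>l. \<omega> l i) n ` {0..1}"
proof -
  let ?g = "coord_map (\<phi> i) (\<lambda>l. \<omega> l i)"
  have "(\<lambda>m. ?g m 0) \<longlonglongrightarrow> coding_map \<phi> \<omega> $ i"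
    using tendsto_vec_nth[OF coding_map_LIMSEQ[OF assms], of i] by (simp add: word_map_nth)
  moreover have "closed (?g n ` {0..1})"
    unfolding scales_image_ball(2)[OF coord_scales[OF assms] exp_gt_zero] by simp
  moreover have "eventually (\<lambda>m. ?g m 0 \<in> ?g n ` {0..1}) sequentially"
    using eventually_ge_at_top[of n]
  proof eventually_elim
    case (elim m)
    have "coord_map (\<phi> i) (\<lambda>l. \<omega> (n + l) i) (m - n) 0 \<in> {0..1}" using sim seqsD[OF assms] by (intro coord_map_in) auto
    then show ?case using coord_map_add[of "\<phi> i" "\<lambda>l. \<omega> l i" n "m - n"] elim by auto
  qed
  ultimately show ?thesis by (intro Lim_in_closed_set[of "?g n ` {0..1}" _ sequentially]) auto
qed

lemma coding_map_close:
  assumes "\<omega> \<in> seqs" "\<tau> \<in> seqs" "\<And>l. l < n \<Longrightarrow> \<omega> l i = \<tau> l i"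
  shows "\<bar>coding_map \<phi> \<omega> $ i - coding_map \<phi> \<tau> $ i\<bar> \<le> exp (- rsum i \<omega> n)"
proof -
  let ?g = "coord_map (\<phi> i) (\<lambda>l. \<omega> l i) n"
  have "coord_map (\<phi> i) (\<lambda>l. \<tau> l i) n = ?g" using assms(3) by (intro coord_map_cong) auto
  then obtain x y where "x \<in> {0..1}" "y \<in> {0..1}" "coding_map \<phi> \<omega> $ i = ?g x" "coding_map \<phi> \<tau> $ i = ?g y"
    using coding_map_in[OF assms(1), of i n] coding_map_in[OF assms(2), of i n] by auto
  moreover have "dist (?g x) (?g y) = exp (- rsum i \<omega> n) * dist x y"
    using coord_scales[OF assms(1), of i n] calculation unfolding scales_def by blast
  moreover have "dist x y \<le> 1" using calculation by (auto simp: dist_real_def)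
  ultimately show ?thesis by (simp add: dist_real_def mult_le_cancel_left1)
qed

end

section \<open>Sponges with constant contraction ratios\<close>

text \<open>When \<open>xs\<close> lists the coordinates by decreasing level, those still active at
  position \<open>l\<close> form an initial segment.\<close>

lemma level_set_eq_take:
  fixes n :: "'d \<Rightarrow> nat"
  assumes xs: "set xs = UNIV"
    and dec: "\<And>k k'. k \<le> k' \<Longrightarrow> k' < length xs \<Longrightarrow> n (xs ! k') \<le> n (xs ! k)"
  obtains j where "j \<le> length xs" "{i. l < n i} = set (take j xs)"
    "\<And>k. k < length xs \<Longrightarrow> l < n (xs ! k) \<longleftrightarrow> k < j"
proof -
  define j where "j = (if \<exists>k<length xs. \<not> l < n (xs ! k) then LEAST k. k < length xs \<and> \<not> l < n (xs ! k) else length xs)"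
  have jle: "j \<le> length xs"
  proof (cases "\<exists>k<length xs. \<not> l < n (xs ! k)")
    case True
    then show ?thesis using LeastI_ex[of "\<lambda>k. k < length xs \<and> \<not> l < n (xs ! k)"] by (simp add: j_def)
  next
    case False
    show ?thesis unfolding j_def if_not_P[OF False] by simp
  qed
  have iff: "l < n (xs ! k) \<longleftrightarrow> k < j" if k: "k < length xs" for k
  proof (cases "\<exists>k<length xs. \<not> l < n (xs ! k)")
    case True
    then have j_eq: "j = (LEAST k. k < length xs \<and> \<not> l < n (xs ! k))" by (simp add: j_def)
    have "j < length xs \<and> \<not> l < n (xs ! j)" unfolding j_eq using True by (rule LeastI_ex)
    then have j: "j < length xs" "\<not> l < n (xs ! j)" by auto
    have j3: "l < n (xs ! k)" if "k < j" "k < length xs" for k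
      using not_less_Least[OF that(1)[unfolded j_eq]] that(2) by blast
    show ?thesis
    proof (cases "k < j")
      case True
      then show ?thesis using j3 k by blast
    next
      case False
      then show ?thesis using j(2) dec[of j k] k by simp
    qed
  next
    case False
    then have "l < n (xs ! k)" using k by blast
    then show ?thesis using k unfolding j_def if_not_P[OF False] by simp
  qed
  have "{i. l < n i} = set (take j xs)"
  proof (intro equalityI subsetI)
    fix i assume "i \<in> {i. l < n i}"
    moreover obtain k where "k < length xs" "xs ! k = i" using xs by (metis UNIV_I in_set_conv_nth)
    ultimately show "i \<in> set (take j xs)" using iff[of k] by (auto simp: in_set_conv_nth intro!: exI[of _ k])
  next
    fix i assume "i \<in> set (take j xs)"
    then obtain k where "k < length xs" "k < j" "xs ! k = i" by (auto simp: in_set_conv_nth)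
    then show "i \<in> {i. l < n i}" using iff[of k] by auto
  qed
  then show ?thesis using that jle iff by blast
qed

text \<open>Summation by parts: at each position \<open>g\<close> telescopes along the initial
  segments of \<open>xs\<close>, and after interchanging the sums the \<open>k\<close>-th increment
  occurs once for each position below \<open>n (xs ! k)\<close>.\<close>

lemma sum_over_levels:
  fixes n :: "'d \<Rightarrow> nat" and g :: "'d set \<Rightarrow> real"
  assumes xs: "set xs = UNIV"
    and dec: "\<And>k k'. k \<le> k' \<Longrightarrow> k' < length xs \<Longrightarrow> n (xs ! k') \<le> n (xs ! k)"
    and g: "g {} = 0" and M: "\<And>i. n i \<le> M"
  shows "(\<Sum>l<M. g {i. l < n i}) =
    (\<Sum>k<length xs. real (n (xs ! k)) * (g (set (take (Suc k) xs)) - g (set (take k xs))))"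
proof -
  let ?c = "\<lambda>k. g (set (take k xs))"
  have "g {i. l < n i} = (\<Sum>k<length xs. if l < n (xs ! k) then ?c (Suc k) - ?c k else 0)" for l
  proof -
    obtain j where j: "j \<le> length xs" "{i. l < n i} = set (take j xs)"
      "\<And>k. k < length xs \<Longrightarrow> l < n (xs ! k) \<longleftrightarrow> k < j" using level_set_eq_take[of xs n l] xs dec by metis
    have "(\<Sum>k<length xs. if l < n (xs ! k) then ?c (Suc k) - ?c k else 0) = (\<Sum>k<j. ?c (Suc k) - ?c k)"
      using j(1,3) by (intro sum.mono_neutral_cong_right) auto
    also have "\<dots> = ?c j - ?c 0" by (rule sum_lessThan_telescope)
    finally show ?thesis using j(2) g by simp
  qed
  then have "(\<Sum>l<M. g {i. l < n i}) = (\<Sum>l<M. \<Sum>k<length xs. if l < n (xs ! k) then ?c (Suc k) - ?c k else 0)"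
    by simp
  also have "\<dots> = (\<Sum>k<length xs. \<Sum>l<M. if l < n (xs ! k) then ?c (Suc k) - ?c k else 0)" by (rule sum.swap)
  also have "\<dots> = (\<Sum>k<length xs. real (n (xs ! k)) * (?c (Suc k) - ?c k))"
  proof (rule sum.cong[OF refl])
    fix k
    have "(\<Sum>l<M. if l < n (xs ! k) then ?c (Suc k) - ?c k else 0) = (\<Sum>l<n (xs ! k). ?c (Suc k) - ?c k)"
      using M[of "xs ! k"] by (intro sum.mono_neutral_cong_right) auto
    then show "(\<Sum>l<M. if l < n (xs ! k) then ?c (Suc k) - ?c k else 0) = real (n (xs ! k)) * (?c (Suc k) - ?c k)"
      by simp
  qed
  finally show ?thesis .
qed

text \<open>Sequences that agree lie in the same approximate cube: the number of fixed letters
  depends on the coordinate, because the contraction does.\<close>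

definition agree :: "('d \<Rightarrow> nat) \<Rightarrow> (nat \<Rightarrow> 'd \<Rightarrow> 'a) \<Rightarrow> (nat \<Rightarrow> 'd \<Rightarrow> 'a) \<Rightarrow> bool" where
  "agree n \<omega> \<tau> \<longleftrightarrow> (\<forall>i. \<forall>l<n i. \<omega> l i = \<tau> l i)"

lemma agree_sym: "agree n \<omega> \<tau> \<Longrightarrow> agree n \<tau> \<omega>"
  by (simp add: agree_def)

lemma agree_trans: "agree n \<omega> \<tau> \<Longrightarrow> agree n \<tau> \<sigma> \<Longrightarrow> agree n \<omega> \<sigma>"
  by (simp add: agree_def)

lemma agree_mono: "agree n' \<omega> \<tau> \<Longrightarrow> (\<And>i. n i \<le> n' i) \<Longrightarrow> agree n \<omega> \<tau>"
  unfolding agree_def using less_le_trans by blast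

text \<open>What is needed of the alphabet of blocks. By \<open>fibres\<close>, the number of
  subcylinders does not depend on the cylinder; \<open>diffuse\<close> provides the change of letter
  that moves a point off a hyperplane.\<close>

locale homogeneous_sponge = sponge_ifs A \<phi> E
  for A :: "'d::finite \<Rightarrow> 'a set" and \<phi> :: "'d \<Rightarrow> 'a \<Rightarrow> real \<Rightarrow> real" and E :: "('d \<Rightarrow> 'a) set" +
  fixes lam :: "'d \<Rightarrow> real"
  assumes baranski: "baranski A \<phi>"
    and rate_eq: "a \<in> E \<Longrightarrow> rate i a = lam i"
    and fibres: "I \<subseteq> J \<Longrightarrow> a \<in> E \<Longrightarrow>
      card ((\<lambda>b. restrict b J) ` {b \<in> E. restrict b I = restrict a I}) * card ((\<lambda>b. restrict b I) ` E) =
      card ((\<lambda>b. restrict b J) ` E)"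
    and diffuse: "a \<in> E \<Longrightarrow> \<exists>b\<in>E. b i \<noteq> a i \<and> (\<forall>j. a j \<noteq> b j \<longrightarrow> j = i \<or> lam i < lam j)"
begin

lemma lam_pos: "0 < lam i"
  using E_ne rate_pos rate_eq by fastforce

lemma rsum_eq: "\<omega> \<in> seqs \<Longrightarrow> rsum i \<omega> n = n * lam i"
  by (simp add: rsum_def rate_eq seqsD)

text \<open>At level \<open>lev L i\<close> the \<open>i\<close>-th side of a cylinder has length about \<open>exp (- L)\<close>.\<close>

definition lev :: "real \<Rightarrow> 'd \<Rightarrow> nat" where "lev L i = nat \<lceil>L / lam i\<rceil>"

lemma lev_ge: "L \<le> lev L i * lam i"
proof -
  have "L / lam i \<le> lev L i" by (simp add: lev_def le_nat_iff ceiling_le_iff) linarith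
  then show ?thesis using lam_pos[of i] by (simp add: divide_le_eq)
qed

lemma lev_less: "0 \<le> L \<Longrightarrow> lev L i * lam i < L + lam i"
proof -
  assume "0 \<le> L"
  then have "0 \<le> L / lam i" using lam_pos[of i] by simp
  then have "real (lev L i) = of_int \<lceil>L / lam i\<rceil>" unfolding lev_def by simp
  then have "lev L i < L / lam i + 1" by linarith
  then show ?thesis using lam_pos[of i] by (simp add: field_simps)
qed

lemma lev_mono: "L \<le> L' \<Longrightarrow> lev L i \<le> lev L' i"
  unfolding lev_def using lam_pos[of i] by (intro nat_mono ceiling_mono divide_right_mono) auto

section \<open>Cylinders of a given size: their number and their distances\<close>

definition card_proj :: "'d set \<Rightarrow> nat" where "card_proj I = card ((\<lambda>b. restrict b I) ` E)"

lemma card_proj_pos: "1 \<le> card_proj I"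
  using finite_E E_ne by (simp add: card_proj_def Suc_le_eq card_gt_0_iff)

lemma card_proj_empty: "card_proj {} = 1"
proof -
  have "(\<lambda>b. restrict b {}) ` E = {\<lambda>_. undefined}"
    using E_ne by (simp add: restrict_def image_constant_conv)
  then show ?thesis by (simp add: card_proj_def)
qed

lemma card_proj_mono: "I \<subseteq> J \<Longrightarrow> card_proj I \<le> card_proj J"
proof -
  assume "I \<subseteq> J"
  then have "(\<lambda>b. restrict b I) ` E = (\<lambda>b. restrict b I) ` (\<lambda>b. restrict b J) ` E"
    by (auto simp: image_image inf.absorb2)
  then show ?thesis unfolding card_proj_def using finite_E by (metis card_image_le finite_imageI)
qed

lemma card_proj_le: "card_proj I \<le> card E"
  unfolding card_proj_def by (rule card_image_le[OF finite_E])

text \<open>The number of classes of \<open>seqs\<close> under \<open>agree n\<close>: position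
  \<open>l\<close> contributes the letters seen through the coordinates active there.\<close>

definition nodes :: "('d \<Rightarrow> nat) \<Rightarrow> nat" where
  "nodes n = (\<Prod>l<Max (range n). card_proj {i. l < n i})"

lemma nodes_eq:
  assumes "\<And>i. n i \<le> M" shows "nodes n = (\<Prod>l<M. card_proj {i. l < n i})"
  unfolding nodes_def
proof (rule prod.mono_neutral_left)
  show "{..<Max (range n)} \<subseteq> {..<M}" using assms by (auto simp: Max_less_iff intro: order.strict_trans2)
  show "\<forall>l\<in>{..<M} - {..<Max (range n)}. card_proj {i. l < n i} = 1"
  proof
    fix l assume "l \<in> {..<M} - {..<Max (range n)}"
    then have "{i. l < n i} = {}" by (auto simp: not_less)
    then show "card_proj {i. l < n i} = 1" by (simp add: card_proj_empty)
  qed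
qed simp

lemma nodes_pos: "1 \<le> nodes n"
  unfolding nodes_def using card_proj_pos by (simp add: Suc_le_eq)

text \<open>The subcylinders at levels \<open>n'\<close> of the cylinder of \<tau> at levels
  \<open>n\<close>, each given by one sequence. The choices at different positions are independent,
  and the count is exact because all fibres have the same size.\<close>

lemma nodes_children:
  assumes le: "\<And>i. n i \<le> n' i" and \<tau>: "\<tau> \<in> seqs"
  obtains Ch where "finite Ch" "Ch \<subseteq> seqs" "card Ch * nodes n = nodes n'"
    "\<And>\<sigma>. \<sigma> \<in> Ch \<Longrightarrow> agree n \<tau> \<sigma>" "\<And>\<sigma> \<sigma>'. \<sigma> \<in> Ch \<Longrightarrow> \<sigma>' \<in> Ch \<Longrightarrow> agree n' \<sigma> \<sigma>' \<Longrightarrow> \<sigma> = \<sigma>'"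
proof -
  define M where "M = Max (range n')"
  have M: "n' i \<le> M" "n i \<le> M" for i
  proof -
    show "n' i \<le> M" unfolding M_def by (rule Max_ge) auto
    then show "n i \<le> M" using le[of i] by simp
  qed
  define I where "I l = {i. l < n i}" for l
  define J where "J l = {i. l < n' i}" for l
  have IJ: "I l \<subseteq> J l" for l using le by (auto simp: I_def J_def intro: less_le_trans)
  define F where "F l = {b \<in> E. restrict b (I l) = restrict (\<tau> l) (I l)}" for l
  \<comment> \<open>At position \<open>l\<close>, one letter for each possible content of the
    coordinates \<open>J l\<close> that is compatible with \<tau> on \<open>I l\<close>.\<close>
  have "\<exists>R\<subseteq>F l. inj_on (\<lambda>b. restrict b (J l)) R \<and> (\<lambda>b. restrict b (J l)) ` F l = (\<lambda>b. restrict b (J l)) ` R" for l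
    using subset_image_inj[of "(\<lambda>b. restrict b (J l)) ` F l" "\<lambda>b. restrict b (J l)" "F l"] by auto
  then obtain R where R: "\<And>l. R l \<subseteq> F l" "\<And>l. inj_on (\<lambda>b. restrict b (J l)) (R l)"
    "\<And>l. (\<lambda>b. restrict b (J l)) ` F l = (\<lambda>b. restrict b (J l)) ` R l" by metis
  have finR: "finite (R l)" for l using R(1) finite_E finite_subset[of "R l" E] by (auto simp: F_def)
  have cardR: "card (R l) * card_proj (I l) = card_proj (J l)" for l
  proof -
    have "card (R l) = card ((\<lambda>b. restrict b (J l)) ` F l)" using R(2,3) by (simp add: card_image)
    then show ?thesis using fibres[OF IJ seqsD[OF \<tau>]] by (simp add: F_def card_proj_def)
  qed
  define h where "h g l = (if l < M then g l else \<tau> l)" for g :: "nat \<Rightarrow> 'd \<Rightarrow> 'a" and l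
  define Ch where "Ch = h ` PiE {..<M} R"
  have inj: "inj_on h (PiE {..<M} R)"
  proof (rule inj_onI)
    fix g g' assume g: "g \<in> PiE {..<M} R" "g' \<in> PiE {..<M} R" "h g = h g'"
    show "g = g'"
    proof
      fix l
      have "h g l = h g' l" using g(3) by simp
      then show "g l = g' l" using g(1,2) by (cases "l < M") (auto simp: h_def PiE_iff extensional_def)
    qed
  qed
  show ?thesis
  proof (rule that)
    show "finite Ch" unfolding Ch_def using finR by (intro finite_imageI finite_PiE) auto
    have RE: "R l \<subseteq> E" for l using R(1) by (auto simp: F_def)
    show "Ch \<subseteq> seqs" using RE seqsD[OF \<tau>] by (fastforce simp: Ch_def h_def PiE_iff)
    have "card Ch = (\<Prod>l<M. card (R l))" unfolding Ch_def using inj by (simp add: card_image card_PiE)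
    then show "card Ch * nodes n = nodes n'"
      using cardR by (simp add: nodes_eq[of n M] nodes_eq[of n' M] M I_def J_def prod.distrib[symmetric])
    fix \<sigma> assume "\<sigma> \<in> Ch"
    then obtain g where g: "g \<in> PiE {..<M} R" "\<sigma> = h g" by (auto simp: Ch_def)
    show "agree n \<tau> \<sigma>" unfolding agree_def
    proof (intro allI impI)
      fix i l assume l: "l < n i"
      then have "l < M" using M(2)[of i] by simp
      then have "g l \<in> F l" using g(1) R(1) by (auto simp: PiE_iff)
      then have "restrict (g l) (I l) i = restrict (\<tau> l) (I l) i" by (auto simp: F_def)
      then show "\<tau> l i = \<sigma> l i" using l g(2) \<open>l < M\<close> by (simp add: I_def h_def)
    qed
    fix \<sigma>' assume "\<sigma>' \<in> Ch" "agree n' \<sigma> \<sigma>'"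
    then obtain g' where g': "g' \<in> PiE {..<M} R" "\<sigma>' = h g'" by (auto simp: Ch_def)
    have "g l = g' l" if "l < M" for l
    proof (rule inj_onD[OF R(2)])
      show "g l \<in> R l" "g' l \<in> R l" using g g' that by (auto simp: PiE_iff)
      have "g l i = g' l i" if "i \<in> J l" for i
      proof -
        have "(if l < M then g l else \<tau> l) i = (if l < M then g' l else \<tau> l) i"
          using \<open>agree n' \<sigma> \<sigma>'\<close> that unfolding agree_def g(2) g'(2) h_def J_def by blast
        then show ?thesis using \<open>l < M\<close> by simp
      qed
      then show "restrict (g l) (J l) = restrict (g' l) (J l)" by (auto simp: restrict_def)
    qed
    then show "\<sigma> = \<sigma>'" by (auto simp: g(2) g'(2) h_def)
  qed
qed

text \<open>Each position at which further coordinates become active costs at most a factor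
  \<open>card E\<close>.\<close>

lemma nodes_le:
  assumes le: "\<And>i. n i \<le> n' i"
  shows "nodes n' \<le> card E ^ (\<Sum>i\<in>UNIV. n' i - n i) * nodes n"
proof -
  define M where "M = Max (range n')"
  have M: "n' i \<le> M" "n i \<le> M" for i
  proof -
    show "n' i \<le> M" unfolding M_def by (rule Max_ge) auto
    then show "n i \<le> M" using le[of i] by simp
  qed
  have cE: "1 \<le> card E" using card_proj_pos[of "{}"] card_proj_le[of "{}"] by simp
  define D where "D l = card {i. n i \<le> l \<and> l < n' i}" for l
  have "card_proj {i. l < n' i} \<le> card E ^ D l * card_proj {i. l < n i}" for l
  proof (cases "{i. n i \<le> l \<and> l < n' i} = {}")
    case True
    then have "{i. l < n' i} = {i. l < n i}" using le by (fastforce simp: not_le intro: less_le_trans)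
    then show ?thesis using True cE by (simp add: D_def)
  next
    case False
    then have "1 \<le> D l" by (simp add: D_def Suc_le_eq card_gt_0_iff)
    then have "card E ^ 1 \<le> card E ^ D l" using cE by (intro power_increasing) auto
    then have "card_proj {i. l < n' i} \<le> card E ^ D l" using card_proj_le[of "{i. l < n' i}"] by simp
    also have "\<dots> \<le> card E ^ D l * card_proj {i. l < n i}" using card_proj_pos[of "{i. l < n i}"] by simp
    finally show ?thesis .
  qed
  then have "nodes n' \<le> (\<Prod>l<M. card E ^ D l * card_proj {i. l < n i})"
    unfolding nodes_eq[OF M(1)] by (intro prod_mono) auto
  also have "\<dots> = card E ^ (\<Sum>l<M. D l) * nodes n"
    by (simp add: nodes_eq[OF M(2)] prod.distrib power_sum)
  also have "(\<Sum>l<M. D l) = (\<Sum>i\<in>UNIV. n' i - n i)"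
  proof -
    have "(\<Sum>l<M. D l) = (\<Sum>l<M. \<Sum>i\<in>UNIV. if n i \<le> l \<and> l < n' i then 1 else 0)"
      by (simp add: D_def sum.If_cases)
    also have "\<dots> = (\<Sum>i\<in>UNIV. \<Sum>l<M. if n i \<le> l \<and> l < n' i then 1 else 0)" by (rule sum.swap)
    also have "\<dots> = (\<Sum>i\<in>UNIV. n' i - n i)"
    proof (rule sum.cong[OF refl])
      fix i
      have "(\<Sum>l<M. if n i \<le> l \<and> l < n' i then 1 else 0) = card ({..<M} \<inter> {l. n i \<le> l \<and> l < n' i})"
        by (simp add: sum.If_cases)
      also have "{..<M} \<inter> {l. n i \<le> l \<and> l < n' i} = {n i..<n' i}" using M(1)[of i] by auto
      finally show "(\<Sum>l<M. if n i \<le> l \<and> l < n' i then 1 else 0) = n' i - n i" by simp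
    qed
    finally show ?thesis .
  qed
  finally show ?thesis .
qed

text \<open>Between \<open>L\<close> and \<open>L + T\<close> each coordinate gains a number of
  levels that is bounded independently of \<open>L\<close>. So replacing a cylinder by a subcylinder
  \<open>T\<close> deeper costs a constant factor.\<close>

lemma nodes_lev_step:
  assumes "0 \<le> T"
  obtains \<kappa> :: real where "1 \<le> \<kappa>" "\<And>L. 0 \<le> L \<Longrightarrow> real (nodes (lev (L + T))) \<le> \<kappa> * nodes (lev L)"
proof -
  have cE: "1 \<le> card E" using card_proj_pos[of "{}"] card_proj_le[of "{}"] by simp
  define k where "k i = nat \<lceil>T / lam i\<rceil> + 1" for i
  have "lev (L + T) i - lev L i \<le> k i" if "0 \<le> L" for L i
  proof -
    have "lev (L + T) i * lam i < L + T + lam i" using lev_less[of "L + T" i] assms that by simp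
    also have "\<dots> \<le> lev L i * lam i + T + lam i" using lev_ge[of L i] by simp
    also have "T \<le> real (nat \<lceil>T / lam i\<rceil>) * lam i" using lev_ge[of T i] by (simp add: lev_def)
    finally have "real (lev (L + T) i) * lam i < real (lev L i + k i) * lam i" by (simp add: k_def algebra_simps)
    then have "real (lev (L + T) i) < real (lev L i + k i)" using lam_pos[of i] by (simp only: mult_less_cancel_right_pos)
    then show ?thesis by simp
  qed
  then have "nodes (lev (L + T)) \<le> card E ^ (\<Sum>i\<in>UNIV. k i) * nodes (lev L)" if "0 \<le> L" for L
  proof -
    have "nodes (lev (L + T)) \<le> card E ^ (\<Sum>i\<in>UNIV. lev (L + T) i - lev L i) * nodes (lev L)"
      using assms by (intro nodes_le lev_mono) simp
    also have "\<dots> \<le> card E ^ (\<Sum>i\<in>UNIV. k i) * nodes (lev L)"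
      using that cE \<open>\<And>L i. 0 \<le> L \<Longrightarrow> lev (L + T) i - lev L i \<le> k i\<close>
      by (intro mult_right_mono power_increasing sum_mono) auto
    finally show ?thesis .
  qed
  then have "real (nodes (lev (L + T))) \<le> real (card E ^ (\<Sum>i\<in>UNIV. k i)) * nodes (lev L)" if "0 \<le> L" for L
    using that by (metis of_nat_le_iff of_nat_mult)
  moreover have "1 \<le> real (card E ^ (\<Sum>i\<in>UNIV. k i))" using cE by (simp add: Suc_le_eq)
  ultimately show ?thesis by (intro that[of "real (card E ^ (\<Sum>i\<in>UNIV. k i))"])
qed

text \<open>Slowly contracting coordinates have the higher levels, so \<open>sum_over_levels\<close>
  applies to the order \<open>xs\<close>. Rounding levels up only helps, the increments of
  \<open>ln (card_proj _)\<close> being nonnegative.\<close>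

lemma nodes_lev_ge:
  assumes xs: "set xs = UNIV" and L: "0 \<le> L"
    and inc: "\<And>k k'. k \<le> k' \<Longrightarrow> k' < length xs \<Longrightarrow> lam (xs ! k) \<le> lam (xs ! k')"
  shows "L * (\<Sum>k<length xs. (ln (card_proj (set (take (Suc k) xs))) - ln (card_proj (set (take k xs)))) / lam (xs ! k))
    \<le> ln (nodes (lev L))"
proof -
  define M where "M = Max (range (lev L))"
  have M: "lev L i \<le> M" for i by (simp add: M_def)
  define c where "c k = ln (card_proj (set (take k xs)))" for k
  have c: "c k \<le> c (Suc k)" for k
  proof -
    have "card_proj (set (take k xs)) \<le> card_proj (set (take (Suc k) xs))"
      by (intro card_proj_mono set_take_subset_set_take) simp
    then show ?thesis using card_proj_pos[of "set (take k xs)"] unfolding c_def by simp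
  qed
  have "ln (nodes (lev L)) = (\<Sum>l<M. ln (card_proj {i. l < lev L i}))"
    unfolding nodes_eq[OF M] of_nat_prod using card_proj_pos by (subst ln_prod) (auto simp: Suc_le_eq)
  also have "\<dots> = (\<Sum>k<length xs. real (lev L (xs ! k)) * (c (Suc k) - c k))"
    unfolding c_def
  proof (rule sum_over_levels[OF xs, where g="\<lambda>I. ln (card_proj I)"])
    show "lev L (xs ! k') \<le> lev L (xs ! k)" if "k \<le> k'" "k' < length xs" for k k'
      using inc[OF that] L lam_pos unfolding lev_def by (intro nat_mono ceiling_mono divide_left_mono) auto
  qed (use M card_proj_empty in auto)
  finally have eq: "ln (nodes (lev L)) = (\<Sum>k<length xs. real (lev L (xs ! k)) * (c (Suc k) - c k))" .
  have "L * (\<Sum>k<length xs. (c (Suc k) - c k) / lam (xs ! k)) = (\<Sum>k<length xs. L / lam (xs ! k) * (c (Suc k) - c k))"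
    by (simp add: sum_distrib_left)
  also have "\<dots> \<le> (\<Sum>k<length xs. real (lev L (xs ! k)) * (c (Suc k) - c k))"
    using c lev_ge[of L] lam_pos by (intro sum_mono mult_right_mono) (auto simp: divide_le_eq)
  finally show ?thesis unfolding eq c_def .
qed

text \<open>The Baranski condition makes the intervals of distinct words disjoint balls of radius
  \<open>?h / 2\<close>, so their centres are at least \<open>?h\<close> apart.\<close>

lemma separated:
  assumes "\<sigma> \<in> seqs" "\<tau> \<in> seqs" "\<exists>l<n. \<sigma> l i \<noteq> \<tau> l i"
  shows "exp (- real n * lam i) \<le> \<bar>coord_map (\<phi> i) (\<lambda>l. \<sigma> l i) n (1/2) - coord_map (\<phi> i) (\<lambda>l. \<tau> l i) n (1/2)\<bar>"
    (is "?h \<le> \<bar>?x - ?y\<bar>")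
proof (rule ccontr)
  assume "\<not> ?thesis"
  then have "dist ?x ((?x + ?y) / 2) < ?h / 2" "dist ?y ((?x + ?y) / 2) < ?h / 2"
    by (auto simp: dist_real_def abs_if field_simps split: if_splits)
  then have "(?x + ?y) / 2 \<in> ball ?x (?h / 2) \<inter> ball ?y (?h / 2)" by simp
  moreover have "coord_map (\<phi> i) (\<lambda>l. \<omega> l i) n ` {0<..<1} = ball (coord_map (\<phi> i) (\<lambda>l. \<omega> l i) n (1/2)) (?h / 2)"
    if "\<omega> \<in> seqs" for \<omega>
    using scales_image_ball(1)[OF coord_scales[OF that] exp_gt_zero, of i n] rsum_eq[OF that] by simp
  moreover have "coord_map (\<phi> i) (\<lambda>l. \<sigma> l i) n ` {0<..<1} \<inter> coord_map (\<phi> i) (\<lambda>l. \<tau> l i) n ` {0<..<1} = {}"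
    using assms baranski sim_A E_A seqsD by (intro coord_map_disjoint[of "A i"]) (auto simp: baranski_def)
  ultimately show False using assms by auto
qed

lemma near_centre:
  assumes "\<sigma> \<in> seqs"
  shows "\<bar>coding_map \<phi> \<sigma> $ i - coord_map (\<phi> i) (\<lambda>l. \<sigma> l i) n (1/2)\<bar> \<le> exp (- real n * lam i) / 2"
proof -
  have "coding_map \<phi> \<sigma> $ i \<in> cball (coord_map (\<phi> i) (\<lambda>l. \<sigma> l i) n (1/2)) (exp (- real n * lam i) / 2)"
    using coding_map_in[OF assms, of i n] rsum_eq[OF assms]
    unfolding scales_image_ball(2)[OF coord_scales[OF assms] exp_gt_zero, of i n] by simp
  then show ?thesis by (simp add: dist_real_def abs_minus_commute)
qed

lemma coding_close:
  assumes "\<sigma> \<in> seqs" "\<tau> \<in> seqs" "\<And>l. l < n \<Longrightarrow> \<sigma> l i = \<tau> l i"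
  shows "\<bar>coding_map \<phi> \<sigma> $ i - coding_map \<phi> \<tau> $ i\<bar> \<le> exp (- real n * lam i)"
  using coding_map_close[OF assms] rsum_eq[OF assms(1)] by simp

lemma coding_close_lev:
  assumes "\<sigma> \<in> seqs" "\<tau> \<in> seqs" "agree (lev L) \<sigma> \<tau>"
  shows "\<bar>coding_map \<phi> \<sigma> $ i - coding_map \<phi> \<tau> $ i\<bar> \<le> exp (- L)"
proof -
  have "\<bar>coding_map \<phi> \<sigma> $ i - coding_map \<phi> \<tau> $ i\<bar> \<le> exp (- real (lev L i) * lam i)"
    using assms by (intro coding_close) (auto simp: agree_def)
  also have "\<dots> \<le> exp (- L)" using lev_ge[of L i] by simp
  finally show ?thesis .
qed

section \<open>Escaping from hyperplanes and from rational points\<close>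

lemma lam_bound: obtains \<Lambda> where "\<And>i. lam i \<le> \<Lambda>" "0 < \<Lambda>"
proof -
  have "lam i \<le> Max (range lam)" for i by simp
  then show ?thesis using that lam_pos order.strict_trans2 by metis
qed

text \<open>Changing one letter at position \<open>lev L i\<close> or at the next one moves the \<open>i\<close>-th coordinate by
  about \<open>exp (- L)\<close>, and the other coordinates by much less. Taking for \<open>i\<close> the largest coefficient
  of the hyperplane, one of the resulting subcubes avoids it.\<close>

lemma avoid_hyperplane:
  obtains T \<gamma> L1 where "0 \<le> T" "0 < \<gamma>" "\<gamma> \<le> 1" "0 \<le> L1"
    "\<And>L \<omega> (v :: real ^ 'd) t. L1 \<le> L \<Longrightarrow> \<omega> \<in> seqs \<Longrightarrow> norm v = 1 \<Longrightarrow>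
       \<exists>\<tau>\<in>seqs. agree (lev L) \<omega> \<tau> \<and>
         (\<forall>\<sigma>\<in>seqs. agree (lev (L + T)) \<tau> \<sigma> \<longrightarrow> \<gamma> * exp (- L) \<le> \<bar>v \<bullet> coding_map \<phi> \<sigma> - t\<bar>)"
proof -
  obtain \<Lambda> where \<Lambda>: "\<And>i. lam i \<le> \<Lambda>" "0 < \<Lambda>" using lam_bound by metis
  define d where "d = real CARD('d)"
  have d1: "1 \<le> d" by (simp add: d_def Suc_le_eq)
  \<comment> \<open>Depth \<open>T\<close> makes the joint effect of the other coordinates,
    \<open>d * exp (- T)\<close>, half of the guaranteed gap \<open>exp (- 3 * \<Lambda>)\<close>.
    In \<gamma>, the factor \<open>1 / d\<close> comes from the largest coefficient of
    \<open>v\<close>, one half from this loss, and another half because two competing subcubes share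
    the gap.\<close>
  define T where "T = 3 * \<Lambda> + ln (2 * d)"
  define \<gamma> where "\<gamma> = exp (- 3 * \<Lambda>) / (4 * d)"
  \<comment> \<open>From \<open>L1\<close> on, a letter at position \<open>lev L i\<close> affects a
    strictly faster coordinate \<open>j\<close> only below the scale
    \<open>exp (- (L + T))\<close>.\<close>
  define L1 where "L1 = (\<Sum>(i, j)\<in>UNIV. \<bar>T * lam i / (lam j - lam i)\<bar>)"
  have T: "3 * \<Lambda> \<le> T" "0 \<le> T" using \<Lambda>(2) d1 by (auto simp: T_def intro!: add_nonneg_nonneg)
  have expT: "d * exp (- T) = exp (- 3 * \<Lambda>) / 2"
    using d1 by (simp add: T_def exp_diff exp_minus exp_add field_simps)
  have \<gamma>: "0 < \<gamma>" "\<gamma> \<le> 1"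
  proof -
    show "0 < \<gamma>" using d1 by (simp add: \<gamma>_def)
    have "exp (- 3 * \<Lambda>) \<le> 1" using \<Lambda>(2) by simp
    also have "1 \<le> 4 * d" using d1 by simp
    finally show "\<gamma> \<le> 1" using d1 by (simp add: \<gamma>_def divide_le_eq)
  qed
  have L1: "0 \<le> L1" unfolding L1_def by (intro sum_nonneg) auto
  have L1': "T * lam i \<le> L1 * (lam j - lam i)" if "lam i < lam j" for i j
  proof -
    have "T * lam i / (lam j - lam i) \<le> \<bar>T * lam i / (lam j - lam i)\<bar>" by (rule abs_ge_self)
    also have "\<dots> \<le> L1" unfolding L1_def
      using member_le_sum[of "(i, j)" UNIV "\<lambda>(i, j). \<bar>T * lam i / (lam j - lam i)\<bar>"] by auto
    finally show ?thesis using that by (simp add: divide_le_eq)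
  qed
  show ?thesis
  proof (rule that[OF T(2) \<gamma> L1])
    fix L \<omega> and v :: "real ^ 'd" and t :: real
    assume L: "L1 \<le> L" and \<omega>: "\<omega> \<in> seqs" and v: "norm v = 1"
    have L0: "0 \<le> L" using L L1 by simp
    obtain i where i: "\<And>j. \<bar>v $ j\<bar> \<le> \<bar>v $ i\<bar>"
    proof -
      have "Max (range (\<lambda>j. \<bar>v $ j\<bar>)) \<in> range (\<lambda>j. \<bar>v $ j\<bar>)" by (rule Max_in) auto
      then obtain i where i: "Max (range (\<lambda>j. \<bar>v $ j\<bar>)) = \<bar>v $ i\<bar>" by blast
      have "\<bar>v $ j\<bar> \<le> \<bar>v $ i\<bar>" for j unfolding i[symmetric] by (rule Max_ge) auto
      then show ?thesis by (rule that)
    qed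
    have vi: "1 / d \<le> \<bar>v $ i\<bar>"
    proof -
      have "1 \<le> (\<Sum>j\<in>UNIV. \<bar>v $ j\<bar>)" using norm_le_l1_cart[of v] v by simp
      also have "\<dots> \<le> (\<Sum>j\<in>(UNIV :: 'd set). \<bar>v $ i\<bar>)" by (intro sum_mono i)
      finally show ?thesis using d1 by (simp add: d_def divide_le_eq mult.commute)
    qed
    define n where "n = lev L i"
    obtain b0 where b0: "b0 \<in> E" "b0 i \<noteq> \<omega> n i" "\<And>j. \<omega> n j \<noteq> b0 j \<Longrightarrow> j = i \<or> lam i < lam j"
      using diffuse[OF seqsD[OF \<omega>, of n], of i] by blast
    obtain b1 where b1: "b1 \<in> E" "b1 i \<noteq> \<omega> (Suc n) i" "\<And>j. \<omega> (Suc n) j \<noteq> b1 j \<Longrightarrow> j = i \<or> lam i < lam j"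
      using diffuse[OF seqsD[OF \<omega>, of "Suc n"], of i] by blast
    \<comment> \<open>Two candidates would not do, since neighbouring intervals may touch. Of three
      centres with mutual distances at least \<open>h\<close>, two are at least \<open>2 * h\<close>
      apart, and \<open>h\<close> remains after moving within the intervals.\<close>
    define X where "X = {\<omega>, (fun_upd \<omega> n b0), (fun_upd \<omega> (Suc n) b1)}"
    have Xseqs: "\<tau> \<in> seqs" if "\<tau> \<in> X" for \<tau> using that seqsD[OF \<omega>] b0(1) b1(1) by (auto simp: X_def PiE_iff)
    have Xn: "\<tau> l = \<omega> l" if "\<tau> \<in> X" "l < n" for \<tau> l using that by (auto simp: X_def)
    have Xj: "\<tau> l j = \<omega> l j" if "\<tau> \<in> X" "j \<noteq> i" "\<not> lam i < lam j" for \<tau> l j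
    proof -
      have "b0 j = \<omega> n j" "b1 j = \<omega> (Suc n) j" using that(2,3) b0(3)[of j] b1(3)[of j] by metis+
      then show ?thesis using that(1) by (auto simp: X_def)
    qed
    \<comment> \<open>The changes occur at positions \<open>n\<close> and \<open>Suc n\<close>, in
      coordinate \<open>i\<close> or faster ones, whose level at scale \<open>L\<close> is at most
      \<open>n\<close>; they happen beyond the cylinder.\<close>
    have Xagree: "agree (lev L) \<omega> \<tau>" if "\<tau> \<in> X" for \<tau> unfolding agree_def
    proof (intro allI impI)
      fix j l assume l: "l < lev L j"
      show "\<omega> l j = \<tau> l j"
      proof (cases "l < n")
        case True
        then show ?thesis using Xn[OF that] by simp
      next
        case False
        then have "lev L i < lev L j" using l by (simp add: n_def)
        then have "\<not> lam i \<le> lam j" using L0 lam_pos unfolding lev_def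
          by (metis ceiling_mono divide_left_mono linorder_not_less mult_pos_pos nat_mono)
        then have "\<tau> l j = \<omega> l j" by (intro Xj[OF that]) auto
        then show ?thesis by simp
      qed
    qed
    define z where "z \<tau> = coord_map (\<phi> i) (\<lambda>l. \<tau> l i) (n + 2) (1/2)" for \<tau>
    define h where "h = exp (- real (n + 2) * lam i)"
    have sep: "h \<le> \<bar>z \<tau> - z \<tau>'\<bar>" if "\<tau> \<in> X" "\<tau>' \<in> X" "\<exists>l<n+2. \<tau> l i \<noteq> \<tau>' l i" for \<tau> \<tau>'
      using separated[OF Xseqs[OF that(1)] Xseqs[OF that(2)] that(3)] by (simp add: z_def h_def)
    have "\<exists>\<tau>1\<in>X. \<exists>\<tau>2\<in>X. 2 * h \<le> \<bar>z \<tau>1 - z \<tau>2\<bar>"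
    proof -
      have "h \<le> \<bar>z \<omega> - z (fun_upd \<omega> n b0)\<bar>" using b0(2) by (intro sep) (auto simp: X_def intro!: exI[of _ n])
      moreover have "h \<le> \<bar>z \<omega> - z ((fun_upd \<omega> (Suc n) b1))\<bar>" using b1(2) by (intro sep) (auto simp: X_def intro!: exI[of _ "Suc n"])
      moreover have "h \<le> \<bar>z (fun_upd \<omega> n b0) - z ((fun_upd \<omega> (Suc n) b1))\<bar>" using b0(2) by (intro sep) (auto simp: X_def intro!: exI[of _ n])
      ultimately have "2 * h \<le> \<bar>z \<omega> - z (fun_upd \<omega> n b0)\<bar> \<or> 2 * h \<le> \<bar>z \<omega> - z ((fun_upd \<omega> (Suc n) b1))\<bar>
         \<or> 2 * h \<le> \<bar>z (fun_upd \<omega> n b0) - z ((fun_upd \<omega> (Suc n) b1))\<bar>" by linarith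
      then show ?thesis by (auto simp: X_def)
    qed
    then obtain \<tau>1 \<tau>2 where \<tau>12: "\<tau>1 \<in> X" "\<tau>2 \<in> X" "2 * h \<le> \<bar>z \<tau>1 - z \<tau>2\<bar>" by blast
    \<comment> \<open>Thus the subcubes at depth \<open>L + T\<close> still determine both letters
      that may have been changed in coordinate \<open>i\<close>.\<close>
    have n2: "n + 2 \<le> lev (L + T) i"
    proof -
      have "real (n + 2) * lam i < L + 3 * lam i" using lev_less[OF L0, of i] by (simp add: n_def algebra_simps)
      also have "\<dots> \<le> lev (L + T) i * lam i" using lev_ge[of "L + T" i] T(1) \<Lambda>(1)[of i] by simp
      finally have "real (n + 2) < real (lev (L + T) i)" using lam_pos[of i] by (simp only: mult_less_cancel_right_pos)
      then show ?thesis by simp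
    qed
    have key: "2 * \<gamma> * exp (- L) \<le> \<bar>v \<bullet> coding_map \<phi> \<sigma>1 - v \<bullet> coding_map \<phi> \<sigma>2\<bar>"
      if \<sigma>: "\<sigma>1 \<in> seqs" "\<sigma>2 \<in> seqs" "agree (lev (L + T)) \<tau>1 \<sigma>1" "agree (lev (L + T)) \<tau>2 \<sigma>2" for \<sigma>1 \<sigma>2
    proof -
      define x where "x = coding_map \<phi> \<sigma>1"
      define y where "y = coding_map \<phi> \<sigma>2"
      have zz: "z \<sigma>1 = z \<tau>1" "z \<sigma>2 = z \<tau>2"
        using \<sigma>(3,4) n2 unfolding z_def agree_def by (auto intro!: coord_map_cong[THEN fun_cong])
      have "\<bar>x $ i - z \<tau>1\<bar> \<le> h / 2" "\<bar>y $ i - z \<tau>2\<bar> \<le> h / 2"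
        using near_centre[OF \<sigma>(1), of i "n + 2"] near_centre[OF \<sigma>(2), of i "n + 2"] zz
        unfolding x_def y_def h_def z_def by auto
      then have xyi: "h \<le> \<bar>x $ i - y $ i\<bar>" using \<tau>12(3) by linarith
      have "exp (- L) * exp (- 3 * \<Lambda>) \<le> h"
      proof -
        have "real (n + 2) * lam i \<le> L + 3 * lam i" using lev_less[OF L0, of i] by (simp add: n_def algebra_simps)
        also have "\<dots> \<le> L + 3 * \<Lambda>" using \<Lambda>(1)[of i] by simp
        finally have "- L + - 3 * \<Lambda> \<le> - real (n + 2) * lam i" by (simp only: mult_minus_left)
        then show ?thesis unfolding h_def exp_add[symmetric] exp_le_cancel_iff .
      qed
      with xyi have xyi: "exp (- L) * exp (- 3 * \<Lambda>) \<le> \<bar>x $ i - y $ i\<bar>" by simp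
      have xyj: "\<bar>x $ j - y $ j\<bar> \<le> exp (- L) * exp (- T)" if "j \<noteq> i" for j
      proof -
        define m where "m = lev (L + T) j"
        have m: "exp (- real m * lam j) \<le> exp (- L) * exp (- T)"
          using lev_ge[of "L + T" j] unfolding m_def exp_add[symmetric] by simp
        show ?thesis
        proof (cases "lam i < lam j")
          case False
          have "\<sigma>1 l j = \<sigma>2 l j" if "l < m" for l
            using \<sigma>(3,4) that Xj[OF \<tau>12(1) \<open>j \<noteq> i\<close> False, of l] Xj[OF \<tau>12(2) \<open>j \<noteq> i\<close> False, of l]
            unfolding agree_def m_def by metis
          then have "\<bar>x $ j - y $ j\<bar> \<le> exp (- real m * lam j)"
            unfolding x_def y_def by (intro coding_close \<sigma>) auto
          with m show ?thesis by simp
        next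
          case True
          have "\<sigma>1 l j = \<sigma>2 l j" if "l < min m n" for l
            using \<sigma>(3,4) that Xn[OF \<tau>12(1), of l] Xn[OF \<tau>12(2), of l]
            unfolding agree_def m_def by (metis min_less_iff_conj)
          then have "\<bar>x $ j - y $ j\<bar> \<le> exp (- real (min m n) * lam j)"
            unfolding x_def y_def by (intro coding_close \<sigma>) auto
          also have "\<dots> \<le> exp (- L) * exp (- T)"
          proof (cases "m \<le> n")
            case True
            then show ?thesis using m by (simp add: min_def)
          next
            case False
            \<comment> \<open>This is where \<open>L1\<close> and the strict inequality
              \<open>lam i < lam j\<close> enter: \<open>n\<close> common letters already bring
              coordinate \<open>j\<close> down to size \<open>exp (- (L + T))\<close>.\<close>
            have "(L + T) * lam i \<le> L * lam j"
            proof -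
              have "T * lam i \<le> L1 * (lam j - lam i)" by (rule L1'[OF \<open>lam i < lam j\<close>])
              also have "\<dots> \<le> L * (lam j - lam i)" using L \<open>lam i < lam j\<close> by (intro mult_right_mono) auto
              finally show ?thesis by (simp add: algebra_simps)
            qed
            also have "\<dots> \<le> (n * lam i) * lam j"
              using lev_ge[of L i] lam_pos[of j] by (intro mult_right_mono) (auto simp: n_def)
            finally have "(L + T) * lam i \<le> (n * lam j) * lam i" by (simp add: mult_ac)
            then have "L + T \<le> n * lam j" using lam_pos[of i] by (simp only: mult_le_cancel_right_pos)
            then show ?thesis using False unfolding exp_add[symmetric] by (simp add: min_def)
          qed
          finally show ?thesis .
        qed
      qed
      define r where "r = (\<Sum>j\<in>UNIV - {i}. v $ j * (x $ j - y $ j))"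
      have "v \<bullet> (x - y) = v $ i * (x $ i - y $ i) + r"
        by (simp add: inner_vec_def r_def sum.remove[of UNIV i])
      moreover have "\<bar>r\<bar> \<le> \<bar>v $ i\<bar> * (exp (- L) * (d * exp (- T)))"
      proof -
        have "\<bar>r\<bar> \<le> (\<Sum>j\<in>UNIV - {i}. \<bar>v $ j * (x $ j - y $ j)\<bar>)" unfolding r_def by (rule sum_abs)
        also have "\<dots> \<le> (\<Sum>j\<in>UNIV - {i}. \<bar>v $ i\<bar> * (exp (- L) * exp (- T)))"
          unfolding abs_mult by (intro sum_mono mult_mono i xyj) auto
        also have "\<dots> \<le> d * (\<bar>v $ i\<bar> * (exp (- L) * exp (- T)))"
          unfolding sum_constant d_def by (intro mult_right_mono) (auto simp: card_Diff_singleton)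
        finally show ?thesis by (simp add: mult_ac)
      qed
      moreover have "\<bar>v $ i\<bar> * (exp (- L) * exp (- 3 * \<Lambda>)) \<le> \<bar>v $ i * (x $ i - y $ i)\<bar>"
        unfolding abs_mult by (intro mult_left_mono xyi) auto
      ultimately have "\<bar>v $ i\<bar> * (exp (- L) * exp (- 3 * \<Lambda>)) - \<bar>v $ i\<bar> * (exp (- L) * (exp (- 3 * \<Lambda>) / 2)) \<le> \<bar>v \<bullet> (x - y)\<bar>"
        unfolding expT by linarith
      then have "\<bar>v $ i\<bar> * (exp (- L) * exp (- 3 * \<Lambda>) / 2) \<le> \<bar>v \<bullet> (x - y)\<bar>" by (simp add: algebra_simps)
      moreover have "1 / d * (exp (- L) * exp (- 3 * \<Lambda>) / 2) \<le> \<bar>v $ i\<bar> * (exp (- L) * exp (- 3 * \<Lambda>) / 2)"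
        using vi by (intro mult_right_mono) auto
      moreover have "1 / d * (exp (- L) * exp (- 3 * \<Lambda>) / 2) = 2 * \<gamma> * exp (- L)" using d1 by (simp add: \<gamma>_def field_simps)
      ultimately show ?thesis by (simp add: x_def y_def inner_diff_right)
    qed
    show "\<exists>\<tau>\<in>seqs. agree (lev L) \<omega> \<tau> \<and>
         (\<forall>\<sigma>\<in>seqs. agree (lev (L + T)) \<tau> \<sigma> \<longrightarrow> \<gamma> * exp (- L) \<le> \<bar>v \<bullet> coding_map \<phi> \<sigma> - t\<bar>)"
    proof (rule ccontr)
      assume neg: "\<not> ?thesis"
      have "\<exists>\<sigma>\<in>seqs. agree (lev (L + T)) \<tau> \<sigma> \<and> \<bar>v \<bullet> coding_map \<phi> \<sigma> - t\<bar> < \<gamma> * exp (- L)" if "\<tau> \<in> X" for \<tau>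
        using neg Xseqs[OF that] Xagree[OF that] by (auto simp: not_le)
      from this[OF \<tau>12(1)] this[OF \<tau>12(2)] obtain \<sigma>1 \<sigma>2 where
        "\<sigma>1 \<in> seqs" "agree (lev (L + T)) \<tau>1 \<sigma>1" "\<bar>v \<bullet> coding_map \<phi> \<sigma>1 - t\<bar> < \<gamma> * exp (- L)"
        "\<sigma>2 \<in> seqs" "agree (lev (L + T)) \<tau>2 \<sigma>2" "\<bar>v \<bullet> coding_map \<phi> \<sigma>2 - t\<bar> < \<gamma> * exp (- L)" by blast
      with key[of \<sigma>1 \<sigma>2] show False by linarith
    qed
  qed
qed

text \<open>Measured in units of the side lengths \<open>h i\<close>, the integer parts of the
  centres distinguish the cylinders, by \<open>separated\<close>, and they lie in a window of
  bounded size around those of one fixed cylinder.\<close>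

lemma few_nodes_meet_small_set:
  obtains C :: nat where "\<And>L U Y. 0 \<le> L \<Longrightarrow> bounded U \<Longrightarrow> diameter U \<le> exp (- L) \<Longrightarrow> Y \<subseteq> seqs \<Longrightarrow>
      (\<And>\<sigma>. \<sigma> \<in> Y \<Longrightarrow> coding_map \<phi> \<sigma> \<in> U) \<Longrightarrow>
      (\<And>\<sigma> \<sigma>'. \<sigma> \<in> Y \<Longrightarrow> \<sigma>' \<in> Y \<Longrightarrow> agree (lev L) \<sigma> \<sigma>' \<Longrightarrow> \<sigma> = \<sigma>') \<Longrightarrow> card Y \<le> C"
proof -
  obtain \<Lambda> where \<Lambda>: "\<And>i. lam i \<le> \<Lambda>" "0 < \<Lambda>" using lam_bound by metis
  define K where "K = \<lceil>exp \<Lambda>\<rceil> + 3"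
  define C where "C = nat (2 * K + 1) ^ CARD('d)"
  show ?thesis
  proof (rule that[of C])
    fix L and U :: "(real ^ 'd) set" and Y
    assume L: "0 \<le> L" and U: "bounded U" "diameter U \<le> exp (- L)" and Y: "Y \<subseteq> seqs" "\<And>\<sigma>. \<sigma> \<in> Y \<Longrightarrow> coding_map \<phi> \<sigma> \<in> U"
      and inj: "\<And>\<sigma> \<sigma>'. \<sigma> \<in> Y \<Longrightarrow> \<sigma>' \<in> Y \<Longrightarrow> agree (lev L) \<sigma> \<sigma>' \<Longrightarrow> \<sigma> = \<sigma>'"
    show "card Y \<le> C"
    proof (cases "Y = {}")
      case True then show ?thesis by simp
    next
      case False
      then obtain \<sigma>0 where \<sigma>0: "\<sigma>0 \<in> Y" by blast
      define z where "z \<sigma> i = coord_map (\<phi> i) (\<lambda>l. \<sigma> l i) (lev L i) (1/2)" for \<sigma> i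
      define h where "h i = exp (- real (lev L i) * lam i)" for i
      define f where "f \<sigma> i = \<lfloor>z \<sigma> i / h i\<rfloor>" for \<sigma> i
      have h0: "0 < h i" for i by (simp add: h_def)
      have hL: "exp (- L) \<le> exp \<Lambda> * h i" for i
        using lev_less[OF L, of i] \<Lambda>(1)[of i] unfolding h_def exp_add[symmetric] by simp
      have near: "\<bar>z \<sigma> i / h i - z \<sigma>0 i / h i\<bar> \<le> exp \<Lambda> + 1" if "\<sigma> \<in> Y" for \<sigma> i
      proof -
        have "\<bar>coding_map \<phi> \<sigma> $ i - coding_map \<phi> \<sigma>0 $ i\<bar> \<le> dist (coding_map \<phi> \<sigma>) (coding_map \<phi> \<sigma>0)"
          using component_le_norm_cart[of "coding_map \<phi> \<sigma> - coding_map \<phi> \<sigma>0" i] by (simp add: dist_norm)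
        also have "\<dots> \<le> diameter U" using U(1) Y(2) that \<sigma>0 by (intro diameter_bounded_bound) auto
        also have "\<dots> \<le> exp \<Lambda> * h i" using U(2) hL[of i] by simp
        finally have "\<bar>coding_map \<phi> \<sigma> $ i - coding_map \<phi> \<sigma>0 $ i\<bar> \<le> exp \<Lambda> * h i" .
        moreover have "\<bar>coding_map \<phi> \<sigma> $ i - z \<sigma> i\<bar> \<le> h i / 2" "\<bar>coding_map \<phi> \<sigma>0 $ i - z \<sigma>0 i\<bar> \<le> h i / 2"
          using that \<sigma>0 Y(1) unfolding z_def h_def by (blast intro: near_centre)+
        ultimately have "\<bar>z \<sigma> i - z \<sigma>0 i\<bar> \<le> (exp \<Lambda> + 1) * h i" unfolding distrib_right by linarith
        then have "\<bar>z \<sigma> i - z \<sigma>0 i\<bar> / h i \<le> exp \<Lambda> + 1" using h0[of i] by (simp add: divide_le_eq)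
        then show ?thesis using h0[of i] by (simp add: diff_divide_distrib[symmetric] abs_divide)
      qed
      have sub: "f ` Y \<subseteq> (\<Pi>\<^sub>E i\<in>UNIV. {f \<sigma>0 i - K .. f \<sigma>0 i + K})"
      proof
        fix g assume "g \<in> f ` Y"
        then obtain \<sigma> where \<sigma>: "\<sigma> \<in> Y" "g = f \<sigma>" by blast
        have "f \<sigma> i \<in> {f \<sigma>0 i - K .. f \<sigma>0 i + K}" for i
          using near[OF \<sigma>(1), of i] unfolding f_def K_def by simp linarith
        then show "g \<in> (\<Pi>\<^sub>E i\<in>UNIV. {f \<sigma>0 i - K .. f \<sigma>0 i + K})" using \<sigma>(2) by auto
      qed
      have "inj_on f Y"
      proof (rule inj_onI)
        fix \<sigma> \<sigma>' assume \<sigma>: "\<sigma> \<in> Y" "\<sigma>' \<in> Y" "f \<sigma> = f \<sigma>'"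
        have "agree (lev L) \<sigma> \<sigma>'" unfolding agree_def
        proof (rule ccontr)
          assume "\<not> (\<forall>i. \<forall>l<lev L i. \<sigma> l i = \<sigma>' l i)"
          then obtain i where "\<exists>l<lev L i. \<sigma> l i \<noteq> \<sigma>' l i" by blast
          then have "h i \<le> \<bar>z \<sigma> i - z \<sigma>' i\<bar>" using \<sigma>(1,2) Y(1) unfolding z_def h_def by (intro separated) auto
          then have "1 \<le> \<bar>z \<sigma> i - z \<sigma>' i\<bar> / h i" using h0[of i] by simp
          then have "1 \<le> \<bar>z \<sigma> i / h i - z \<sigma>' i / h i\<bar>" using h0[of i] by (simp add: diff_divide_distrib[symmetric] abs_divide)
          moreover have "\<lfloor>z \<sigma> i / h i\<rfloor> = \<lfloor>z \<sigma>' i / h i\<rfloor>" using fun_cong[OF \<sigma>(3), of i] by (simp add: f_def)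
          ultimately show False by linarith
        qed
        then show "\<sigma> = \<sigma>'" using inj \<sigma> by blast
      qed
      then have "card Y = card (f ` Y)" by (simp add: card_image)
      also have "\<dots> \<le> card (\<Pi>\<^sub>E i\<in>UNIV. {f \<sigma>0 i - K .. f \<sigma>0 i + K})"
        by (rule card_mono[OF _ sub]) (auto intro: finite_PiE)
      also have "\<dots> = C" by (simp add: card_PiE C_def)
      finally show ?thesis .
    qed
  qed
qed

definition avoids :: "real \<Rightarrow> real \<Rightarrow> real ^ 'd \<Rightarrow> bool" where
  "avoids Q \<delta> y \<longleftrightarrow> (\<forall>(p :: int ^ 'd) (q :: int). 1 \<le> q \<longrightarrow> of_int q \<le> Q \<longrightarrow>
     \<delta> \<le> norm (y - (\<chi> i. of_int (p $ i) / of_int q)))"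

text \<open>The bound \<open>Q\<close> on denominators satisfies
  \<open>Q ^ (d + 1) = (\<theta> * exp L) ^ d\<close> with \<open>d = CARD('d)\<close>, which is
  what the simplex lemma permits for a cube of radius \<open>2 * exp (- L)\<close>.\<close>

lemma avoid_rationals:
  obtains T \<gamma> L1 \<theta> where "0 \<le> T" "0 < \<gamma>" "0 \<le> L1" "0 < \<theta>"
    "\<And>L \<omega>. L1 \<le> L \<Longrightarrow> \<omega> \<in> seqs \<Longrightarrow>
       \<exists>\<tau>\<in>seqs. agree (lev L) \<omega> \<tau> \<and>
         (\<forall>\<sigma>\<in>seqs. agree (lev (L + T)) \<tau> \<sigma> \<longrightarrow>
            avoids ((\<theta> * exp L) powr (CARD('d) / (CARD('d) + 1))) (\<gamma> * exp (- L)) (coding_map \<phi> \<sigma>))"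
proof -
  obtain T \<gamma> L1 where T: "0 \<le> T" "0 < \<gamma>" "\<gamma> \<le> 1" "0 \<le> L1" and
    H: "\<And>L \<omega> (v :: real ^ 'd) t. L1 \<le> L \<Longrightarrow> \<omega> \<in> seqs \<Longrightarrow> norm v = 1 \<Longrightarrow>
       \<exists>\<tau>\<in>seqs. agree (lev L) \<omega> \<tau> \<and>
         (\<forall>\<sigma>\<in>seqs. agree (lev (L + T)) \<tau> \<sigma> \<longrightarrow> \<gamma> * exp (- L) \<le> \<bar>v \<bullet> coding_map \<phi> \<sigma> - t\<bar>)"
    using avoid_hyperplane by metis
  let ?d = "CARD('d)"
  \<comment> \<open>So small that \<open>fact (d + 1) * (2 * \<theta>) ^ d < 1\<close>, the 2 coming
    from the radius of the cube.\<close>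
  define \<theta> where "\<theta> = 1 / (2 * (fact (?d + 1) + 1) :: real)"
  have \<theta>: "0 < \<theta>" by (simp add: \<theta>_def add_pos_pos)
  have \<theta>2: "fact (?d + 1) * (2 * \<theta>) ^ ?d < 1"
  proof -
    have le1: "2 * \<theta> \<le> 1" "0 \<le> 2 * \<theta>" using \<theta> by (auto simp: \<theta>_def)
    have "(2 * \<theta>) ^ ?d \<le> (2 * \<theta>) ^ 1" using le1 by (intro power_decreasing) (auto simp: Suc_le_eq)
    then have "fact (?d + 1) * (2 * \<theta>) ^ ?d \<le> fact (?d + 1) * (2 * \<theta>)"
      unfolding power_one_right by (rule mult_left_mono) simp
    also have "\<dots> < 1"
    proof -
      define F :: real where "F = fact (?d + 1)"
      have "0 < F" by (simp add: F_def)
      then show ?thesis unfolding \<theta>_def F_def[symmetric] by (simp add: field_simps)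
    qed
    finally show ?thesis .
  qed
  show ?thesis
  proof (rule that[OF T(1,2,4) \<theta>])
    fix L \<omega> assume L: "L1 \<le> L" and \<omega>: "\<omega> \<in> seqs"
    define Q where "Q = (\<theta> * exp L) powr (?d / (?d + 1))"
    define x where "x = coding_map \<phi> \<omega>"
    have Q: "Q ^ (?d + 1) = (\<theta> * exp L) ^ ?d"
    proof -
      have "Q ^ (?d + 1) = Q powr (?d + 1)" unfolding Q_def using \<theta> by (subst powr_realpow[symmetric]) auto
      also have "\<dots> = (\<theta> * exp L) powr ?d" unfolding Q_def by (simp add: powr_powr)
      also have "\<dots> = (\<theta> * exp L) ^ ?d" using \<theta> by (subst powr_realpow) auto
      finally show ?thesis .
    qed
    have "\<exists>(v :: real ^ 'd) t. norm v = 1 \<and> (\<forall>(p :: int ^ 'd) (q :: int). 1 \<le> q \<longrightarrow> of_int q \<le> Q \<longrightarrow>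
      (\<forall>i. \<bar>of_int (p $ i) / of_int q - x $ i\<bar> \<le> 2 * exp (- L)) \<longrightarrow>
      v \<bullet> (\<chi> i. of_int (p $ i) / of_int q) = t)"
    proof (rule rational_points_on_hyperplane)
      have "(\<theta> * exp L) * (2 * exp (- L)) = 2 * \<theta>" by (simp add: exp_minus)
      then have e: "(\<theta> * exp L) ^ ?d * (2 * exp (- L)) ^ ?d = (2 * \<theta>) ^ ?d"
        by (simp only: power_mult_distrib[symmetric])
      show "fact (?d + 1) * Q ^ (?d + 1) * (2 * exp (- L)) ^ ?d < 1"
        unfolding Q mult.assoc e by (rule \<theta>2)
    qed (auto simp: Q_def)
    then obtain v :: "real ^ 'd" and t where v: "norm v = 1" and vt: "\<And>(p :: int ^ 'd) (q :: int). 1 \<le> q \<Longrightarrow> of_int q \<le> Q \<Longrightarrow>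
      (\<And>i. \<bar>of_int (p $ i) / of_int q - x $ i\<bar> \<le> 2 * exp (- L)) \<Longrightarrow>
      v \<bullet> (\<chi> i. of_int (p $ i) / of_int q) = t" by blast
    from H[OF L \<omega> v, of t] obtain \<tau> where \<tau>: "\<tau> \<in> seqs" "agree (lev L) \<omega> \<tau>" and
      \<tau>2: "\<And>\<sigma>. \<sigma> \<in> seqs \<Longrightarrow> agree (lev (L + T)) \<tau> \<sigma> \<Longrightarrow> \<gamma> * exp (- L) \<le> \<bar>v \<bullet> coding_map \<phi> \<sigma> - t\<bar>" by blast
    have "avoids Q (\<gamma> * exp (- L)) (coding_map \<phi> \<sigma>)" if \<sigma>: "\<sigma> \<in> seqs" "agree (lev (L + T)) \<tau> \<sigma>" for \<sigma>
      unfolding avoids_def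
    proof (intro allI impI)
      fix p :: "int ^ 'd" and q :: int assume q: "1 \<le> q" "of_int q \<le> Q"
      define y where "y = coding_map \<phi> \<sigma>"
      define z :: "real ^ 'd" where "z = (\<chi> i. of_int (p $ i) / of_int q)"
      have "agree (lev L) \<tau> \<sigma>" by (rule agree_mono[OF \<sigma>(2)], rule lev_mono) (use T(1) in simp)
      then have yx: "\<bar>x $ i - y $ i\<bar> \<le> exp (- L)" for i
        unfolding x_def y_def using \<tau> agree_trans by (intro coding_close_lev[OF \<omega> \<sigma>(1)]) blast
      show "\<gamma> * exp (- L) \<le> norm (coding_map \<phi> \<sigma> - (\<chi> i. of_int (p $ i) / of_int q))"
      \<comment> \<open>Only rational points close to the cylinder are known to lie on the
        hyperplane; for the others the claim follows from \<open>\<gamma> \<le> 1\<close>.\<close>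
      proof (cases "norm (y - z) \<le> exp (- L)")
        case True
        have "\<bar>z $ i - x $ i\<bar> \<le> 2 * exp (- L)" for i
          using component_le_norm_cart[of "y - z" i] True yx[of i] by simp
        then have "v \<bullet> z = t" unfolding z_def by (intro vt q) simp
        then have "\<gamma> * exp (- L) \<le> \<bar>v \<bullet> (y - z)\<bar>" using \<tau>2[OF \<sigma>] by (simp add: y_def inner_diff_right)
        also have "\<dots> \<le> norm v * norm (y - z)" by (rule Cauchy_Schwarz_ineq2)
        finally show ?thesis using v by (simp add: y_def z_def)
      next
        case False
        moreover have "\<gamma> * exp (- L) \<le> 1 * exp (- L)" using T(3) by (intro mult_right_mono) auto
        ultimately have "\<gamma> * exp (- L) \<le> norm (y - z)" by linarith
        then show ?thesis by (simp only: y_def z_def)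
      qed
    qed
    then show "\<exists>\<tau>\<in>seqs. agree (lev L) \<omega> \<tau> \<and>
         (\<forall>\<sigma>\<in>seqs. agree (lev (L + T)) \<tau> \<sigma> \<longrightarrow>
            avoids ((\<theta> * exp L) powr (?d / (?d + 1))) (\<gamma> * exp (- L)) (coding_map \<phi> \<sigma>))"
      using \<tau> by (auto simp: Q_def)
  qed
qed

text \<open>For a denominator \<open>q\<close> take the first scale with \<open>q \<le> Q m\<close>.
  The preceding scale has \<open>Q < q\<close>, and as consecutive scales differ by the fixed factor
  \<open>exp T\<close>, \<open>exp (- L m)\<close> is at least a constant times
  \<open>q powr - (1 + 1 / d)\<close>. The first term of the minimum \<open>c\<close> serves the
  \<open>q\<close> for which there is no preceding scale.\<close>

lemma avoids_all_badly_approximable: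
  fixes L0 T :: real
  assumes \<theta>: "0 < \<theta>" and \<gamma>: "0 < \<gamma>" and T: "0 < T"
    and y: "\<And>m :: nat. avoids ((\<theta> * exp (L0 + m * T)) powr (CARD('d) / (CARD('d) + 1))) (\<gamma> * exp (- (L0 + m * T))) y"
  shows "y \<in> badly_approximable"
proof -
  let ?d = "CARD('d)"
  define L where "L m = L0 + real m * T" for m
  define Q where "Q m = (\<theta> * exp (L m)) powr (?d / (?d + 1))" for m
  define c where "c = min (\<gamma> * exp (- L0)) (\<gamma> * \<theta> * exp (- T))"
  have c: "0 < c" using \<theta> \<gamma> by (simp add: c_def)
  have "c * of_int q powr - (1 + 1 / real ?d) \<le> norm (y - (\<chi> i. of_int (p $ i) / of_int q))"
    if q: "1 \<le> q" for p :: "int ^ 'd" and q :: int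
  proof -
    have "filterlim (\<lambda>m. (\<theta> * exp (L0 + real m * T)) powr (?d / (?d + 1))) at_top sequentially"
      using \<theta> T by real_asymp
    then have "eventually (\<lambda>m. of_int q \<le> Q m) sequentially" by (simp add: filterlim_at_top Q_def L_def)
    then have ex: "\<exists>m. of_int q \<le> Q m" by (rule eventually_happens'[rotated]) simp
    define m where "m = (LEAST m. of_int q \<le> Q m)"
    have m: "of_int q \<le> Q m" unfolding m_def using ex by (rule LeastI_ex)
    have norm: "\<gamma> * exp (- L m) \<le> norm (y - (\<chi> i. of_int (p $ i) / of_int q))"
    proof -
      have "avoids (Q m) (\<gamma> * exp (- L m)) y" using y[of m] by (simp only: Q_def L_def)
      then show ?thesis using q m unfolding avoids_def by blast
    qed
    have q1: "of_int q powr - (1 + 1 / real ?d) \<le> 1"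
    proof -
      have "of_int q powr - (1 + 1 / real ?d) \<le> (of_int q :: real) powr 0"
        using q by (intro powr_mono) (auto simp: neg_le_0_iff_le intro!: add_nonneg_nonneg simp del: minus_add_distrib)
      then show ?thesis using q by simp
    qed
    show ?thesis
    proof (cases m)
      case 0
      have "c * of_int q powr - (1 + 1 / real ?d) \<le> c * 1" using q1 c by (intro mult_left_mono) auto
      also have "\<dots> \<le> \<gamma> * exp (- L m)" by (simp add: c_def 0 L_def)
      finally show ?thesis using norm by simp
    next
      case (Suc m')
      then have "\<not> of_int q \<le> Q m'" using not_less_Least[of m' "\<lambda>m. of_int q \<le> Q m"] by (auto simp: m_def)
      then have "Q m' powr (1 + 1 / real ?d) \<le> of_int q powr (1 + 1 / real ?d)"
        by (intro powr_mono2) (auto simp: Q_def)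
      moreover have "Q m' powr (1 + 1 / real ?d) = \<theta> * exp (L m')"
      proof -
        have one: "D / (D + 1) * (1 + 1 / D) = 1" if "0 < D" for D :: real
        proof -
          have "1 + 1 / D = (D + 1) / D" using that by (simp add: field_simps)
          then show ?thesis using that by simp
        qed
        have "(\<theta> * exp (L m')) powr 1 = \<theta> * exp (L m')" using \<theta> by simp
        moreover have "0 < real ?d" by simp
        ultimately show ?thesis unfolding Q_def powr_powr by (simp only: of_nat_add of_nat_1 one)
      qed
      ultimately have "inverse (of_int q powr (1 + 1 / real ?d)) \<le> inverse (\<theta> * exp (L m'))"
        using \<theta> by (intro le_imp_inverse_le) auto
      then have qle: "of_int q powr - (1 + 1 / real ?d) \<le> exp (- L m') / \<theta>"
        unfolding powr_minus by (simp add: exp_minus field_simps)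
      have "c * of_int q powr - (1 + 1 / real ?d) \<le> (\<gamma> * \<theta> * exp (- T)) * (exp (- L m') / \<theta>)"
        using qle c \<theta> \<gamma> by (intro mult_mono) (auto simp: c_def)
      also have "\<dots> = \<gamma> * (exp (- T) * exp (- L m'))" using \<theta> by simp
      also have "exp (- T) * exp (- L m') = exp (- L m)" by (simp add: exp_add[symmetric] L_def Suc algebra_simps)
      finally show ?thesis using norm by simp
    qed
  qed
  then show ?thesis using c unfolding badly_approximable_def by blast
qed

text \<open>A Cantor set is built by passing alternately to a subcylinder free of rational points
  and to all subcylinders of that one at the next scale; \<open>mass_distribution\<close> then
  applies to the digits numbering the choices.\<close>

theorem hausdorff_measure_badly_approximable:
  assumes xs: "set xs = UNIV"
    and inc: "\<And>k k'. k \<le> k' \<Longrightarrow> k' < length xs \<Longrightarrow> lam (xs ! k) \<le> lam (xs ! k')"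
    and s: "0 \<le> s" "s < (\<Sum>k<length xs. (ln (card_proj (set (take (Suc k) xs))) - ln (card_proj (set (take k xs)))) / lam (xs ! k))"
  shows "hausdorff_measure s (sponge \<phi> E \<inter> badly_approximable) \<noteq> 0"
proof -
  define \<delta> where "\<delta> = (\<Sum>k<length xs. (ln (card_proj (set (take (Suc k) xs))) - ln (card_proj (set (take k xs)))) / lam (xs ! k))"
  obtain T0 \<gamma> L0 \<theta> where T0: "0 \<le> T0" "0 < \<gamma>" "0 \<le> L0" "0 < \<theta>" and
    H: "\<And>L \<omega>. L0 \<le> L \<Longrightarrow> \<omega> \<in> seqs \<Longrightarrow>
       \<exists>\<tau>\<in>seqs. agree (lev L) \<omega> \<tau> \<and>
         (\<forall>\<sigma>\<in>seqs. agree (lev (L + T0)) \<tau> \<sigma> \<longrightarrow>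
            avoids ((\<theta> * exp L) powr (CARD('d) / (CARD('d) + 1))) (\<gamma> * exp (- L)) (coding_map \<phi> \<sigma>))"
    using avoid_rationals by metis
  obtain \<kappa> :: real where \<kappa>: "1 \<le> \<kappa>" "\<And>L. 0 \<le> L \<Longrightarrow> real (nodes (lev (L + T0))) \<le> \<kappa> * nodes (lev L)"
    using nodes_lev_step[OF T0(1)] by metis
  obtain C where C: "\<And>L U Y. 0 \<le> L \<Longrightarrow> bounded U \<Longrightarrow> diameter U \<le> exp (- L) \<Longrightarrow> Y \<subseteq> seqs \<Longrightarrow>
      (\<And>\<sigma>. \<sigma> \<in> Y \<Longrightarrow> coding_map \<phi> \<sigma> \<in> U) \<Longrightarrow>
      (\<And>\<sigma> \<sigma>'. \<sigma> \<in> Y \<Longrightarrow> \<sigma>' \<in> Y \<Longrightarrow> agree (lev L) \<sigma> \<sigma>' \<Longrightarrow> \<sigma> = \<sigma>') \<Longrightarrow> card Y \<le> C"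
    using few_nodes_meet_small_set by metis
  \<comment> \<open>Each step loses at most a factor \<kappa>. The step length is chosen so that the
    surplus \<open>exp (T * (\<delta> - s))\<close> pays for it; it also exceeds \<open>T0\<close>,
    so that every step gets below the selected subcylinder.\<close>
  define T where "T = max (T0 + 1) (ln \<kappa> / (\<delta> - s))"
  have T: "T0 \<le> T" "0 < T" "ln \<kappa> \<le> T * (\<delta> - s)"
    using T0(1) s(2) by (auto simp: T_def \<delta>_def[symmetric] pos_divide_le_eq[symmetric])
  define L where "L m = L0 + real m * T" for m
  have L: "0 \<le> L m" "L0 \<le> L m" for m using T0(3) T(2) by (auto simp: L_def)
  have L_Suc: "L (Suc m) = L m + T" for m by (simp add: L_def algebra_simps)
  \<comment> \<open>The number of choices in step \<open>m\<close>, the same in all cylinders. The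
    division is exact by \<open>nodes_children\<close>.\<close>
  define K where "K m = nodes (lev (L (Suc m))) div nodes (lev (L m + T0))" for m
  define ok where "ok m y \<longleftrightarrow> avoids ((\<theta> * exp (L m)) powr (CARD('d) / (CARD('d) + 1))) (\<gamma> * exp (- L m)) y" for m y
  have step: "K m * nodes (lev (L m + T0)) = nodes (lev (L (Suc m))) \<and>
     (\<exists>g. \<forall>k<K m. g k \<in> seqs \<and> agree (lev (L m)) \<omega> (g k) \<and>
       (\<forall>k'<K m. agree (lev (L (Suc m))) (g k) (g k') \<longrightarrow> k = k') \<and>
       (\<forall>\<sigma>\<in>seqs. agree (lev (L (Suc m))) (g k) \<sigma> \<longrightarrow> ok m (coding_map \<phi> \<sigma>)))" if \<omega>: "\<omega> \<in> seqs" for m \<omega>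
  proof -
    obtain \<tau> where \<tau>: "\<tau> \<in> seqs" "agree (lev (L m)) \<omega> \<tau>"
      "\<And>\<sigma>. \<sigma> \<in> seqs \<Longrightarrow> agree (lev (L m + T0)) \<tau> \<sigma> \<Longrightarrow> ok m (coding_map \<phi> \<sigma>)"
      using H[OF L(2) \<omega>, of m] unfolding ok_def by blast
    have lev1: "lev (L m + T0) i \<le> lev (L (Suc m)) i" for i using T by (intro lev_mono) (simp add: L_Suc)
    have lev0: "lev (L m) i \<le> lev (L m + T0) i" for i using T0 by (intro lev_mono) simp
    obtain Ch where Ch: "finite Ch" "Ch \<subseteq> seqs" "card Ch * nodes (lev (L m + T0)) = nodes (lev (L (Suc m)))"
      "\<And>\<sigma>. \<sigma> \<in> Ch \<Longrightarrow> agree (lev (L m + T0)) \<tau> \<sigma>"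
      "\<And>\<sigma> \<sigma>'. \<sigma> \<in> Ch \<Longrightarrow> \<sigma>' \<in> Ch \<Longrightarrow> agree (lev (L (Suc m))) \<sigma> \<sigma>' \<Longrightarrow> \<sigma> = \<sigma>'"
      by (rule nodes_children[OF lev1 \<tau>(1)], rule that)
    have K: "K m = card Ch" unfolding K_def Ch(3)[symmetric] using nodes_pos[of "lev (L m + T0)"] by simp
    obtain g where g: "bij_betw g {..<card Ch} Ch"
      using ex_bij_betw_nat_finite[OF Ch(1)] by (auto simp: lessThan_atLeast0)
    show ?thesis
    proof (intro conjI exI[of _ g] allI impI)
      show "K m * nodes (lev (L m + T0)) = nodes (lev (L (Suc m)))" using K Ch(3) by simp
    next
      fix k assume k: "k < K m"
      then have gk: "g k \<in> Ch" using g K by (auto simp: bij_betw_def)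
      show "g k \<in> seqs" using gk Ch(2) by blast
      show "agree (lev (L m)) \<omega> (g k)"
        using agree_trans[OF \<tau>(2) agree_mono[OF Ch(4)[OF gk] lev0]] .
      show "k = k'" if "k' < K m" "agree (lev (L (Suc m))) (g k) (g k')" for k'
      proof -
        have "g k' \<in> Ch" using g K that by (auto simp: bij_betw_def)
        then have "g k = g k'" using Ch(5) gk that by blast
        then show ?thesis using g k that K by (auto simp: bij_betw_def inj_on_def)
      qed
      show "\<forall>\<sigma>\<in>seqs. agree (lev (L (Suc m))) (g k) \<sigma> \<longrightarrow> ok m (coding_map \<phi> \<sigma>)"
      proof (intro ballI impI)
        fix \<sigma> assume \<sigma>: "\<sigma> \<in> seqs" "agree (lev (L (Suc m))) (g k) \<sigma>"
        show "ok m (coding_map \<phi> \<sigma>)"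
          by (rule \<tau>(3)[OF \<sigma>(1)], rule agree_trans[OF Ch(4)[OF gk]], rule agree_mono[OF \<sigma>(2) lev1])
      qed
    qed
  qed
  define good where "good m \<omega> g \<longleftrightarrow> (\<forall>k<K m. g k \<in> seqs \<and> agree (lev (L m)) \<omega> (g k) \<and>
       (\<forall>k'<K m. agree (lev (L (Suc m))) (g k) (g k') \<longrightarrow> k = k') \<and>
       (\<forall>\<sigma>\<in>seqs. agree (lev (L (Suc m))) (g k) \<sigma> \<longrightarrow> ok m (coding_map \<phi> \<sigma>)))" for m \<omega> g
  define G where "G m \<omega> = (SOME g. good m \<omega> g)" for m \<omega>
  have G: "G m \<omega> k \<in> seqs \<and> agree (lev (L m)) \<omega> (G m \<omega> k) \<and>
       (\<forall>k'<K m. agree (lev (L (Suc m))) (G m \<omega> k) (G m \<omega> k') \<longrightarrow> k = k') \<and>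
       (\<forall>\<sigma>\<in>seqs. agree (lev (L (Suc m))) (G m \<omega> k) \<sigma> \<longrightarrow> ok m (coding_map \<phi> \<sigma>))"
    if "\<omega> \<in> seqs" "k < K m" for m \<omega> k
  proof -
    have "\<exists>g. good m \<omega> g" using step[OF that(1), of m] unfolding good_def by (rule conjunct2)
    then have "good m \<omega> (G m \<omega>)" unfolding G_def by (rule someI_ex)
    then show ?thesis using that(2) unfolding good_def by blast
  qed
  obtain a0 where "a0 \<in> E" using E_ne by blast
  then have "(\<lambda>_. a0) \<in> seqs" by (simp add: seqs_iff)
  then obtain \<omega>0 where \<omega>0: "\<omega>0 \<in> seqs" by blast
  have K1: "1 \<le> K m" for m
    using step[OF \<omega>0, of m] nodes_pos[of "lev (L (Suc m))"] by (cases "K m") auto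
  \<comment> \<open>The representative of the cylinder reached after \<open>m\<close> choices. It is
    refined, but may change beyond the levels fixed so far.\<close>
  define W where "W \<kappa> = rec_nat \<omega>0 (\<lambda>m \<omega>. G m \<omega> (\<kappa> m))" for \<kappa> :: "nat \<Rightarrow> nat"
  have W0: "W \<kappa> 0 = \<omega>0" and W_Suc: "W \<kappa> (Suc m) = G m (W \<kappa> m) (\<kappa> m)" for \<kappa> m by (simp_all add: W_def)
  let ?X = "\<Pi>\<^sub>E l\<in>UNIV. {..<K l}"
  have W_seqs: "W \<kappa> m \<in> seqs" if "\<kappa> \<in> ?X" for \<kappa> m
  proof (induction m)
    case (Suc m)
    have "\<kappa> m < K m" using that by (auto simp: PiE_iff)
    then show ?case unfolding W_Suc using G[OF Suc.IH] by blast
  qed (simp only: W0 \<omega>0)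
  have W_step: "agree (lev (L m)) (W \<kappa> m) (W \<kappa> (Suc m))" if "\<kappa> \<in> ?X" for \<kappa> m
    unfolding W_Suc using G[OF W_seqs[OF that], of "\<kappa> m" m] that by (auto simp: PiE_iff)
  have lev_L: "lev (L m) i \<le> lev (L m') i" if "m \<le> m'" for m m' i
    using that T(2) by (intro lev_mono) (simp add: L_def mult_right_mono)
  have W_agree: "agree (lev (L m)) (W \<kappa> m) (W \<kappa> m')" if "\<kappa> \<in> ?X" "m \<le> m'" for \<kappa> m m'
    using that(2)
  proof (induction m' rule: dec_induct)
    case (step m')
    show ?case using agree_trans[OF step.IH agree_mono[OF W_step[OF that(1)] lev_L[OF step.hyps(1)]]] .
  qed (simp add: agree_def)
  have lev_unbounded: "\<exists>m. \<forall>i. l < lev (L m) i" for l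
  proof -
    obtain \<Lambda> where \<Lambda>: "\<And>i. lam i \<le> \<Lambda>" "0 < \<Lambda>" using lam_bound by metis
    obtain m :: nat where "(l + 1) * \<Lambda> / T < m" using reals_Archimedean2 by blast
    then have m: "(l + 1) * \<Lambda> < L m" using T(2) T0(3) by (simp add: L_def divide_less_eq)
    have "l < lev (L m) i" for i
    proof -
      have "real (l + 1) * lam i \<le> (l + 1) * \<Lambda>" using \<Lambda>(1) by (intro mult_left_mono) auto
      also have "\<dots> < lev (L m) i * lam i" using m lev_ge[of "L m" i] by simp
      finally have "real (l + 1) < real (lev (L m) i)" using lam_pos[of i] by (simp only: mult_less_cancel_right_pos)
      then show ?thesis by simp
    qed
    then show ?thesis by blast
  qed
  then obtain \<mu> where \<mu>: "\<And>l i. l < lev (L (\<mu> l)) i" by metis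
  \<comment> \<open>The limit sequence: the letter at position \<open>l\<close> is read off at a
    stage where it is fixed in all coordinates.\<close>
  define \<Psi> where "\<Psi> \<kappa> l = W \<kappa> (\<mu> l) l" for \<kappa> l
  have \<Psi>_seqs: "\<Psi> \<kappa> \<in> seqs" if "\<kappa> \<in> ?X" for \<kappa>
    using W_seqs[OF that] by (auto simp: \<Psi>_def seqs_iff simp del: PiE_UNIV_domain)
  have \<Psi>_agree: "agree (lev (L m)) (W \<kappa> m) (\<Psi> \<kappa>)" if "\<kappa> \<in> ?X" for \<kappa> m
    unfolding agree_def
  proof (intro allI impI)
    fix i l assume l: "l < lev (L m) i"
    show "W \<kappa> m l i = \<Psi> \<kappa> l i"
    proof (cases "m \<le> \<mu> l")
      case True
      then show ?thesis using W_agree[OF that True] l by (simp add: agree_def \<Psi>_def)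
    next
      case False
      then show ?thesis using W_agree[OF that, of "\<mu> l" m] \<mu>[of l i] by (simp add: agree_def \<Psi>_def)
    qed
  qed
  have \<Psi>_ok: "ok m (coding_map \<phi> (\<Psi> \<kappa>))" if "\<kappa> \<in> ?X" for \<kappa> m
    using G[OF W_seqs[OF that], of "\<kappa> m" m] \<Psi>_agree[OF that, of "Suc m"] \<Psi>_seqs[OF that] that
    by (auto simp: PiE_iff W_Suc)
  \<comment> \<open>The cylinder at scale \<open>L m\<close> determines the first \<open>m\<close>
    choices, one after the other, because siblings differ at their own scale.\<close>
  have \<Psi>_inj: "restrict \<kappa> {..<m} = restrict \<kappa>' {..<m}"
    if "\<kappa> \<in> ?X" "\<kappa>' \<in> ?X" "agree (lev (L m)) (\<Psi> \<kappa>) (\<Psi> \<kappa>')" for \<kappa> \<kappa>' m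
  proof -
    have "\<kappa> l = \<kappa>' l \<and> W \<kappa> (Suc l) = W \<kappa>' (Suc l)" if "l < m" for l
      using that
    proof (induction l rule: less_induct)
      case (less l)
      have eq: "W \<kappa> l = W \<kappa>' l" using less by (cases l) (auto simp: W0)
      have "agree (lev (L (Suc l))) (\<Psi> \<kappa>) (\<Psi> \<kappa>')"
        using agree_mono[OF \<open>agree (lev (L m)) (\<Psi> \<kappa>) (\<Psi> \<kappa>')\<close> lev_L[of "Suc l" m]] less.prems by simp
      then have "agree (lev (L (Suc l))) (W \<kappa> (Suc l)) (W \<kappa>' (Suc l))"
        using \<Psi>_agree[OF \<open>\<kappa> \<in> ?X\<close>, of "Suc l"] \<Psi>_agree[OF \<open>\<kappa>' \<in> ?X\<close>, of "Suc l"] agree_trans agree_sym by metis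
      moreover have "\<kappa> l < K l" "\<kappa>' l < K l" using \<open>\<kappa> \<in> ?X\<close> \<open>\<kappa>' \<in> ?X\<close> by (auto simp: PiE_iff)
      ultimately have "\<kappa> l = \<kappa>' l" using G[OF W_seqs[OF \<open>\<kappa> \<in> ?X\<close>], of "\<kappa> l" l l] unfolding W_Suc eq[symmetric] by blast
      then show ?case using eq by (simp add: W_Suc)
    qed
    then show ?thesis by (auto simp: restrict_def)
  qed
  have nodes_ge: "exp (\<delta> * L m) \<le> nodes (lev (L m))" for m
  proof -
    have "L m * \<delta> \<le> ln (nodes (lev (L m)))" unfolding \<delta>_def by (intro nodes_lev_ge xs L inc) auto
    then have "exp (\<delta> * L m) \<le> exp (ln (nodes (lev (L m))))" by (simp add: mult.commute)
    then show ?thesis using nodes_pos[of "lev (L m)"] by simp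
  qed
  have prodK: "real (nodes (lev (L m))) \<le> \<kappa> ^ m * nodes (lev (L 0)) * (\<Prod>l<m. real (K l))" for m
  proof (induction m)
    case (Suc m)
    have "real (nodes (lev (L (Suc m)))) = K m * real (nodes (lev (L m + T0)))"
      using step[OF \<omega>0, of m] by (metis of_nat_mult)
    also have "\<dots> \<le> K m * (\<kappa> * nodes (lev (L m)))" using \<kappa>(2)[OF L(1), of m] by (intro mult_left_mono) auto
    also have "\<dots> \<le> K m * (\<kappa> * (\<kappa> ^ m * nodes (lev (L 0)) * (\<Prod>l<m. real (K l))))"
      using Suc.IH \<kappa>(1) by (intro mult_left_mono) auto
    finally show ?case by (simp add: mult_ac)
  qed simp
  define B where "B = (real C + 1) * nodes (lev (L 0)) * exp (s * T)"
  have B: "0 < B" using nodes_pos[of "lev (L 0)"] by (simp add: B_def Suc_le_eq)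
  have "hausdorff_measure s ((coding_map \<phi> \<circ> \<Psi>) ` ?X) \<noteq> 0"
  proof (rule mass_distribution[where rad="\<lambda>m. exp (- L m)" and C=C and B=B])
    show "(\<lambda>m. exp (- L m)) \<longlonglongrightarrow> 0" unfolding L_def using T(2) by real_asymp
    fix m
    show "1 \<le> K m" by (rule K1)
    show "0 < exp (- L m)" by simp
    show "real C / (\<Prod>l<m. real (K l)) \<le> B * exp (- L (Suc m)) powr s"
    proof -
      have pK: "0 < (\<Prod>l<m. real (K l))" using K1 by (intro prod_pos) (auto simp: Suc_le_eq)
      have N0: "0 < real (nodes (lev (L 0)))" using nodes_pos[of "lev (L 0)"] by simp
      have "ln \<kappa> * m \<le> (T * (\<delta> - s)) * m" using T(3) by (intro mult_right_mono) auto
      also have "\<dots> \<le> (\<delta> - s) * L m"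
      proof -
        have "(T * (\<delta> - s)) * m = (\<delta> - s) * (real m * T)" by (simp add: mult_ac)
        also have "\<dots> \<le> (\<delta> - s) * L m"
          using s(2) T0(3) by (intro mult_left_mono) (auto simp: L_def \<delta>_def[symmetric])
        finally show ?thesis .
      qed
      finally have "exp (ln \<kappa> * m) \<le> exp ((\<delta> - s) * L m)" by simp
      then have \<kappa>m: "\<kappa> ^ m \<le> exp ((\<delta> - s) * L m)" using \<kappa>(1) by (simp add: exp_of_nat2_mult)
      have "exp (\<delta> * L m) \<le> \<kappa> ^ m * nodes (lev (L 0)) * (\<Prod>l<m. real (K l))"
        using nodes_ge prodK order_trans by blast
      also have "\<dots> \<le> exp ((\<delta> - s) * L m) * nodes (lev (L 0)) * (\<Prod>l<m. real (K l))"
        using \<kappa>m pK by (intro mult_right_mono) auto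
      finally have "exp ((\<delta> - s) * L m) * exp (s * L m) \<le> exp ((\<delta> - s) * L m) * (nodes (lev (L 0)) * (\<Prod>l<m. real (K l)))"
        by (simp add: exp_add[symmetric] algebra_simps)
      then have "exp (s * L m) \<le> nodes (lev (L 0)) * (\<Prod>l<m. real (K l))" by simp
      then have "1 / (\<Prod>l<m. real (K l)) \<le> nodes (lev (L 0)) * exp (- (s * L m))"
        using pK by (simp add: exp_minus field_simps)
      then have "real C * (1 / (\<Prod>l<m. real (K l))) \<le> real C * (nodes (lev (L 0)) * exp (- (s * L m)))"
        by (intro mult_left_mono) auto
      also have "\<dots> \<le> (real C + 1) * (nodes (lev (L 0)) * exp (- (s * L m)))" by (intro mult_right_mono) auto
      also have "exp (- (s * L m)) = exp (s * T) * exp (- L (Suc m)) powr s"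
        by (simp add: powr_def exp_add[symmetric] L_Suc algebra_simps)
      finally show ?thesis by (simp add: B_def mult_ac)
    qed
    fix U :: "(real ^ 'd) set" assume U: "bounded U" "diameter U \<le> exp (- L m)"
    let ?S = "{\<kappa> \<in> ?X. (coding_map \<phi> \<circ> \<Psi>) \<kappa> \<in> U}"
    let ?r = "\<lambda>\<kappa>. restrict \<kappa> {..<m} :: nat \<Rightarrow> nat"
    \<comment> \<open>One digit sequence for each initial segment that is to be counted; the
      corresponding limit sequences lie in different cylinders, so \<open>C\<close> bounds their
      number.\<close>
    obtain S where S: "S \<subseteq> ?S" "inj_on ?r S" "?r ` ?S = ?r ` S"
      using subset_image_inj[of "?r ` ?S" ?r ?S] by auto
    have injS: "\<kappa> = \<kappa>'" if "\<kappa> \<in> S" "\<kappa>' \<in> S" "agree (lev (L m)) (\<Psi> \<kappa>) (\<Psi> \<kappa>')" for \<kappa> \<kappa>'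
    proof -
      have "\<kappa> \<in> ?X" "\<kappa>' \<in> ?X" using S(1) that by blast+
      then have "?r \<kappa> = ?r \<kappa>'" using that(3) by (rule \<Psi>_inj)
      then show ?thesis using S(2) that by (auto dest: inj_onD)
    qed
    have "inj_on \<Psi> S"
    proof (rule inj_onI)
      fix \<kappa> \<kappa>' assume "\<kappa> \<in> S" "\<kappa>' \<in> S" "\<Psi> \<kappa> = \<Psi> \<kappa>'"
      then show "\<kappa> = \<kappa>'" by (intro injS) (auto simp: agree_def)
    qed
    then have "card (?r ` ?S) = card (\<Psi> ` S)" unfolding S(3) using S(2) by (simp add: card_image)
    also have "\<dots> \<le> C"
    proof (rule C[OF L(1) U])
      show "\<Psi> ` S \<subseteq> seqs" using S(1) \<Psi>_seqs by blast
      show "coding_map \<phi> \<sigma> \<in> U" if "\<sigma> \<in> \<Psi> ` S" for \<sigma> using that S(1) by auto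
      show "\<sigma> = \<sigma>'" if "\<sigma> \<in> \<Psi> ` S" "\<sigma>' \<in> \<Psi> ` S" "agree (lev (L m)) \<sigma> \<sigma>'" for \<sigma> \<sigma>'
        using that injS by blast
    qed
    finally show "card (?r ` ?S) \<le> C" .
  qed (use s B in auto)
  moreover have "(coding_map \<phi> \<circ> \<Psi>) ` ?X \<subseteq> sponge \<phi> E \<inter> badly_approximable"
  proof
    fix y assume "y \<in> (coding_map \<phi> \<circ> \<Psi>) ` ?X"
    then obtain \<kappa>' where \<kappa>': "\<kappa>' \<in> ?X" "y = coding_map \<phi> (\<Psi> \<kappa>')" by (metis comp_apply imageE)
    have "y \<in> badly_approximable"
      using \<Psi>_ok[OF \<kappa>'(1)] T0 T unfolding \<kappa>'(2) ok_def L_def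
      by (intro avoids_all_badly_approximable[of \<theta> \<gamma> T L0]) auto
    moreover have "y \<in> sponge \<phi> E" unfolding sponge_def \<kappa>'(2) using \<Psi>_seqs[OF \<kappa>'(1)] by (rule imageI)
    ultimately show "y \<in> sponge \<phi> E \<inter> badly_approximable" by blast
  qed
  ultimately show ?thesis using hausdorff_measure_subset_null by blast
qed

end

section \<open>Blocks of letters\<close>

text \<open>\<open>log_count I M / size M\<close> plays the role of the entropy of the projection to \<open>I\<close> of a
  Bernoulli measure with letter frequencies given by \<open>M\<close>.\<close>

definition log_count :: "'d set \<Rightarrow> ('d \<Rightarrow> 'a) multiset \<Rightarrow> real" where
  "log_count I M = ln (card (permutations_of_multiset (image_mset (\<lambda>a. restrict a I) M)))"

text \<open>A letter of the new alphabet must again be a function of the coordinate: a list of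
  letters is replaced by its lists of \<open>i\<close>-th components.\<close>

definition block :: "('d \<Rightarrow> 'a) list \<Rightarrow> 'd \<Rightarrow> 'a list" where
  "block u i = map (\<lambda>a. a i) u"

definition block_map :: "('d \<Rightarrow> 'a \<Rightarrow> real \<Rightarrow> real) \<Rightarrow> 'd \<Rightarrow> 'a list \<Rightarrow> real \<Rightarrow> real" where
  "block_map \<phi> i v = coord_map (\<phi> i) ((!) v) (length v)"

lemma length_block [simp]: "length (block u i) = length u"
  by (simp add: block_def)

lemma permute_list_inj:
  assumes "\<sigma> permutes {..<n}" "length v = n" "length v' = n" "permute_list \<sigma> v = permute_list \<sigma> v'"
  shows "v = v'"
proof (rule nth_equalityI)
  show "length v = length v'" using assms by simp
  fix l assume l: "l < length v"
  have "l \<in> \<sigma> ` {..<n}" using permutes_image[OF assms(1)] l assms(2) by simp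
  then obtain k where k: "k < n" "l = \<sigma> k" by auto
  have "permute_list \<sigma> v ! k = v ! l" "permute_list \<sigma> v' ! k = v' ! l"
    using permute_list_nth[of \<sigma> v k] permute_list_nth[of \<sigma> v' k] assms(1-3) k by auto
  then show "v ! l = v' ! l" using assms(4) by simp
qed

context sponge_ifs
begin

definition mrate :: "'d \<Rightarrow> ('d \<Rightarrow> 'a) multiset \<Rightarrow> real" where
  "mrate i M = (\<Sum>a\<in>#M. rate i a)"

context
  fixes M :: "('d \<Rightarrow> 'a) multiset"
  assumes M: "set_mset M = E"
begin

definition blocks :: "('d \<Rightarrow> 'a list) set" where
  "blocks = block ` permutations_of_multiset M"

definition block_letters :: "'d \<Rightarrow> 'a list set" where
  "block_letters i = {v. set v \<subseteq> A i \<and> length v = size M}"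

lemma size_M: "0 < size M"
  using M E_ne by (auto simp: nonempty_has_size[symmetric])

lemma perm_in: "u \<in> permutations_of_multiset M \<Longrightarrow> l < size M \<Longrightarrow> u ! l \<in> E"
  using M by (metis length_finite_permutations_of_multiset nth_mem permutations_of_multisetD set_mset_mset)

text \<open>The results on \<open>coord_map\<close> concern infinite words over the index set; a
  list is continued by repeating its first entry.\<close>

lemma block_map_eq:
  assumes "length v = n" "0 < n"
  shows "block_map \<phi> i v = coord_map (\<phi> i) (\<lambda>l. v ! (if l < n then l else 0)) n"
  unfolding block_map_def assms(1) by (intro coord_map_cong) auto

lemma block_similarity:
  assumes v: "v \<in> block_letters i"
  shows "contracting_similarity (block_map \<phi> i v)"
    "contraction_ratio (block_map \<phi> i v) = (\<Prod>l<size M. contraction_ratio (\<phi> i (v ! l)))"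
proof -
  define w where "w l = v ! (if l < size M then l else 0)" for l
  have w: "w l \<in> A i" for l
    using v size_M unfolding w_def block_letters_def by (auto simp: subset_iff)
  have eq: "block_map \<phi> i v = coord_map (\<phi> i) w (size M)"
    unfolding w_def using v size_M by (intro block_map_eq) (auto simp: block_letters_def)
  have sc: "scales (\<Prod>l<size M. contraction_ratio (\<phi> i (v ! l))) (block_map \<phi> i v)"
    using coord_map_scales[of "\<phi> i" w "size M", OF sim_A[OF w]] unfolding eq by (simp add: w_def)
  then show "contraction_ratio (block_map \<phi> i v) = (\<Prod>l<size M. contraction_ratio (\<phi> i (v ! l)))"
    by (rule contraction_ratio_eqI)
  have r: "0 < contraction_ratio (\<phi> i (v ! l))" "contraction_ratio (\<phi> i (v ! l)) < 1" if "l < size M" for l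
    using contracting_similarityD(2,3)[OF sim_A[OF w[of l]]] that by (auto simp: w_def)
  have "0 < (\<Prod>l<size M. contraction_ratio (\<phi> i (v ! l)))" using r by (intro prod_pos) auto
  moreover have "(\<Prod>l<size M. contraction_ratio (\<phi> i (v ! l))) < 1"
  proof -
    have "(\<Prod>l<size M. contraction_ratio (\<phi> i (v ! l))) \<le> contraction_ratio (\<phi> i (v ! 0))"
    proof -
      have "(\<Prod>l<size M. contraction_ratio (\<phi> i (v ! l))) =
          contraction_ratio (\<phi> i (v ! 0)) * (\<Prod>l\<in>{..<size M} - {0}. contraction_ratio (\<phi> i (v ! l)))"
        using size_M by (intro prod.remove) auto
      also have "\<dots> \<le> contraction_ratio (\<phi> i (v ! 0)) * 1"
        using r[of 0] size_M by (intro mult_left_mono prod_le_1) (auto simp: r less_imp_le)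
      finally show ?thesis by simp
    qed
    then show ?thesis using r[OF size_M] by simp
  qed
  moreover have "block_map \<phi> i v ` {0..1} \<subseteq> {0..1}"
    unfolding eq using coord_map_in[of "\<phi> i" w, OF sim_A[OF w]] by blast
  ultimately show "contracting_similarity (block_map \<phi> i v)"
    using sc unfolding contracting_similarity_def scales_def by blast
qed

lemma block_in: "u \<in> permutations_of_multiset M \<Longrightarrow> block u i \<in> block_letters i"
  using E_A M by (auto simp: block_def block_letters_def length_finite_permutations_of_multiset dest!: permutations_of_multisetD)

lemma block_ifs: "diagonal_IFS block_letters (block_map \<phi>) blocks"
  unfolding diagonal_IFS_def
proof (intro conjI allI ballI)
  show "finite (block_letters i)" for i
    using ifs unfolding block_letters_def diagonal_IFS_def by (intro finite_lists_length_eq) auto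
  show "contracting_similarity (block_map \<phi> i a)" if "a \<in> block_letters i" for i a
    using that by (rule block_similarity)
  show "blocks \<subseteq> (\<Pi>\<^sub>E i\<in>UNIV. block_letters i)" using block_in by (auto simp: blocks_def)
  show "blocks \<noteq> {}" by (simp add: blocks_def)
qed

interpretation B: sponge_ifs block_letters "block_map \<phi>" blocks
  by standard (rule block_ifs)

lemma block_rate: "a \<in> blocks \<Longrightarrow> B.rate i a = mrate i M"
proof -
  assume "a \<in> blocks"
  then obtain u where u: "u \<in> permutations_of_multiset M" "a = block u" by (auto simp: blocks_def)
  have len: "length u = size M" using u(1) by (rule length_finite_permutations_of_multiset)
  have "contraction_ratio (block_map \<phi> i (a i)) = (\<Prod>l<size M. exp (- rate i (u ! l)))"
    unfolding block_similarity(2)[OF block_in[OF u(1)], folded u(2)]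
    using perm_in[OF u(1)] len by (intro prod.cong refl) (simp add: u(2) block_def ratio_eq)
  also have "\<dots> = exp (- (\<Sum>l<size M. rate i (u ! l)))" by (simp add: exp_sum sum_negf[symmetric])
  also have "(\<Sum>l<size M. rate i (u ! l)) = sum_list (map (rate i) u)"
    using len by (simp add: sum_list_sum_nth atLeast0LessThan)
  also have "\<dots> = mrate i M"
    using permutations_of_multisetD[OF u(1)] unfolding mrate_def by (metis mset_map sum_mset_sum_list)
  finally show ?thesis by (simp add: B.rate_def)
qed

text \<open>A permutation of positions taking \<open>u\<close> to \<open>u'\<close> acts on all
  coordinates at once. It maps the blocks with the \<open>I\<close>-part of \<open>u\<close>
  injectively to blocks with the \<open>I\<close>-part of \<open>u'\<close>.\<close>

lemma block_fibre_card_le: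
  assumes u: "u \<in> permutations_of_multiset M" and u': "u' \<in> permutations_of_multiset M"
    and IJ: "I \<subseteq> J"
  shows "card {y \<in> (\<lambda>b. restrict b J) ` blocks. restrict y I = restrict (block u) I} \<le>
    card {y \<in> (\<lambda>b. restrict b J) ` blocks. restrict y I = restrict (block u') I}" (is "card (?F u) \<le> card (?F u')")
proof -
  have "mset u' = mset u" using u u' by (simp add: permutations_of_multisetD)
  then obtain \<sigma> where \<sigma>: "\<sigma> permutes {..<length u}" "permute_list \<sigma> u = u'" by (rule mset_eq_permutation)
  have len: "length u = size M" using u by (rule length_finite_permutations_of_multiset)
  note \<sigma>1 = \<sigma>(1)[unfolded len]
  have JI: "J \<inter> I = I" using IJ by blast
  define P where "P y = restrict (\<lambda>i. permute_list \<sigma> (y i)) J" for y :: "'d \<Rightarrow> 'a list"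
  have pb: "permute_list \<sigma> (block b i) = block (permute_list \<sigma> b) i" if "length b = size M" for b i
    unfolding block_def by (rule permute_list_map) (simp add: that \<sigma>1)
  have "P ` ?F u \<subseteq> ?F u'"
  proof
    fix z assume "z \<in> P ` ?F u"
    then obtain b where b: "b \<in> permutations_of_multiset M" "z = P (restrict (block b) J)"
      "restrict (restrict (block b) J) I = restrict (block u) I" unfolding blocks_def by blast
    have lb: "length b = size M" using b(1) by (rule length_finite_permutations_of_multiset)
    have z: "z = restrict (block (permute_list \<sigma> b)) J" unfolding b(2) P_def by (auto simp: pb[OF lb])
    have "permute_list \<sigma> b \<in> permutations_of_multiset M"
      using b(1) \<sigma>1 lb by (auto simp: permutations_of_multiset_def)
    moreover have "restrict z I = restrict (block u') I"
    proof
      fix i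
      show "restrict z I i = restrict (block u') I i"
      proof (cases "i \<in> I")
        case True
        then have "block b i = block u i" using fun_cong[OF b(3), of i] IJ by auto
        then have "block (permute_list \<sigma> b) i = block u' i"
          unfolding pb[OF lb, symmetric] \<sigma>(2)[symmetric] pb[OF len, symmetric] by (rule arg_cong)
        then show ?thesis using True IJ unfolding z by auto
      qed simp
    qed
    ultimately show "z \<in> ?F u'" unfolding z blocks_def by blast
  qed
  moreover have "inj_on P (?F u)"
  proof (rule inj_onI)
    fix y y' assume y: "y \<in> ?F u" "y' \<in> ?F u" "P y = P y'"
    obtain b b' where b: "b \<in> permutations_of_multiset M" "y = restrict (block b) J"
      "b' \<in> permutations_of_multiset M" "y' = restrict (block b') J" using y(1,2) unfolding blocks_def by blast
    have lb: "length b = size M" "length b' = size M" using b length_finite_permutations_of_multiset by blast+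
    have "block b i = block b' i" if "i \<in> J" for i
    proof (rule permute_list_inj[OF \<sigma>1])
      show "permute_list \<sigma> (block b i) = permute_list \<sigma> (block b' i)"
        using fun_cong[OF y(3), of i] that by (simp add: P_def b)
    qed (simp_all add: lb)
    then show "y = y'" unfolding b by (intro restrict_ext) blast
  qed
  moreover have "finite (?F u')" by (simp add: blocks_def)
  ultimately show ?thesis using card_inj_on_le by blast
qed

text \<open>By symmetry in \<open>u\<close> and \<open>u'\<close> all fibres have the same size, and
  they partition the projection to \<open>J\<close>.\<close>

lemma block_fibres:
  assumes IJ: "I \<subseteq> J" and a: "a \<in> blocks"
  shows "card ((\<lambda>b. restrict b J) ` {b \<in> blocks. restrict b I = restrict a I}) * card ((\<lambda>b. restrict b I) ` blocks) =
    card ((\<lambda>b. restrict b J) ` blocks)"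
proof -
  define F where "F c = {y \<in> (\<lambda>b. restrict b J) ` blocks. restrict y I = c}" for c :: "'d \<Rightarrow> 'a list"
  have rr: "restrict (restrict b J) I = restrict b I" for b :: "'d \<Rightarrow> 'a list"
    by (simp add: Int_absorb1[OF IJ])
  have JI: "J \<inter> I = I" using IJ by blast
  have fin: "finite ((\<lambda>b. restrict b J) ` blocks)" by (simp add: blocks_def)
  have "F (restrict a I) = (\<lambda>b. restrict b J) ` {b \<in> blocks. restrict b I = restrict a I}"
    by (auto simp: F_def JI)
  moreover have "(\<Sum>c\<in>(\<lambda>b. restrict b I) ` blocks. card (F c)) = (\<Sum>c\<in>(\<lambda>b. restrict b I) ` blocks. card (F (restrict a I)))"
  proof (rule sum.cong[OF refl])
    fix c assume "c \<in> (\<lambda>b. restrict b I) ` blocks"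
    then obtain b where b: "b \<in> blocks" "c = restrict b I" by blast
    show "card (F c) = card (F (restrict a I))" unfolding b(2)
      using a b(1) block_fibre_card_le[OF _ _ IJ] unfolding blocks_def F_def by (blast intro!: antisym)
  qed
  moreover have "card ((\<lambda>b. restrict b J) ` blocks) = (\<Sum>c\<in>(\<lambda>b. restrict b I) ` blocks. card (F c))"
  proof -
    have "(\<lambda>b. restrict b J) ` blocks = (\<Union>c\<in>(\<lambda>b. restrict b I) ` blocks. F c)"
      by (auto simp: F_def JI)
    moreover have "card (\<Union>c\<in>(\<lambda>b. restrict b I) ` blocks. F c) = (\<Sum>c\<in>(\<lambda>b. restrict b I) ` blocks. card (F c))"
      by (rule card_UN_disjoint) (auto simp: F_def blocks_def)
    ultimately show ?thesis by simp
  qed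
  ultimately show ?thesis by (simp add: mult.commute)
qed

lemma card_proj_blocks:
  "card ((\<lambda>b. restrict b I) ` blocks) = card (permutations_of_multiset (image_mset (\<lambda>a. restrict a I) M))"
proof -
  define g where "g v = restrict (block v) I" for v :: "('d \<Rightarrow> 'a) list"
  let ?P = "permutations_of_multiset (image_mset (\<lambda>a. restrict a I) M)"
  have "(\<lambda>b. restrict b I) ` blocks = g ` map (\<lambda>a. restrict a I) ` permutations_of_multiset M"
    unfolding blocks_def image_image g_def by (intro image_cong refl) (auto simp: block_def restrict_def fun_eq_iff)
  also have "\<dots> = g ` ?P" by (simp add: permutations_of_multiset_image)
  finally have "(\<lambda>b. restrict b I) ` blocks = g ` ?P" .
  moreover have "inj_on g ?P"
  proof (rule inj_onI)
    fix v v' assume v: "v \<in> ?P" "v' \<in> ?P" "g v = g v'"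
    obtain w w' where w: "v = map (\<lambda>a. restrict a I) w" "v' = map (\<lambda>a. restrict a I) w'"
      using v(1,2) unfolding permutations_of_multiset_image by blast
    have len: "length v = length v'" using length_finite_permutations_of_multiset[OF v(1)]
      length_finite_permutations_of_multiset[OF v(2)] by simp
    show "v = v'"
    proof (rule nth_equalityI[OF len], rule ext)
      fix l i assume l: "l < length v"
      have "block v i = block v' i" if "i \<in> I" using fun_cong[OF v(3), of i] that by (simp add: g_def)
      then have "(v ! l) i = (v' ! l) i" if "i \<in> I"
        using that l len nth_map[of l v "\<lambda>a. a i"] nth_map[of l v' "\<lambda>a. a i"] by (simp add: block_def)
      then show "(v ! l) i = (v' ! l) i" using l len unfolding w by (cases "i \<in> I") auto
    qed
  qed
  ultimately show ?thesis by (simp add: card_image)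
qed

text \<open>Concatenating blocks gives a sequence over \<open>E\<close>, whose approximations at
  multiples of the block length are those of the block sponge.\<close>

lemma block_sponge: "sponge (block_map \<phi>) blocks \<subseteq> sponge \<phi> E"
proof
  fix x assume "x \<in> sponge (block_map \<phi>) blocks"
  then obtain \<omega>' where \<omega>': "\<omega>' \<in> B.seqs" "x = coding_map (block_map \<phi>) \<omega>'" by (auto simp: sponge_def)
  have "\<forall>l. \<exists>u. u \<in> permutations_of_multiset M \<and> \<omega>' l = block u"
    using B.seqsD[OF \<omega>'(1)] unfolding blocks_def by blast
  then obtain U where U: "\<And>l. U l \<in> permutations_of_multiset M" "\<And>l. \<omega>' l = block (U l)" by metis
  define N where "N = size M"
  have N: "0 < N" using size_M by (simp add: N_def)
  have lenU: "length (U n) = N" for n using length_finite_permutations_of_multiset[OF U(1)] by (simp add: N_def)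
  define \<omega> where "\<omega> l = U (l div N) ! (l mod N)" for l
  have \<omega>: "\<omega> \<in> seqs" unfolding seqs_iff \<omega>_def using perm_in[OF U(1)] N by (simp add: N_def)
  have cm: "coord_map (block_map \<phi> i) (\<lambda>l. \<omega>' l i) n = coord_map (\<phi> i) (\<lambda>l. \<omega> l i) (n * N)" for i n
  proof (induction n)
    case (Suc n)
    have "block_map \<phi> i (\<omega>' n i) = coord_map (\<phi> i) (\<lambda>l. \<omega> (n * N + l) i) N"
      unfolding U(2) block_map_def length_block lenU
      using lenU by (intro coord_map_cong) (auto simp: block_def \<omega>_def)
    then show ?case
      using coord_map_add[of "\<phi> i" "\<lambda>l. \<omega> l i" "n * N" N] Suc by (simp add: add.commute)
  qed simp
  then have "word_map (block_map \<phi>) \<omega>' n 0 = word_map \<phi> \<omega> (n * N) 0" for n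
    by (simp add: vec_eq_iff word_map_nth)
  moreover have "(\<lambda>n. word_map \<phi> \<omega> (n * N) 0) \<longlonglongrightarrow> coding_map \<phi> \<omega>"
    using LIMSEQ_subseq_LIMSEQ[OF coding_map_LIMSEQ[OF \<omega>], of "\<lambda>n. n * N"] N
    by (simp add: strict_mono_def o_def)
  ultimately have "coding_map (block_map \<phi>) \<omega>' = coding_map \<phi> \<omega>"
    using LIMSEQ_unique[OF B.coding_map_LIMSEQ[OF \<omega>'(1)]] by simp
  then show "x \<in> sponge \<phi> E" using \<omega> \<omega>'(2) by (auto simp: sponge_def)
qed

text \<open>Since \<open>M\<close> contains every letter, it contains one that distinguishes the two
  coordinates.\<close>

lemma mrate_strict_mono:
  assumes "coord_prec \<phi> E i j" "i \<noteq> j" "distinguishable_coordinates \<phi> E"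
  shows "mrate i M < mrate j M"
proof -
  have le: "rate i a \<le> rate j a" if "a \<in> E" for a
    using assms(1) that contracting_similarityD(2)[OF sim[OF that]] by (auto simp: rate_def coord_prec_def)
  obtain a where a: "a \<in> E" "contraction_ratio (\<phi> i (a i)) \<noteq> contraction_ratio (\<phi> j (a j))"
    using assms(2,3) by (auto simp: distinguishable_coordinates_def)
  then have "rate i a < rate j a" using le[OF a(1)] ratio_eq[OF a(1)] by (auto simp: less_le)
  moreover obtain M' where M': "M = add_mset a M'" using a(1) M by (metis multi_member_split)
  moreover have "(\<Sum>a\<in>#M'. rate i a) \<le> (\<Sum>a\<in>#M'. rate j a)"
    using le M M' by (intro sum_mset_mono) auto
  ultimately show ?thesis by (simp add: mrate_def)
qed

text \<open>Every block contains the two letters \<open>c\<close>, \<open>d\<close> provided by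
  irreducibility. Swapping them changes exactly the coordinates in which they differ, and all of
  these contract at least as fast as \<open>i\<close>.\<close>

lemma block_diffuse:
  assumes irr: "irreducible_sponge \<phi> E" and dist: "distinguishable_coordinates \<phi> E" and a: "a \<in> blocks"
  shows "\<exists>b\<in>blocks. b i \<noteq> a i \<and> (\<forall>j. a j \<noteq> b j \<longrightarrow> j = i \<or> mrate i M < mrate j M)"
proof -
  obtain u where u: "u \<in> permutations_of_multiset M" "a = block u" using a by (auto simp: blocks_def)
  obtain c d where cd: "c \<in> E" "d \<in> E" "c i \<noteq> d i" "{j. c j \<noteq> d j} \<subseteq> {j. coord_prec \<phi> E i j}"
    using irr unfolding irreducible_sponge_def by metis
  have "set u = E" using permutations_of_multisetD[OF u(1)] M by (metis set_mset_mset)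
  then obtain s t where st: "s < length u" "t < length u" "u ! s = c" "u ! t = d"
    using cd(1,2) by (metis in_set_conv_nth)
  have "s \<noteq> t" using st cd(3) by auto
  define u' where "u' = u[t := u ! s, s := u ! t]"
  have "u' \<in> permutations_of_multiset M"
    using u(1) mset_swap[OF st(1,2)] by (simp add: permutations_of_multiset_def u'_def)
  then have "block u' \<in> blocks" by (simp add: blocks_def)
  moreover have "block u' i \<noteq> a i"
  proof
    assume "block u' i = a i"
    then have "block u' i ! s = block u i ! s" by (simp add: u(2))
    then show False using st cd(3) \<open>s \<noteq> t\<close> by (simp add: block_def u'_def)
  qed
  moreover have "j = i \<or> mrate i M < mrate j M" if "a j \<noteq> block u' j" for j
  proof -
    have "c j \<noteq> d j"
    proof
      assume cdj: "c j = d j"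
      have "block u j = block u' j"
        using st cdj unfolding block_def u'_def
        by (intro nth_equalityI) (auto simp: nth_list_update)
      then show False using that u(2) by simp
    qed
    then have "coord_prec \<phi> E i j" using cd(4) by blast
    then show ?thesis using mrate_strict_mono[OF _ _ dist] by blast
  qed
  ultimately show ?thesis by blast
qed

lemma block_baranski: "baranski A \<phi> \<Longrightarrow> baranski block_letters (block_map \<phi>)"
  unfolding baranski_def disjoint_family_on_def
proof (intro allI ballI impI)
  assume bar: "\<forall>i. \<forall>m\<in>A i. \<forall>n\<in>A i. m \<noteq> n \<longrightarrow> \<phi> i m ` {0<..<1} \<inter> \<phi> i n ` {0<..<1} = {}"
  fix i v v' assume v: "v \<in> block_letters i" "v' \<in> block_letters i" "v \<noteq> v'"
  have "\<exists>l<size M. v ! l \<noteq> v' ! l" using v by (auto simp: block_letters_def list_eq_iff_nth_eq)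
  then have *: "\<exists>l<size M. v ! (if l < size M then l else 0) \<noteq> v' ! (if l < size M then l else 0)" by auto
  have in_A: "w ! (if l < size M then l else 0) \<in> A i" if "w \<in> block_letters i" for w l
    using that size_M by (auto simp: block_letters_def subset_iff)
  have eq: "block_map \<phi> i w = coord_map (\<phi> i) (\<lambda>l. w ! (if l < size M then l else 0)) (size M)"
    if "w \<in> block_letters i" for w
    using that size_M by (intro block_map_eq) (auto simp: block_letters_def)
  show "block_map \<phi> i v ` {0<..<1} \<inter> block_map \<phi> i v' ` {0<..<1} = {}"
    unfolding eq[OF v(1)] eq[OF v(2)]
    by (rule coord_map_disjoint[of "A i", OF _ _ in_A[OF v(1)] in_A[OF v(2)] *])
      (use bar in \<open>auto simp: disjoint_family_on_def intro: sim_A\<close>)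
qed

theorem hausdorff_dim_badly_approximable_ge:
  assumes "baranski A \<phi>" "irreducible_sponge \<phi> E" "distinguishable_coordinates \<phi> E"
    and xs: "set xs = UNIV"
    and inc: "\<And>k k'. k \<le> k' \<Longrightarrow> k' < length xs \<Longrightarrow> mrate (xs ! k) M \<le> mrate (xs ! k') M"
  shows "ennreal (\<Sum>k<length xs. (log_count (set (take (Suc k) xs)) M - log_count (set (take k xs)) M) / mrate (xs ! k) M)
    \<le> hausdorff_dim (sponge \<phi> E \<inter> badly_approximable)"
proof -
  interpret H: homogeneous_sponge block_letters "block_map \<phi>" blocks "\<lambda>i. mrate i M"
    using assms block_baranski block_rate block_fibres block_diffuse by unfold_locales auto
  have lc: "log_count I M = ln (H.card_proj I)" for I
    by (simp add: log_count_def H.card_proj_def card_proj_blocks)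
  have "ennreal (\<Sum>k<length xs. (log_count (set (take (Suc k) xs)) M - log_count (set (take k xs)) M) / mrate (xs ! k) M)
    \<le> hausdorff_dim (sponge (block_map \<phi>) blocks \<inter> badly_approximable)"
    unfolding lc by (rule hausdorff_dim_geI, rule H.hausdorff_measure_badly_approximable[OF xs inc])
  also have "\<dots> \<le> hausdorff_dim (sponge \<phi> E \<inter> badly_approximable)"
    using block_sponge by (intro hausdorff_dim_mono) blast
  finally show ?thesis .
qed

end
end

section \<open>Covers by cylinders with given letter statistics\<close>

text \<open>A Borel-Cantelli argument: every point lies in sets of infinitely many of the finite
  families, so the families from any index on form a cover, and the tail of a summable series bounds
  its cost.\<close>

lemma hausdorff_measure_0_if_covers:
  fixes U :: "nat \<Rightarrow> 'j \<Rightarrow> 'a::metric_space set" and a r :: "nat \<Rightarrow> real"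
  assumes t: "0 < t"
    and J: "\<And>m. finite (J m)"
    and bdd: "\<And>m j. j \<in> J m \<Longrightarrow> bounded (U m j)"
    and diam: "\<And>m j. j \<in> J m \<Longrightarrow> diameter (U m j) \<le> r m" and r: "r \<longlonglongrightarrow> 0"
    and sum: "\<And>m. (\<Sum>j\<in>J m. diameter (U m j) powr t) \<le> a m" and a: "summable a"
    and cover: "\<And>x m0. x \<in> S \<Longrightarrow> \<exists>m\<ge>m0. \<exists>j\<in>J m. x \<in> U m j"
  shows "hausdorff_measure t S = 0"
proof (rule hausdorff_measure_eq_0I)
  fix e :: real assume e: "0 < e"
  have a0: "0 \<le> a m" for m by (rule order_trans[OF sum_nonneg sum]) simp
  obtain N1 where N1: "\<And>n. N1 \<le> n \<Longrightarrow> norm (\<Sum>i. a (i + n)) < e" using suminf_exist_split[OF e a] by blast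
  have "eventually (\<lambda>m. r m < e) sequentially" using r e by (rule order_tendstoD)
  then obtain N2 where N2: "\<And>m. N2 \<le> m \<Longrightarrow> r m < e" by (auto simp: eventually_sequentially)
  define N where "N = max N1 N2"
  have "\<exists>h. bij_betw h {..<card (J m)} (J m)" for m
    using ex_bij_betw_nat_finite[OF J] by (auto simp: lessThan_atLeast0)
  then obtain h where h: "\<And>m. bij_betw (h m) {..<card (J m)} (J m)" by metis
  define V where "V = (\<lambda>(m, j). if j < card (J (m + N)) then U (m + N) (h (m + N) j) else {})"
  have hJ: "h m j \<in> J m" if "j < card (J m)" for m j using h[of m] that by (auto simp: bij_betw_def)
  show "\<exists>W. S \<subseteq> (\<Union>n::nat. W n) \<and> (\<forall>n. bounded (W n) \<and> diameter (W n) \<le> e) \<and>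
      (\<Sum>n. hausdorff_gauge t (W n)) \<le> ennreal e"
  proof (intro exI[of _ "V \<circ> prod_decode"] conjI allI)
    show "S \<subseteq> (\<Union>n. (V \<circ> prod_decode) n)"
    proof
      fix x assume "x \<in> S"
      then obtain m j where m: "N \<le> m" "j \<in> J m" "x \<in> U m j" using cover by blast
      then obtain k where k: "k < card (J m)" "j = h m k" using h[of m] by (auto simp: bij_betw_def)
      have "x \<in> V (m - N, k)" using m k by (simp add: V_def)
      then have "x \<in> (V \<circ> prod_decode) (prod_encode (m - N, k))" by simp
      then show "x \<in> (\<Union>n. (V \<circ> prod_decode) n)" by blast
    qed
    fix n
    obtain m j where mj: "prod_decode n = (m, j)" by (cases "prod_decode n")
    show "bounded ((V \<circ> prod_decode) n)" using bdd hJ by (simp add: mj V_def)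
    show "diameter ((V \<circ> prod_decode) n) \<le> e"
    proof (cases "j < card (J (m + N))")
      case True
      have "r (m + N) < e" by (rule N2) (simp add: N_def)
      then show ?thesis using diam[OF hJ[OF True]] True by (simp add: mj V_def)
    next
      case False
      then show ?thesis using e by (simp add: mj V_def)
    qed
  next
    have row: "(\<Sum>j. hausdorff_gauge t (V (m, j))) \<le> ennreal (a (m + N))" for m
    proof -
      let ?c = "card (J (m + N))"
      have "(\<Sum>j. hausdorff_gauge t (V (m, j))) = (\<Sum>j<?c. hausdorff_gauge t (V (m, j)))"
        by (rule suminf_finite) (auto simp: V_def hausdorff_gauge_def)
      also have "\<dots> \<le> (\<Sum>j<?c. ennreal (diameter (U (m + N) (h (m + N) j)) powr t))"
        using t by (intro sum_mono) (auto simp: V_def hausdorff_gauge_def)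
      also have "\<dots> = ennreal (\<Sum>j<?c. diameter (U (m + N) (h (m + N) j)) powr t)" by (rule sum_ennreal) simp
      also have "(\<Sum>j<?c. diameter (U (m + N) (h (m + N) j)) powr t) = (\<Sum>j\<in>J (m + N). diameter (U (m + N) j) powr t)"
        by (rule sum.reindex_bij_betw[OF h])
      finally show ?thesis using sum[of "m + N"] ennreal_leI order_trans by blast
    qed
    have "(\<Sum>n. hausdorff_gauge t ((V \<circ> prod_decode) n)) = (\<Sum>m. \<Sum>j. hausdorff_gauge t (V (m, j)))"
      using suminf_ennreal_2dimen[of "\<lambda>m. \<Sum>j. hausdorff_gauge t (V (m, j))" "\<lambda>p. hausdorff_gauge t (V p)"] by simp
    also have "\<dots> \<le> (\<Sum>m. ennreal (a (m + N)))" using row by (intro suminf_le) auto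
    also have "\<dots> = ennreal (\<Sum>m. a (m + N))"
      using a0 a by (intro suminf_ennreal2) (auto simp: summable_iff_shift)
    also have "\<dots> \<le> ennreal e" using N1[of N] by (intro ennreal_leI) (simp add: N_def abs_less_iff)
    finally show "(\<Sum>n. hausdorff_gauge t ((V \<circ> prod_decode) n)) \<le> ennreal e" .
  qed
qed

abbreviation perms :: "'a multiset \<Rightarrow> nat" where
  "perms M \<equiv> card (permutations_of_multiset M)"

lemma perms_pos: "0 < perms M"
  by (simp add: card_gt_0_iff)

text \<open>Concatenation is injective when the lengths are known. The resulting superadditivity of
  \<open>log_count\<close> bounds the count for a segment by the difference of the counts for two
  prefixes.\<close>

lemma perms_add: "perms M * perms N \<le> perms (M + N)"
proof -
  let ?f = "\<lambda>(u, v). u @ v"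
  have "inj_on ?f (permutations_of_multiset M \<times> permutations_of_multiset N)"
    by (rule inj_onI) (auto dest!: length_finite_permutations_of_multiset)
  then have "perms M * perms N = card (?f ` (permutations_of_multiset M \<times> permutations_of_multiset N))"
    by (simp add: card_image card_cartesian_product)
  also have "\<dots> \<le> perms (M + N)"
    by (rule card_mono[OF finite_permutations_of_multiset]) (auto simp: permutations_of_multiset_def)
  finally show ?thesis .
qed

lemma log_count_add: "log_count I M + log_count I N \<le> log_count I (M + N)"
proof -
  let ?c = "\<lambda>M. real (perms (image_mset (\<lambda>a. restrict a I) M))"
  have pos: "0 < ?c M" for M by (simp add: perms_pos)
  have "?c M * ?c N \<le> ?c (M + N)" unfolding of_nat_mult[symmetric] of_nat_le_iff image_mset_union by (rule perms_add)
  then have "ln (?c M * ?c N) \<le> ln (?c (M + N))" using pos[of M] pos[of N] by (intro ln_mono) auto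
  then show ?thesis using pos[of M] pos[of N] by (simp add: log_count_def ln_mult)
qed

lemma log_count_nonneg: "0 \<le> log_count I M"
  using perms_pos[of "image_mset (\<lambda>a. restrict a I) M"] by (simp add: log_count_def Suc_le_eq)

lemma log_count_empty_set: "log_count {} M = 0"
proof -
  have "permutations_of_multiset (image_mset (\<lambda>a. restrict a {}) M) \<subseteq> {replicate (size M) (\<lambda>_. undefined)}"
  proof
    fix v assume "v \<in> permutations_of_multiset (image_mset (\<lambda>a. restrict a {}) M)"
    then have v: "mset v = image_mset (\<lambda>a. restrict a {}) M" by (rule permutations_of_multisetD)
    then have "length v = size M" by (metis size_image_mset size_mset)
    moreover have "set v \<subseteq> {\<lambda>_. undefined}"
      unfolding set_mset_mset[symmetric] v by (auto simp: restrict_def)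
    ultimately show "v \<in> {replicate (size M) (\<lambda>_. undefined)}" by (simp add: replicate_eqI subset_iff)
  qed
  from card_mono[OF _ this] have "perms (image_mset (\<lambda>a. restrict a {}) M) \<le> 1" by simp
  then have "perms (image_mset (\<lambda>a. restrict a {}) M) = 1"
    using perms_pos[of "image_mset (\<lambda>a. restrict a {}) M"] by (simp add: Suc_le_eq)
  then show ?thesis by (simp add: log_count_def)
qed

text \<open>The method of types: tuples of words with the same multisets contribute at most 1 in
  total, and the number of tuples of multisets is polynomial in \<open>m\<close>.\<close>

lemma sum_inverse_perms_le:
  assumes V: "finite V" "\<And>v k. v \<in> V \<Longrightarrow> k < d \<Longrightarrow> set (v k) \<subseteq> F \<and> length (v k) \<le> m"
    "\<And>v. v \<in> V \<Longrightarrow> v \<in> extensional {..<d}" and F: "finite F"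
  shows "(\<Sum>v\<in>V. 1 / (\<Prod>k<d. real (perms (mset (v k))))) \<le> real (((m + 1) ^ card F) ^ d)"
proof -
  define ty where "ty v = (\<lambda>k\<in>{..<d}. mset (v k))" for v :: "nat \<Rightarrow> 'a list"
  have fib: "(\<Sum>v\<in>{v\<in>V. ty v = T}. 1 / (\<Prod>k<d. real (perms (mset (v k))))) \<le> 1" if "T \<in> ty ` V" for T
  proof -
    let ?P = "PiE {..<d} (\<lambda>k. permutations_of_multiset (T k))"
    have P: "0 < (\<Prod>k<d. real (perms (T k)))" by (intro prod_pos) (simp add: perms_pos)
    have "v \<in> ?P" if v: "v \<in> V" "ty v = T" for v
    proof (rule PiE_I)
      fix k assume "k \<in> {..<d}"
      then show "v k \<in> permutations_of_multiset (T k)"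
        unfolding v(2)[symmetric] by (simp add: ty_def permutations_of_multiset_def)
    qed (use V(3)[OF v(1)] in \<open>auto simp: extensional_def\<close>)
    then have "card {v\<in>V. ty v = T} \<le> card ?P" by (intro card_mono finite_PiE) auto
    also have "\<dots> = (\<Prod>k<d. perms (T k))" by (simp add: card_PiE)
    finally have "real (card {v\<in>V. ty v = T}) \<le> (\<Prod>k<d. real (perms (T k)))"
      unfolding of_nat_prod[symmetric] of_nat_le_iff .
    moreover have "(\<Sum>v\<in>{v\<in>V. ty v = T}. 1 / (\<Prod>k<d. real (perms (mset (v k))))) =
        (\<Sum>v\<in>{v\<in>V. ty v = T}. 1 / (\<Prod>k<d. real (perms (T k))))"
      by (intro sum.cong refl arg_cong[where f="\<lambda>x. 1 / x"] prod.cong) (auto simp: ty_def)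
    ultimately show ?thesis using P by (simp add: divide_le_eq)
  qed
  have "(\<Sum>v\<in>V. 1 / (\<Prod>k<d. real (perms (mset (v k))))) =
      (\<Sum>T\<in>ty ` V. \<Sum>v\<in>{v\<in>V. ty v = T}. 1 / (\<Prod>k<d. real (perms (mset (v k)))))"
    using V(1) by (rule sum.image_gen)
  also have "\<dots> \<le> (\<Sum>T\<in>ty ` V. 1)" by (intro sum_mono fib)
  also have "\<dots> = real (card (ty ` V))" by simp
  also have "card (ty ` V) \<le> ((m + 1) ^ card F) ^ d"
  proof -
    define cnt where "cnt T = (\<lambda>k\<in>{..<d}. \<lambda>x\<in>F. count (T k) x)" for T :: "nat \<Rightarrow> 'a multiset"
    have "cnt ` ty ` V \<subseteq> PiE {..<d} (\<lambda>_. PiE F (\<lambda>_. {..m}))"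
    proof (rule image_subsetI)
      fix T assume "T \<in> ty ` V"
      then obtain v where v: "v \<in> V" "T = ty v" by blast
      have "count (mset (v k)) x \<le> m" if "k < d" for k x
        using V(2)[OF v(1) that] count_le_length[of "v k" x] by (simp add: count_mset)
      then show "cnt T \<in> PiE {..<d} (\<lambda>_. PiE F (\<lambda>_. {..m}))" by (auto simp: cnt_def v(2) ty_def)
    qed
    moreover have "inj_on cnt (ty ` V)"
    proof (rule inj_onI)
      fix T T' assume T: "T \<in> ty ` V" "T' \<in> ty ` V" "cnt T = cnt T'"
      obtain v v' where v: "v \<in> V" "T = ty v" "v' \<in> V" "T' = ty v'" using T by blast
      have "mset (v k) = mset (v' k)" if k: "k < d" for k
      proof (rule multiset_eqI)
        fix x
        show "count (mset (v k)) x = count (mset (v' k)) x"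
        proof (cases "x \<in> F")
          case True
          then show ?thesis using fun_cong[OF fun_cong[OF T(3), of k], of x] k by (simp add: cnt_def v ty_def)
        next
          case False
          then have "x \<notin> set (v k)" "x \<notin> set (v' k)" using V(2)[OF v(1) k] V(2)[OF v(3) k] by auto
          then show ?thesis by (metis count_eq_zero_iff set_mset_mset)
        qed
      qed
      then show "T = T'" unfolding v ty_def by (intro restrict_ext) auto
    qed
    moreover have "finite (PiE {..<d} (\<lambda>_. PiE F (\<lambda>_. {..m})))" using F by (intro finite_PiE) auto
    ultimately have "card (ty ` V) \<le> card (PiE {..<d} (\<lambda>_. PiE F (\<lambda>_. {..m})))"
      by (metis card_image card_mono)
    also have "\<dots> = ((m + 1) ^ card F) ^ d" using F by (simp add: card_PiE)
    finally show ?thesis .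
  qed
  finally show ?thesis by simp
qed

context sponge_ifs
begin

text \<open>Every letter is counted once more than it occurs in the prefix, so that the lower bound on the
  dimension, which needs all letters, applies to \<open>pre \<omega> n\<close>.\<close>

definition pre :: "(nat \<Rightarrow> 'd \<Rightarrow> 'a) \<Rightarrow> nat \<Rightarrow> ('d \<Rightarrow> 'a) multiset" where
  "pre \<omega> n = mset_set E + mset (map \<omega> [0..<n])"

text \<open>The condition that the cylinder of \<open>\<omega>\<close> at levels \<open>n\<close>, of size about \<open>exp (- L)\<close>, belongs to
  a class of at most \<open>exp (s * L)\<close> cylinders with the same letter statistics.\<close>

definition good :: "real \<Rightarrow> real \<Rightarrow> (nat \<Rightarrow> 'd \<Rightarrow> 'a) \<Rightarrow> nat \<Rightarrow> ('d \<Rightarrow> nat) \<Rightarrow> 'd list \<Rightarrow> real \<Rightarrow> bool" where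
  "good c s \<omega> m n xs L \<longleftrightarrow> distinct xs \<and> set xs = UNIV \<and>
     (\<forall>k k'. k \<le> k' \<longrightarrow> k' < length xs \<longrightarrow> n (xs ! k') \<le> n (xs ! k)) \<and>
     (\<forall>i. n i \<le> m) \<and> c * m \<le> L \<and> (\<forall>i. L \<le> mrate i (pre \<omega> (n i))) \<and>
     (\<Sum>k<length xs. log_count (set (take (Suc k) xs)) (pre \<omega> (n (xs ! k))) -
        log_count (set (take k xs)) (pre \<omega> (n (xs ! k)))) \<le> s * L"

lemma set_pre: "\<omega> \<in> seqs \<Longrightarrow> set_mset (pre \<omega> n) = E"
  using finite_E by (auto simp: pre_def seqs_iff)

lemma mrate_add: "mrate i (M + N) = mrate i M + mrate i N"
  by (simp add: mrate_def)

lemma mrate_pre: "mrate i (pre \<omega> n) = mrate i (mset_set E) + rsum i \<omega> n"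
proof -
  have "mrate i (mset (map \<omega> [0..<n])) = rsum i \<omega> n"
    by (simp add: mrate_def rsum_def image_mset.compositionality comp_def sum_unfold_sum_mset atLeast0LessThan)
  then show ?thesis by (simp add: pre_def mrate_add)
qed

lemma pre_split: "j \<le> n \<Longrightarrow> pre \<omega> n = pre \<omega> j + mset (map \<omega> [j..<n])"
  unfolding pre_def using upt_add_eq_append[of 0 j "n - j"] by (simp add: add.assoc)

text \<open>The value 0 behind the last coordinate makes the last segment begin at position
  0.\<close>

definition level_at :: "('d \<Rightarrow> nat) \<Rightarrow> 'd list \<Rightarrow> nat \<Rightarrow> nat" where
  "level_at n xs k = (if k < length xs then n (xs ! k) else 0)"

text \<open>The cylinder of \<omega> at levels \<open>n\<close>, cut where a coordinate drops out:
  on the \<open>k\<close>-th segment the first \<open>k + 1\<close> coordinates of \<open>xs\<close>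
  are active.\<close>

definition seg :: "('d \<Rightarrow> nat) \<Rightarrow> 'd list \<Rightarrow> (nat \<Rightarrow> 'd \<Rightarrow> 'a) \<Rightarrow> nat \<Rightarrow> ('d \<Rightarrow> 'a) list" where
  "seg n xs \<omega> = (\<lambda>k\<in>{..<length xs}. map (\<lambda>l. restrict (\<omega> l) (set (take (Suc k) xs))) [level_at n xs (Suc k)..<level_at n xs k])"

lemma good_level_mono: "good c s \<omega> m n xs L \<Longrightarrow> level_at n xs (Suc k) \<le> level_at n xs k"
  by (auto simp: good_def level_at_def)

text \<open>Superadditivity bounds the count of each segment by a difference of prefix counts for
  the same set of coordinates. Summation by parts rearranges these into differences at the same
  prefix, as they occur in \<open>good\<close>.\<close>

lemma good_perms_le:
  assumes g: "good c s \<omega> m n xs L"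
  shows "(\<Prod>k<length xs. real (perms (mset (seg n xs \<omega> k)))) \<le> exp (s * L)"
proof -
  define lc where "lc k j = log_count (set (take k xs)) (pre \<omega> j)" for k j
  have "ln (real (perms (mset (seg n xs \<omega> k)))) \<le> lc (Suc k) (level_at n xs k) - lc (Suc k) (level_at n xs (Suc k))"
    if k: "k < length xs" for k
  proof -
    let ?W = "mset (map \<omega> [level_at n xs (Suc k)..<level_at n xs k])"
    have "mset (seg n xs \<omega> k) = image_mset (\<lambda>a. restrict a (set (take (Suc k) xs))) ?W"
      using k by (simp add: seg_def image_mset.compositionality comp_def flip: mset_map)
    then have "ln (real (perms (mset (seg n xs \<omega> k)))) = log_count (set (take (Suc k) xs)) ?W"
      by (simp add: log_count_def)
    then show ?thesis
      using log_count_add[of "set (take (Suc k) xs)" "pre \<omega> (level_at n xs (Suc k))" ?W]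
      unfolding lc_def pre_split[OF good_level_mono[OF g, of k], of \<omega>] by simp
  qed
  then have "(\<Sum>k<length xs. ln (real (perms (mset (seg n xs \<omega> k))))) \<le>
      (\<Sum>k<length xs. lc (Suc k) (level_at n xs k) - lc (Suc k) (level_at n xs (Suc k)))" by (intro sum_mono) auto
  also have "\<dots> = (\<Sum>k<length xs. lc (Suc k) (level_at n xs k)) - (\<Sum>k<length xs. lc (Suc k) (level_at n xs (Suc k)))"
    by (rule sum_subtractf)
  \<comment> \<open>Of the two boundary terms, one belongs to the empty set of coordinates and is 0,
    the other is nonnegative and is dropped.\<close>
  also have "(\<Sum>k<length xs. lc (Suc k) (level_at n xs (Suc k))) =
      (\<Sum>k<length xs. lc k (level_at n xs k)) + lc (length xs) (level_at n xs (length xs)) - lc 0 (level_at n xs 0)"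
    using sum.lessThan_Suc_shift[of "\<lambda>k. lc k (level_at n xs k)" "length xs"] by simp
  also have "lc 0 (level_at n xs 0) = 0" by (simp add: lc_def log_count_empty_set)
  also have "(\<Sum>k<length xs. lc (Suc k) (level_at n xs k)) -
      ((\<Sum>k<length xs. lc k (level_at n xs k)) + lc (length xs) (level_at n xs (length xs)) - 0) \<le>
      (\<Sum>k<length xs. lc (Suc k) (n (xs ! k)) - lc k (n (xs ! k)))"
    unfolding sum_subtractf using log_count_nonneg by (simp add: level_at_def lc_def)
  also have "\<dots> \<le> s * L" using g unfolding good_def lc_def by blast
  finally have "exp (\<Sum>k<length xs. ln (real (perms (mset (seg n xs \<omega> k))))) \<le> exp (s * L)" by simp
  then show ?thesis by (simp add: exp_sum perms_pos)
qed

lemma seg_eq_imp_agree: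
  assumes g: "good c s \<omega> m n xs L" and eq: "seg n xs \<tau> = seg n xs \<omega>"
  shows "agree n \<tau> \<omega>"
  unfolding agree_def
proof (intro allI impI)
  fix i l assume l: "l < n i"
  obtain k0 where k0: "k0 < length xs" "xs ! k0 = i" using g by (metis UNIV_I good_def in_set_conv_nth)
  have "\<exists>k. k0 \<le> k \<and> k < length xs \<and> level_at n xs (Suc k) \<le> l \<and> l < level_at n xs k"
  proof (rule ccontr)
    assume neg: "\<not> ?thesis"
    have "l < level_at n xs k" if "k0 \<le> k" "k \<le> length xs" for k
      using that
    proof (induction k rule: dec_induct)
      case base then show ?case using l k0 by (simp add: level_at_def)
    next
      case (step k) then show ?case using neg by (meson Suc_leD Suc_le_lessD not_le)
    qed
    from this[of "length xs"] k0 show False by (simp add: level_at_def)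
  qed
  then obtain k where k: "k0 \<le> k" "k < length xs" "level_at n xs (Suc k) \<le> l" "l < level_at n xs k" by blast
  have "seg n xs \<tau> k ! (l - level_at n xs (Suc k)) = seg n xs \<omega> k ! (l - level_at n xs (Suc k))" using eq by simp
  moreover have "[level_at n xs (Suc k)..<level_at n xs k] ! (l - level_at n xs (Suc k)) = l" using k by (subst nth_upt) auto
  ultimately have "restrict (\<tau> l) (set (take (Suc k) xs)) = restrict (\<omega> l) (set (take (Suc k) xs))"
    using k by (simp add: seg_def)
  moreover have "i \<in> set (take (Suc k) xs)" using k0 k by (auto simp: in_set_conv_nth intro!: exI[of _ k0])
  ultimately show "\<tau> l i = \<omega> l i" by (metis restrict_apply')
qed

text \<open>Cylinders are weighted by the size of their class: the \<open>t\<close>-th power of the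
  diameter is at most \<open>exp (- \<epsilon> * L)\<close> times a constant, divided by the number
  of words with the same statistics. The sum over all of them is then polynomial in \<open>m\<close>
  times \<open>exp (- \<epsilon> * c * m)\<close>.\<close>

theorem hausdorff_dim_coding_image_le:
  assumes X: "X \<subseteq> seqs" and s: "0 \<le> s" and c: "0 < c"
    and good: "\<And>\<omega> \<epsilon> m0. \<omega> \<in> X \<Longrightarrow> 0 < \<epsilon> \<Longrightarrow> \<exists>m\<ge>m0. \<exists>n xs L. good c (s + \<epsilon>) \<omega> m n xs L"
  shows "hausdorff_dim (coding_map \<phi> ` X) \<le> ennreal s"
proof (rule hausdorff_dim_leI[OF s])
  fix t assume t: "s < t"
  \<comment> \<open>Half of \<open>t - s\<close> is spent on the hypothesis, the other half on the
    polynomial number of types.\<close>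
  define \<epsilon> where "\<epsilon> = (t - s) / 2"
  have \<epsilon>: "0 < \<epsilon>" "t = s + 2 * \<epsilon>" using t by (auto simp: \<epsilon>_def field_simps)
  define d where "d = CARD('d)"
  \<comment> \<open>The additional copy of \<open>E\<close> in \<open>pre\<close> enlarges the
    rates; for the diameters this costs the factor \<open>exp b\<close>.\<close>
  define b where "b = (\<Sum>i\<in>UNIV. mrate i (mset_set E))"
  have mb: "mrate i (mset_set E) \<le> b" for i
    unfolding b_def mrate_def sum_unfold_sum_mset[symmetric]
    by (rule member_le_sum) (auto intro!: sum_nonneg less_imp_le[OF rate_pos])
  define D where "D = real d * exp b"
  have D: "0 < D" by (simp add: D_def d_def)
  \<comment> \<open>The scale \<open>L\<close> is not part of the index: \<open>m\<close> bounds the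
    levels, which makes the family finite, and \<open>c * m \<le> L\<close> makes its cylinders
    small.\<close>
  define J where "J m = {(n, xs, v). \<exists>\<omega>\<in>seqs. \<exists>L. good c (s + \<epsilon>) \<omega> m n xs L \<and> v = seg n xs \<omega>}" for m
  define U where "U = (\<lambda>(n, xs, v). {coding_map \<phi> \<tau> | \<tau>. \<tau> \<in> seqs \<and> seg n xs \<tau> = v})"
  define F where "F = (\<lambda>(a, I). restrict a I) ` (E \<times> (UNIV :: 'd set set))"
  have F: "finite F" using finite_E by (simp add: F_def)
  define Nm where "Nm m = (\<Pi>\<^sub>E i\<in>(UNIV :: 'd set). {..m :: nat})" for m
  define Xs where "Xs = {xs :: 'd list. distinct xs \<and> set xs = UNIV}"
  have "Xs \<subseteq> {xs. set xs \<subseteq> UNIV \<and> length xs = d}" by (auto simp: Xs_def d_def distinct_card[symmetric])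
  then have Xs: "finite Xs" using finite_lists_length_eq[of "UNIV :: 'd set" d] by (auto intro: finite_subset)
  have len: "length xs = d" if "xs \<in> Xs" for xs using that distinct_card[of xs] by (simp add: Xs_def d_def)
  define V where "V m = PiE {..<d} (\<lambda>_. {v. set v \<subseteq> F \<and> length v \<le> m})" for m
  have V: "finite (V m)" for m unfolding V_def using F by (intro finite_PiE finite_lists_length_le) auto
  have J_sub: "J m \<subseteq> Nm m \<times> Xs \<times> V m" for m
  proof
    fix p assume "p \<in> J m"
    then obtain n xs \<omega> L where p: "p = (n, xs, seg n xs \<omega>)" "\<omega> \<in> seqs" "good c (s + \<epsilon>) \<omega> m n xs L"
      by (auto simp: J_def)
    have xs: "xs \<in> Xs" "n \<in> Nm m" using p(3) by (auto simp: good_def Xs_def Nm_def)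
    have "level_at n xs k \<le> m" for k using p(3) by (auto simp: good_def level_at_def)
    then have "seg n xs \<omega> k \<in> {v. set v \<subseteq> F \<and> length v \<le> m}" if "k < d" for k
      using that len[OF xs(1)] seqsD[OF p(2)] by (auto simp: seg_def F_def intro: le_trans[OF diff_le_self])
    then have "seg n xs \<omega> \<in> V m" using len[OF xs(1)] by (auto simp: V_def seg_def extensional_def)
    then show "p \<in> Nm m \<times> Xs \<times> V m" using xs p(1) by auto
  qed
  have J_fin: "finite (J m)" for m
    by (rule finite_subset[OF J_sub]) (use Xs V in \<open>auto simp: Nm_def intro!: finite_PiE\<close>)
  have U_J: "bounded (U j) \<and> (\<exists>L. c * m \<le> L \<and> diameter (U j) \<le> D * exp (- L) \<and>
      (\<Prod>k<d. real (perms (mset (snd (snd j) k)))) \<le> exp ((s + \<epsilon>) * L))" if j: "j \<in> J m" for m j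
  proof -
    obtain n xs \<omega> L where p: "j = (n, xs, seg n xs \<omega>)" "\<omega> \<in> seqs" "good c (s + \<epsilon>) \<omega> m n xs L"
      using j by (auto simp: J_def)
    have dist: "dist x y \<le> D * exp (- L)" if xy: "x \<in> U j" "y \<in> U j" for x y
    proof -
      obtain \<tau> \<tau>' where \<tau>: "x = coding_map \<phi> \<tau>" "\<tau> \<in> seqs" "seg n xs \<tau> = seg n xs \<omega>"
        "y = coding_map \<phi> \<tau>'" "\<tau>' \<in> seqs" "seg n xs \<tau>' = seg n xs \<omega>" using xy by (auto simp: U_def p(1))
      have ag: "agree n \<tau> \<omega>" "agree n \<tau>' \<omega>" using seg_eq_imp_agree[OF p(3)] \<tau> by auto
      have "\<bar>x $ i - y $ i\<bar> \<le> exp b * exp (- L)" for i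
      proof -
        have "rsum i \<tau> (n i) = rsum i \<omega> (n i)"
          using ag(1) unfolding rsum_def rate_def agree_def by (intro sum.cong) auto
        then have "L \<le> b + rsum i \<tau> (n i)" using p(3) mb[of i] unfolding good_def mrate_pre by (smt (verit))
        moreover have "\<bar>x $ i - y $ i\<bar> \<le> exp (- rsum i \<tau> (n i))" unfolding \<tau>(1,4)
          using ag by (intro coding_map_close \<tau>) (auto simp: agree_def)
        ultimately have "\<bar>x $ i - y $ i\<bar> \<le> exp (b - L)" using order_trans exp_le_cancel_iff by (smt (verit))
        then show ?thesis by (simp add: exp_add[symmetric])
      qed
      then have "norm (x - y) \<le> (\<Sum>i\<in>(UNIV :: 'd set). exp b * exp (- L))"
        by (intro order_trans[OF norm_le_l1_cart] sum_mono) auto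
      then show ?thesis by (simp add: dist_norm D_def d_def)
    qed
    have "bounded (U j)" unfolding bounded_two_points using dist by blast
    moreover have "diameter (U j) \<le> D * exp (- L)" using D dist by (intro diameter_le) (auto simp: dist_norm[symmetric])
    moreover have "c * m \<le> L" using p(3) by (auto simp: good_def)
    moreover have "(\<Prod>k<d. real (perms (mset (snd (snd j) k)))) \<le> exp ((s + \<epsilon>) * L)"
    proof -
      have "length xs = d" using p(3) by (intro len) (auto simp: good_def Xs_def)
      then show ?thesis using good_perms_le[OF p(3)] by (simp add: p(1))
    qed
    ultimately show ?thesis by blast
  qed
  define B where "B = real (card Xs) * D powr t"
  define p where "p = CARD('d) + card F * d"
  show "hausdorff_measure t (coding_map \<phi> ` X) = 0"
  proof (rule hausdorff_measure_0_if_covers[where J=J and U="\<lambda>_. U" and r="\<lambda>m. D * exp (- (c * real m))"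
        and a="\<lambda>m. B * (real (m + 1) ^ p * exp (- (\<epsilon> * c) * real m))"])
    show "0 < t" using s t by simp
    show "finite (J m)" for m by (rule J_fin)
    show "bounded (U j)" if "j \<in> J m" for m j using U_J[OF that] by blast
    show "diameter (U j) \<le> D * exp (- (c * real m))" if j: "j \<in> J m" for m j
    proof -
      obtain L where L: "c * m \<le> L" "diameter (U j) \<le> D * exp (- L)" using U_J[OF j] by blast
      have "D * exp (- L) \<le> D * exp (- (c * real m))" using L(1) D by (intro mult_left_mono) auto
      then show ?thesis using L(2) by simp
    qed
    show "(\<lambda>m. D * exp (- (c * real m))) \<longlonglongrightarrow> 0" using c by real_asymp
    show "summable (\<lambda>m. B * (real (m + 1) ^ p * exp (- (\<epsilon> * c) * real m)))"
    proof (rule summable_mult, rule summable_comparison_test_bigo)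
      define \<beta> where "\<beta> = \<epsilon> * c"
      have \<beta>: "0 < \<beta>" using \<epsilon>(1) c by (simp add: \<beta>_def)
      have "summable (\<lambda>m. exp (- \<beta> / 2) ^ m)" using \<beta> by (intro summable_geometric) simp
      then show "summable (\<lambda>m. norm (exp (- (\<epsilon> * c) / 2 * real m)))"
        by (simp add: \<beta>_def exp_of_nat_mult[symmetric] mult.commute)
      show "(\<lambda>m. real (m + 1) ^ p * exp (- (\<epsilon> * c) * real m)) \<in> O(\<lambda>m. exp (- (\<epsilon> * c) / 2 * real m))"
        unfolding \<beta>_def[symmetric] using \<beta> by real_asymp
    qed
    show "(\<Sum>j\<in>J m. diameter (U j) powr t) \<le> B * (real (m + 1) ^ p * exp (- (\<epsilon> * c) * real m))" for m
    proof -
      define C where "C v = (\<Prod>k<d. real (perms (mset (v k))))" for v :: "nat \<Rightarrow> ('d \<Rightarrow> 'a) list"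
      have C: "0 < C v" for v unfolding C_def by (intro prod_pos) (simp add: perms_pos)
      define q where "q = D powr t * exp (- (\<epsilon> * c) * real m)"
      have q: "0 \<le> q" by (simp add: q_def)
      have one: "diameter (U j) powr t \<le> q * (1 / C (snd (snd j)))" if j: "j \<in> J m" for j
      proof -
        obtain L where L: "c * m \<le> L" "diameter (U j) \<le> D * exp (- L)" "C (snd (snd j)) \<le> exp ((s + \<epsilon>) * L)"
          using U_J[OF j] by (auto simp: C_def)
        have "diameter (U j) powr t \<le> (D * exp (- L)) powr t"
          using L(2) U_J[OF j] s t diameter_ge_0 by (intro powr_mono2) auto
        also have "\<dots> = D powr t * exp (- (s + 2 * \<epsilon>) * L)"
          using D by (simp add: powr_mult powr_def[of "exp (- L)"] \<epsilon>(2)) (simp add: algebra_simps)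
        also have "\<dots> = D powr t * (exp (- \<epsilon> * L) * exp (- ((s + \<epsilon>) * L)))"
          unfolding exp_add[symmetric] by (simp add: algebra_simps)
        also have "\<dots> \<le> D powr t * (exp (- (\<epsilon> * c) * m) * (1 / C (snd (snd j))))"
        proof (intro mult_left_mono mult_mono)
          have "\<epsilon> * (c * m) \<le> \<epsilon> * L" using L(1) \<epsilon>(1) by (intro mult_left_mono) auto
          then show "exp (- \<epsilon> * L) \<le> exp (- (\<epsilon> * c) * m)" by (simp add: mult.assoc)
          show "exp (- ((s + \<epsilon>) * L)) \<le> 1 / C (snd (snd j))"
            using L(3) C[of "snd (snd j)"] unfolding exp_minus by (simp add: field_simps)
        qed auto
        finally show ?thesis by (simp add: q_def mult_ac)
      qed
      have "(\<Sum>j\<in>J m. diameter (U j) powr t) \<le> (\<Sum>j\<in>J m. q * (1 / C (snd (snd j))))" by (intro sum_mono one)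
      also have "\<dots> \<le> (\<Sum>j\<in>Nm m \<times> Xs \<times> V m. q * (1 / C (snd (snd j))))"
        using J_sub Xs V q C by (intro sum_mono2) (auto simp: Nm_def less_imp_le intro!: finite_PiE mult_nonneg_nonneg)
      also have "\<dots> = (\<Sum>n\<in>Nm m. \<Sum>xs\<in>Xs. \<Sum>v\<in>V m. q * (1 / C v))"
        unfolding sum.cartesian_product by (simp only: case_prod_unfold snd_conv fst_conv)
      also have "\<dots> = real (card (Nm m)) * (real (card Xs) * (q * (\<Sum>v\<in>V m. 1 / C v)))"
        by (simp add: sum_distrib_left)
      also have "\<dots> \<le> real (card (Nm m)) * (real (card Xs) * (q * real (((m + 1) ^ card F) ^ d)))"
        unfolding C_def using q F V
        by (intro mult_left_mono sum_inverse_perms_le) (auto simp: V_def PiE_iff)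
      also have "real (card (Nm m)) = real (m + 1) ^ CARD('d)" by (simp add: Nm_def card_PiE)
      finally show ?thesis
        unfolding B_def q_def p_def power_add power_mult of_nat_power by (simp only: mult_ac)
    qed
    fix x m0 assume "x \<in> coding_map \<phi> ` X"
    then obtain \<omega> where \<omega>: "\<omega> \<in> X" "x = coding_map \<phi> \<omega>" by blast
    obtain m n xs L where m: "m0 \<le> m" "good c (s + \<epsilon>) \<omega> m n xs L" using good[OF \<omega>(1) \<epsilon>(1)] by blast
    have "(n, xs, seg n xs \<omega>) \<in> J m" "x \<in> U (n, xs, seg n xs \<omega>)"
      using m(2) \<omega> X by (auto simp: J_def U_def)
    then show "\<exists>m\<ge>m0. \<exists>j\<in>J m. x \<in> U j" using m(1) by blast
  qed
qed

end

section \<open>Sequences with letter frequencies\<close>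

text \<open>Continuity of \<open>y * ln y\<close> also at 0, where
  \<open>\<bar>y * ln y\<bar> \<le> 2 * sqrt y\<close> gives the limit.\<close>

lemma tendsto_mult_ln_self:
  fixes f :: "'x \<Rightarrow> real"
  assumes f: "(f \<longlongrightarrow> p) F" and nonneg: "eventually (\<lambda>x. 0 \<le> f x) F" and F: "F \<noteq> bot"
  shows "((\<lambda>x. f x * ln (f x)) \<longlongrightarrow> p * ln p) F"
proof -
  have "0 \<le> p" using f nonneg F by (rule tendsto_lowerbound)
  show ?thesis
  proof (cases "p = 0")
    case False
    then show ?thesis using f by (intro tendsto_intros) auto
  next
    case True
    have bound: "\<bar>y * ln y\<bar> \<le> 2 * sqrt y" if "0 \<le> y" "y \<le> 1" for y :: real
    proof (cases "y = 0")
      case False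
      then have y: "0 < y" "y \<le> 1" using that by auto
      have "ln (1 / sqrt y) \<le> 1 / sqrt y - 1" using y by (intro ln_le_minus_one) auto
      then have "- ln y \<le> 2 * (1 / sqrt y)" using y by (simp add: ln_div ln_sqrt)
      then have "y * (- ln y) \<le> y * (2 * (1 / sqrt y))" using y by (intro mult_left_mono) auto
      also have "\<dots> = 2 * (y / sqrt y)" by simp
      also have "\<dots> = 2 * sqrt y" using y by (subst real_div_sqrt) auto
      finally show ?thesis using y by (simp add: abs_mult abs_of_nonpos)
    qed simp
    have "((\<lambda>x. 2 * sqrt (f x)) \<longlongrightarrow> 2 * sqrt 0) F" using f True by (intro tendsto_intros) auto
    then have z: "((\<lambda>x. 2 * sqrt (f x)) \<longlongrightarrow> 0) F" by simp
    have "eventually (\<lambda>x. f x < 1) F" using f True by (intro order_tendstoD(2)) auto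
    then have "eventually (\<lambda>x. norm (f x * ln (f x)) \<le> 2 * sqrt (f x)) F"
      using nonneg by eventually_elim (auto intro: bound)
    then show ?thesis using z unfolding True by (auto intro: Lim_null_comparison)
  qed
qed

text \<open>Stirling's formula up to a logarithmic error, by induction from
  \<open>ln x \<le> x - 1\<close>.\<close>

lemma ln_fact_bounds:
  "real n * ln n - n \<le> ln (fact n)" "ln (fact n) \<le> real n * ln n - n + ln (real n + 1) + 1"
proof -
  show "real n * ln n - n \<le> ln (fact n)"
  proof (induction n)
    case (Suc n)
    have "real (Suc n) * ln (Suc n) - Suc n \<le> real n * ln n - n + ln (Suc n)"
    proof (cases "n = 0")
      case False
      have "ln (real (Suc n) / n) \<le> real (Suc n) / n - 1" using False by (intro ln_le_minus_one) auto
      then have "real n * (ln (Suc n) - ln n) \<le> real n * (1 / n)"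
        using False by (intro mult_left_mono) (auto simp: ln_div field_simps)
      then show ?thesis using False by (simp add: algebra_simps)
    qed simp
    also have "\<dots> \<le> ln (fact n) + ln (Suc n)" using Suc by simp
    also have "\<dots> = ln (fact (Suc n))" by (simp add: ln_mult add.commute)
    finally show ?case .
  qed simp
  have "ln (fact n) \<le> real (n + 1) * ln (real (n + 1)) - n"
  proof (induction n)
    case (Suc n)
    have "ln (real (Suc n) / real (n + 2)) \<le> real (Suc n) / real (n + 2) - 1" by (intro ln_le_minus_one) auto
    then have "real (n + 2) * (ln (real (Suc n)) - ln (real (n + 2))) \<le> real (n + 2) * (real (Suc n) / real (n + 2) - 1)"
      by (intro mult_left_mono) (auto simp: ln_div)
    also have "\<dots> = -1" by (simp add: right_diff_distrib)
    finally have "real (n + 2) * ln (real (Suc n)) + 1 \<le> real (n + 2) * ln (real (n + 2))" by (simp add: right_diff_distrib)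
    moreover have "ln (fact (Suc n) :: real) = ln (fact n) + ln (Suc n)" by (simp add: ln_mult add.commute)
    ultimately show ?case using Suc by (simp add: algebra_simps)
  qed simp
  also have "real (n + 1) * ln (real (n + 1)) - n \<le> real n * ln n - n + ln (real n + 1) + 1"
  proof (cases "n = 0")
    case False
    have "ln (real (n + 1) / n) \<le> real (n + 1) / n - 1" using False by (intro ln_le_minus_one) auto
    then have "real n * (ln (real n + 1) - ln n) \<le> real n * (1 / n)"
      using False by (intro mult_left_mono) (auto simp: ln_div field_simps)
    then show ?thesis using False by (simp add: algebra_simps)
  qed simp
  finally show "ln (fact n) \<le> real n * ln n - n + ln (real n + 1) + 1" .
qed

text \<open>The terms with \<open>ln n\<close> and the linear terms are kept because they cancel in
  the logarithm of a multinomial coefficient.\<close>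

lemma ln_fact_asymp:
  fixes a :: "nat \<Rightarrow> nat"
  assumes a: "(\<lambda>n. a n / n) \<longlonglongrightarrow> p"
  shows "(\<lambda>n. ln (fact (a n)) / n - a n / n * ln n + a n / n) \<longlonglongrightarrow> p * ln p"
proof -
  define g where "g k = ln (fact k) - (real k * ln k - k)" for k :: nat
  have g: "0 \<le> g k" "g k \<le> ln (real k + 1) + 1" for k using ln_fact_bounds[of k] by (auto simp: g_def)
  have p: "0 \<le> p" using a by (rule LIMSEQ_le_const) (auto intro!: exI[of _ 0])
  have "eventually (\<lambda>n. a n / n < p + 1) sequentially" using a by (intro order_tendstoD(2)) auto
  then have "eventually (\<lambda>n. norm (g (a n) / n) \<le> (ln ((p + 1) * real n + 1) + 1) / n) sequentially"
    using eventually_gt_at_top[of 0]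
  proof eventually_elim
    case (elim n)
    have "real (a n) \<le> (p + 1) * n" using elim by (simp add: divide_less_eq)
    then have "ln (real (a n) + 1) \<le> ln ((p + 1) * real n + 1)" by (intro ln_mono) auto
    then have "g (a n) \<le> ln ((p + 1) * real n + 1) + 1" using g(2)[of "a n"] by simp
    then show ?case using g(1)[of "a n"] elim by (simp add: divide_right_mono)
  qed
  moreover have "(\<lambda>n. (ln ((p + 1) * real n + 1) + 1) / n) \<longlonglongrightarrow> 0"
    using p by real_asymp
  ultimately have g0: "(\<lambda>n. g (a n) / n) \<longlonglongrightarrow> 0" by (rule Lim_null_comparison)
  have "(\<lambda>n. a n / n * ln (a n / n)) \<longlonglongrightarrow> p * ln p"
    using a by (rule tendsto_mult_ln_self) auto
  from tendsto_add[OF this g0] have "(\<lambda>n. a n / n * ln (a n / n) + g (a n) / n) \<longlonglongrightarrow> p * ln p" by simp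
  moreover have "eventually (\<lambda>n. a n / n * ln (a n / n) + g (a n) / n =
      ln (fact (a n)) / n - a n / n * ln n + a n / n) sequentially"
    using eventually_gt_at_top[of 0]
  proof eventually_elim
    case (elim n)
    show ?case
    proof (cases "a n = 0")
      case False
      then have "ln (real (a n) / n) = ln (a n) - ln n" using elim by (simp add: ln_div)
      then show ?thesis by (simp only:) (simp add: g_def diff_divide_distrib add_divide_distrib algebra_simps)
    qed (simp add: g_def)
  qed
  ultimately show ?thesis by (rule Lim_transform_eventually)
qed

text \<open>The number of permutations is a multinomial coefficient, so its logarithm is a
  combination of logarithms of factorials. As the counts add up to the size, the normalising terms
  cancel and the limit is an entropy.\<close>

lemma ln_perms_asymp:
  fixes M :: "nat \<Rightarrow> 'a multiset"
  assumes F: "finite F" "\<And>n. set_mset (M n) \<subseteq> F"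
    and cnt: "\<And>x. x \<in> F \<Longrightarrow> convergent (\<lambda>n. count (M n) x / n)"
  shows "convergent (\<lambda>n. ln (perms (M n)) / n)"
proof -
  obtain p where p: "\<And>x. x \<in> F \<Longrightarrow> (\<lambda>n. count (M n) x / n) \<longlonglongrightarrow> p x"
    using cnt unfolding convergent_def by metis
  have size: "size (M n) = (\<Sum>x\<in>F. count (M n) x)" for n
    unfolding size_multiset_overloaded_eq using F by (intro sum.mono_neutral_left) (auto simp: not_in_iff)
  define P where "P = (\<Sum>x\<in>F. p x)"
  have sz: "(\<lambda>n. size (M n) / n) \<longlonglongrightarrow> P"
    unfolding size of_nat_sum sum_divide_distrib P_def by (intro tendsto_sum p)
  have eq: "ln (perms (M n)) / n = (ln (fact (size (M n))) / n - size (M n) / n * ln n + size (M n) / n) -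
     (\<Sum>x\<in>F. ln (fact (count (M n) x)) / n - count (M n) x / n * ln n + count (M n) x / n)" for n
  proof -
    have "real (perms (M n)) * (\<Prod>x\<in>set_mset (M n). fact (count (M n) x)) = fact (size (M n))"
      using card_permutations_of_multiset_aux[of "M n"] by (metis (mono_tags, lifting) of_nat_fact of_nat_mult of_nat_prod prod.cong)
    moreover have "(\<Prod>x\<in>set_mset (M n). fact (count (M n) x)) = (\<Prod>x\<in>F. fact (count (M n) x) :: real)"
      using F by (intro prod.mono_neutral_left) (auto simp: not_in_iff)
    ultimately have "ln (real (perms (M n)) * (\<Prod>x\<in>F. fact (count (M n) x))) = ln (fact (size (M n)))" by simp
    then have "ln (perms (M n)) + (\<Sum>x\<in>F. ln (fact (count (M n) x))) = ln (fact (size (M n)))"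
      using F(1) by (subst (asm) ln_mult) (auto simp: perms_pos ln_prod intro!: prod_pos)
    moreover have "(\<Sum>x\<in>F. ln (fact (count (M n) x)) / n - count (M n) x / n * ln n + count (M n) x / n) =
      (\<Sum>x\<in>F. ln (fact (count (M n) x))) / n - size (M n) / n * ln n + size (M n) / n"
      unfolding size of_nat_sum sum_divide_distrib sum_distrib_right by (simp add: sum.distrib sum_subtractf)
    ultimately show ?thesis by (simp add: diff_divide_distrib[symmetric] algebra_simps)
  qed
  have "(\<lambda>n. ln (perms (M n)) / n) \<longlonglongrightarrow> P * ln P - (\<Sum>x\<in>F. p x * ln (p x))"
    unfolding eq by (intro tendsto_diff tendsto_sum ln_fact_asymp sz p)
  then show ?thesis by (rule convergentI)
qed

lemma tendsto_le_frequently: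
  fixes u v :: "nat \<Rightarrow> real"
  assumes "u \<longlonglongrightarrow> a" "v \<longlonglongrightarrow> b" "frequently (\<lambda>n. u n \<le> v n) sequentially"
  shows "a \<le> b"
proof (rule ccontr)
  assume "\<not> a \<le> b"
  then have "eventually (\<lambda>n. u n - v n > 0) sequentially"
    using tendsto_diff[OF assms(1,2)] by (intro order_tendstoD(1)) auto
  then have "eventually (\<lambda>n. \<not> u n \<le> v n) sequentially" by (rule eventually_mono) simp
  then show False using assms(3) by (simp add: frequently_def)
qed

context sponge_ifs
begin

lemma mrate_bounds:
  assumes "\<And>i a. a \<in> E \<Longrightarrow> c \<le> rate i a \<and> rate i a \<le> C" "set_mset M \<subseteq> E"
  shows "c * size M \<le> mrate i M" "mrate i M \<le> C * size M"
proof -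
  have "c * size M \<le> mrate i M \<and> mrate i M \<le> C * size M"
    using assms(2)
  proof (induction M)
    case (add x M)
    then have "c * size M \<le> mrate i M \<and> mrate i M \<le> C * size M" "x \<in> E" by auto
    then show ?case using assms(1)[of x i] by (simp add: mrate_def algebra_simps)
  qed (simp add: mrate_def)
  then show "c * size M \<le> mrate i M" "mrate i M \<le> C * size M" by auto
qed

lemma mrate_eq_sum: "set_mset M \<subseteq> E \<Longrightarrow> mrate i M = (\<Sum>a\<in>E. count M a * rate i a)"
proof (induction M)
  case (add x M)
  have "(\<Sum>a\<in>E. count (add_mset x M) a * rate i a) = (\<Sum>a\<in>E. (if a = x then rate i x else 0) + count M a * rate i a)"
    by (intro sum.cong refl) (auto simp: algebra_simps)
  also have "\<dots> = rate i x + (\<Sum>a\<in>E. count M a * rate i a)"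
    using add.prems finite_E by (simp add: sum.distrib)
  finally show ?case using add by (simp add: mrate_def)
qed (simp add: mrate_def)

lemma size_pre: "size (pre \<omega> n) = card E + n"
  by (simp add: pre_def)

lemma sorted_enum_exists:
  fixes f :: "'d \<Rightarrow> real"
  obtains xs where "distinct xs" "set xs = UNIV" "\<And>k k'. k \<le> k' \<Longrightarrow> k' < length xs \<Longrightarrow> f (xs ! k) \<le> f (xs ! k')"
proof -
  obtain ys where ys: "set ys = (UNIV :: 'd set)" "distinct ys" using finite_distinct_list[of "UNIV :: 'd set"] by auto
  define xs where "xs = sort_key f ys"
  have "sorted (map f xs)" by (simp add: xs_def)
  then have "f (xs ! k) \<le> f (xs ! k')" if "k \<le> k'" "k' < length xs" for k k'
    using that sorted_nth_mono[of "map f xs" k k'] by simp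
  then show ?thesis using that[of xs] ys by (simp add: xs_def)
qed

lemma finite_enums: "finite {xs :: 'd list. distinct xs \<and> set xs = UNIV}"
proof (rule finite_subset)
  show "{xs :: 'd list. distinct xs \<and> set xs = UNIV} \<subseteq> {xs. set xs \<subseteq> UNIV \<and> length xs = CARD('d)}"
    by (auto simp: distinct_card[symmetric])
qed (rule finite_lists_length_eq, simp)

end

text \<open>The assumption \<open>bound\<close> has the form of the lower bound theorem, with a
  number \<open>s\<close> in place of the dimension of the badly approximable part.\<close>

locale sponge_bound = sponge_ifs A \<phi> E
  for A :: "'d::finite \<Rightarrow> 'a set" and \<phi> :: "'d \<Rightarrow> 'a \<Rightarrow> real \<Rightarrow> real" and E :: "('d \<Rightarrow> 'a) set" +
  fixes s :: real
  assumes s: "0 \<le> s"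
    and bound: "set_mset M = E \<Longrightarrow> distinct xs \<Longrightarrow> set xs = UNIV \<Longrightarrow>
      (\<And>k k'. k \<le> k' \<Longrightarrow> k' < length xs \<Longrightarrow> mrate (xs ! k) M \<le> mrate (xs ! k') M) \<Longrightarrow>
      (\<Sum>k<length xs. (log_count (set (take (Suc k) xs)) M - log_count (set (take k xs)) M) / mrate (xs ! k) M) \<le> s"
begin

text \<open>Under the limits, \<open>bound\<close> at the prefixes of \<omega> becomes
  \<open>\<delta> \<le> s\<close>, and the counts at levels about \<open>N / lyap i\<close> have
  nearly the same ratios as those at one common prefix.\<close>

lemma good_if_convergent:
  assumes \<omega>: "\<omega> \<in> seqs" and \<epsilon>: "0 < \<epsilon>" and c: "0 < c" "\<And>i a. a \<in> E \<Longrightarrow> c \<le> rate i a"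
    and h: "\<And>I. (\<lambda>n. log_count I (pre \<omega> n) / n) \<longlonglongrightarrow> h I"
    and lyap: "\<And>i. (\<lambda>n. mrate i (pre \<omega> n) / n) \<longlonglongrightarrow> lyap i"
  shows "\<exists>m\<ge>m0. \<exists>n xs L. good (c / 4) (s + \<epsilon>) \<omega> m n xs L"
proof -
  have lyapc: "c \<le> lyap i" for i
  proof (rule LIMSEQ_le_const[OF lyap], intro exI allI impI)
    fix n :: nat assume n: "1 \<le> n"
    have "c * n \<le> c * size (pre \<omega> n)" using c(1) by (intro mult_left_mono) (auto simp: size_pre)
    also have "\<dots> \<le> mrate i (pre \<omega> n)"
      using mrate_bounds(1)[of c "Max ((\<lambda>(i, a). rate i a) ` (UNIV \<times> E))" "pre \<omega> n" i] c(2) finite_E set_pre[OF \<omega>]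
      by (force intro!: Max_ge)
    finally show "c \<le> mrate i (pre \<omega> n) / n" using n by (simp add: le_divide_eq)
  qed
  have lyap0: "0 < lyap i" for i using lyapc[of i] c(1) by simp
  define srt where "srt n xs \<longleftrightarrow> (\<forall>k k'. k \<le> k' \<longrightarrow> k' < length xs \<longrightarrow> mrate (xs ! k) (pre \<omega> n) \<le> mrate (xs ! k') (pre \<omega> n))" for n xs
  \<comment> \<open>Coordinates with equal limits \<open>lyap\<close> may change their order again
    and again. One of the finitely many orders occurs infinitely often and also sorts the
    limits.\<close>
  have "\<exists>xs\<in>{xs. distinct xs \<and> set xs = UNIV}. frequently (\<lambda>n. srt n xs) sequentially"
  proof -
    have "\<exists>xs\<in>{xs. distinct xs \<and> set xs = UNIV}. srt n xs" for n
      using sorted_enum_exists[of "\<lambda>i. mrate i (pre \<omega> n)"] unfolding srt_def by (metis (mono_tags, lifting) mem_Collect_eq)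
    then have "frequently (\<lambda>n. \<exists>xs\<in>{xs. distinct xs \<and> set xs = UNIV}. srt n xs) sequentially" by simp
    then show ?thesis using finite_enums frequently_bex_finite by blast
  qed
  then obtain xs where xs: "distinct xs" "set xs = UNIV" and fr: "frequently (\<lambda>n. srt n xs) sequentially" by blast
  have lyapsrt: "lyap (xs ! k) \<le> lyap (xs ! k')" if "k \<le> k'" "k' < length xs" for k k'
    using lyap lyap by (rule tendsto_le_frequently)
      (use fr that in \<open>auto simp: srt_def elim!: frequently_elim1 intro!: divide_right_mono\<close>)
  define I where "I k = set (take k xs)" for k
  define \<delta> where "\<delta> = (\<Sum>k<length xs. (h (I (Suc k)) - h (I k)) / lyap (xs ! k))"
  have \<delta>: "\<delta> \<le> s"
  proof (rule tendsto_le_frequently)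
    show "(\<lambda>n. \<Sum>k<length xs. (log_count (I (Suc k)) (pre \<omega> n) / n - log_count (I k) (pre \<omega> n) / n) / (mrate (xs ! k) (pre \<omega> n) / n))
        \<longlonglongrightarrow> \<delta>"
      unfolding \<delta>_def using lyap0 by (intro tendsto_intros h lyap) (auto simp: less_imp_neq[symmetric])
    show "(\<lambda>_. s) \<longlonglongrightarrow> s" by simp
    show "frequently (\<lambda>n. (\<Sum>k<length xs. (log_count (I (Suc k)) (pre \<omega> n) / n - log_count (I k) (pre \<omega> n) / n) /
        (mrate (xs ! k) (pre \<omega> n) / n)) \<le> s) sequentially"
      using frequently_eventually_frequently[OF fr eventually_gt_at_top[of 0]]
    proof (rule frequently_elim1)
      fix n assume n: "srt n xs \<and> 0 < n"
      have "(\<Sum>k<length xs. (log_count (I (Suc k)) (pre \<omega> n) / n - log_count (I k) (pre \<omega> n) / n) / (mrate (xs ! k) (pre \<omega> n) / n))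
        = (\<Sum>k<length xs. (log_count (I (Suc k)) (pre \<omega> n) - log_count (I k) (pre \<omega> n)) / mrate (xs ! k) (pre \<omega> n))"
        using n by (intro sum.cong refl) (simp add: diff_divide_distrib[symmetric])
      also have "\<dots> \<le> s"
        unfolding I_def using n by (intro bound set_pre \<omega> xs) (auto simp: srt_def)
      finally show "(\<Sum>k<length xs. (log_count (I (Suc k)) (pre \<omega> n) / n - log_count (I k) (pre \<omega> n) / n) / (mrate (xs ! k) (pre \<omega> n) / n)) \<le> s" .
    qed
  qed
  \<comment> \<open>Enlarging the levels by the factor \<open>1 + \<eta>\<close> ensures
    \<open>L \<le> mrate i (pre \<omega> (n i))\<close> for large \<open>N\<close>, although the
    rates converge only approximately; the cost grows to less than
    \<open>s + \<epsilon>\<close>.\<close>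
  define \<eta> where "\<eta> = min 1 (\<epsilon> / (s + 1))"
  have \<eta>: "0 < \<eta>" "\<eta> \<le> 1" using \<epsilon> s by (auto simp: \<eta>_def)
  have "\<eta> * s < \<epsilon>"
  proof -
    have "\<eta> * s \<le> \<epsilon> / (s + 1) * s" using s by (intro mult_right_mono) (auto simp: \<eta>_def)
    also have "\<dots> < \<epsilon>" using \<epsilon> s by (simp add: divide_less_eq)
    finally show ?thesis .
  qed
  moreover have "(1 + \<eta>) * \<delta> \<le> (1 + \<eta>) * s" using \<delta> \<eta> by (intro mult_left_mono) auto
  ultimately have \<delta>\<epsilon>: "(1 + \<eta>) * \<delta> < s + \<epsilon>" by (simp add: algebra_simps)
  define n where "n N i = nat \<lceil>(1 + \<eta>) / lyap i * real N\<rceil>" for N :: nat and i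
  have n_real: "(1 + \<eta>) / lyap i * N \<le> n N i" "n N i \<le> (1 + \<eta>) / lyap i * N + 1" for N i
  proof -
    have "0 \<le> (1 + \<eta>) / lyap i * N" using \<eta> lyap0[of i] by simp
    then have "real (n N i) = of_int \<lceil>(1 + \<eta>) / lyap i * real N\<rceil>" unfolding n_def by simp
    then show "(1 + \<eta>) / lyap i * N \<le> n N i" "n N i \<le> (1 + \<eta>) / lyap i * N + 1" by linarith+
  qed
  have nN: "(\<lambda>N. n N i / N) \<longlonglongrightarrow> (1 + \<eta>) / lyap i" for i
  proof (rule tendsto_sandwich)
    show "eventually (\<lambda>N. (1 + \<eta>) / lyap i \<le> n N i / N) sequentially"
      using eventually_gt_at_top[of 0] by eventually_elim (use n_real in \<open>simp add: le_divide_eq\<close>)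
    show "eventually (\<lambda>N. n N i / N \<le> (1 + \<eta>) / lyap i + 1 / N) sequentially"
      using eventually_gt_at_top[of 0]
    proof eventually_elim
      case (elim N)
      have "n N i / N \<le> ((1 + \<eta>) / lyap i * N + 1) / N" using n_real(2)[of N i] by (intro divide_right_mono) auto
      then show ?case using elim by (simp add: add_divide_distrib)
    qed
    show "(\<lambda>N. (1 + \<eta>) / lyap i + 1 / real N) \<longlonglongrightarrow> (1 + \<eta>) / lyap i"
      using tendsto_add[OF tendsto_const lim_inverse_n'] by (simp add: inverse_eq_divide)
  qed simp
  have n_inf: "filterlim (\<lambda>N. n N i) sequentially sequentially" for i
  proof -
    have "filterlim (\<lambda>N. (1 + \<eta>) / lyap i * real N) at_top sequentially"
      using \<eta> lyap0[of i] by (intro filterlim_tendsto_pos_mult_at_top[OF tendsto_const]) (auto simp: filterlim_real_sequentially)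
    then have "filterlim (\<lambda>N. real (n N i)) at_top sequentially"
      by (rule filterlim_at_top_mono) (use n_real in auto)
    then show ?thesis by (simp add: filterlim_sequentially_iff_filterlim_real)
  qed
  have h': "(\<lambda>N. log_count J (pre \<omega> (n N i)) / n N i) \<longlonglongrightarrow> h J" for J i
    using filterlim_compose[OF h n_inf] .
  have lyap': "(\<lambda>N. mrate j (pre \<omega> (n N i)) / n N i) \<longlonglongrightarrow> lyap j" for i j
    using filterlim_compose[OF lyap n_inf] .
  have "(\<lambda>N. \<Sum>k<length xs. (log_count (I (Suc k)) (pre \<omega> (n N (xs ! k))) / n N (xs ! k) -
      log_count (I k) (pre \<omega> (n N (xs ! k))) / n N (xs ! k)) * (n N (xs ! k) / N)) \<longlonglongrightarrow> (\<Sum>k<length xs. (h (I (Suc k)) - h (I k)) * ((1 + \<eta>) / lyap (xs ! k)))"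
    by (intro tendsto_intros h' nN)
  also have "(\<Sum>k<length xs. (h (I (Suc k)) - h (I k)) * ((1 + \<eta>) / lyap (xs ! k))) = (1 + \<eta>) * \<delta>"
    by (simp add: \<delta>_def sum_distrib_left mult_ac)
  finally have "eventually (\<lambda>N. (\<Sum>k<length xs. (log_count (I (Suc k)) (pre \<omega> (n N (xs ! k))) / n N (xs ! k) -
      log_count (I k) (pre \<omega> (n N (xs ! k))) / n N (xs ! k)) * (n N (xs ! k) / N)) < s + \<epsilon>) sequentially"
    using \<delta>\<epsilon> by (rule order_tendstoD(2))
  moreover have "eventually (\<lambda>N. \<forall>i. lyap i / (1 + \<eta>) < mrate i (pre \<omega> (n N i)) / n N i) sequentially"
  proof (rule eventually_all_finite)
    fix i
    have "lyap i / (1 + \<eta>) < lyap i" using lyap0[of i] \<eta> by (simp add: divide_less_eq)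
    then show "eventually (\<lambda>N. lyap i / (1 + \<eta>) < mrate i (pre \<omega> (n N i)) / n N i) sequentially"
      using lyap' by (intro order_tendstoD(1)) auto
  qed
  moreover have "eventually (\<lambda>N. \<forall>i. max m0 1 \<le> n N i) sequentially"
    using n_inf by (intro eventually_all_finite) (auto simp: filterlim_at_top simp del: max.bounded_iff)
  moreover have "eventually (\<lambda>N. c \<le> real N) sequentially"
    using filterlim_real_sequentially by (auto simp: filterlim_at_top)
  ultimately have "eventually (\<lambda>N. \<exists>m\<ge>m0. \<exists>n xs L. good (c / 4) (s + \<epsilon>) \<omega> m n xs L) sequentially"
    using eventually_gt_at_top[of 0]
  proof eventually_elim
    case (elim N)
    define m where "m = Max (range (n N))"
    have n1: "1 \<le> n N i" for i using elim(3) by (meson le_trans max.cobounded2)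
    have mle: "n N i \<le> m" for i by (simp add: m_def)
    have "m \<in> range (n N)" unfolding m_def by (rule Max_in) auto
    then obtain i0 where i0: "m = n N i0" by blast
    have "good (c / 4) (s + \<epsilon>) \<omega> m (n N) xs N"
      unfolding good_def
    proof (intro conjI allI impI)
      show "n N (xs ! k') \<le> n N (xs ! k)" if "k \<le> k'" "k' < length xs" for k k'
        unfolding n_def using lyapsrt[OF that] lyap0 \<eta>
        by (intro nat_mono ceiling_mono mult_right_mono divide_left_mono) auto
      \<comment> \<open>The factor 1/4 allows for \<open>1 + \<eta> \<le> 2\<close> and for the
        rounding of the levels.\<close>
      show "c / 4 * m \<le> N"
      proof -
        have "real m \<le> (1 + \<eta>) / lyap i0 * N + 1" using n_real(2) i0 by simp
        also have "(1 + \<eta>) / lyap i0 * N \<le> 2 / c * N"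
          using \<eta> lyapc c(1) by (intro mult_right_mono frac_le) auto
        finally have "c / 4 * m \<le> c / 4 * (2 / c * N + 1)" using c(1) by (intro mult_left_mono) auto
        also have "\<dots> = N / 2 + c / 4" using c(1) by (simp add: field_simps)
        also have "\<dots> \<le> N" using elim(4) by simp
        finally show ?thesis .
      qed
      show "N \<le> mrate i (pre \<omega> (n N i))" for i
      proof -
        have "real N = lyap i / (1 + \<eta>) * ((1 + \<eta>) / lyap i * N)" using lyap0[of i] \<eta> by simp
        also have "\<dots> \<le> lyap i / (1 + \<eta>) * n N i" using n_real(1)[of i N] lyap0[of i] \<eta> by (intro mult_left_mono) auto
        also have "\<dots> \<le> mrate i (pre \<omega> (n N i)) / n N i * n N i"
          using elim(2) by (intro mult_right_mono) (auto intro: less_imp_le)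
        also have "\<dots> = mrate i (pre \<omega> (n N i))" using n1[of i] by simp
        finally show ?thesis .
      qed
      have "(\<Sum>k<length xs. log_count (I (Suc k)) (pre \<omega> (n N (xs ! k))) - log_count (I k) (pre \<omega> (n N (xs ! k)))) =
         (\<Sum>k<length xs. (log_count (I (Suc k)) (pre \<omega> (n N (xs ! k))) / n N (xs ! k) -
            log_count (I k) (pre \<omega> (n N (xs ! k))) / n N (xs ! k)) * (n N (xs ! k) / N)) * N"
        unfolding sum_distrib_right using n1 elim(5)
        by (intro sum.cong refl) (simp add: diff_divide_distrib[symmetric] Suc_le_eq)
      also have "\<dots> \<le> (s + \<epsilon>) * N" using elim(1) by (intro mult_right_mono) auto
      finally show "(\<Sum>k<length xs. log_count (set (take (Suc k) xs)) (pre \<omega> (n N (xs ! k))) -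
        log_count (set (take k xs)) (pre \<omega> (n N (xs ! k)))) \<le> (s + \<epsilon>) * N" by (simp only: I_def)
    qed (use xs mle in auto)
    moreover have "m0 \<le> m" using elim(3) mle by (meson le_trans max.cobounded1)
    ultimately show ?case by blast
  qed
  then show ?thesis by simp
qed

text \<open>Letter frequencies determine the asymptotic rates linearly and, through projected
  counts, the limits of \<open>log_count\<close>.\<close>

lemma good_if_frequencies_converge:
  assumes \<omega>: "\<omega> \<in> seqs" and \<epsilon>: "0 < \<epsilon>" and c: "0 < c" "\<And>i a. a \<in> E \<Longrightarrow> c \<le> rate i a"
    and freq: "\<And>a. a \<in> E \<Longrightarrow> convergent (\<lambda>n. (\<Sum>l<n. indicat_real {a} (\<omega> l)) / n)"
  shows "\<exists>m\<ge>m0. \<exists>n xs L. good (c / 4) (s + \<epsilon>) \<omega> m n xs L"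
proof -
  have cnt: "count (pre \<omega> n) a = 1 + (\<Sum>l<n. indicat_real {a} (\<omega> l))" if "a \<in> E" for a n
  proof (induction n)
    case (Suc n)
    then show ?case using pre_split[of n "Suc n" \<omega>] by (simp add: indicator_def)
  qed (use that finite_E in \<open>simp add: pre_def\<close>)
  have lim0: "(\<lambda>n. 1 / real n) \<longlonglongrightarrow> 0" using lim_inverse_n' by (simp add: inverse_eq_divide)
  have conv: "convergent (\<lambda>n. count (pre \<omega> n) a / n)" if "a \<in> E" for a
    using convergent_add[OF convergentI[OF lim0] freq[OF that]] by (simp add: cnt[OF that] add_divide_distrib)
  have "convergent (\<lambda>n. log_count I (pre \<omega> n) / n)" for I
    unfolding log_count_def
  proof (rule ln_perms_asymp)
    show "finite ((\<lambda>a. restrict a I) ` E)" using finite_E by simp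
    show "set_mset (image_mset (\<lambda>a. restrict a I) (pre \<omega> n)) \<subseteq> (\<lambda>a. restrict a I) ` E" for n
      using set_pre[OF \<omega>] by simp
    fix x
    have "count (image_mset (\<lambda>a. restrict a I) (pre \<omega> n)) x / n =
        (\<Sum>a\<in>(\<lambda>a. restrict a I) -` {x} \<inter> E. count (pre \<omega> n) a / n)" for n
      unfolding count_image_mset set_pre[OF \<omega>] by (simp add: sum_divide_distrib)
    then show "convergent (\<lambda>n. count (image_mset (\<lambda>a. restrict a I) (pre \<omega> n)) x / n)"
      using conv by (simp only:) (rule convergent_sum, blast)
  qed
  moreover have "convergent (\<lambda>n. mrate i (pre \<omega> n) / n)" for i
  proof -
    have "mrate i (pre \<omega> n) / n = (\<Sum>a\<in>E. count (pre \<omega> n) a / n * rate i a)" for n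
      using mrate_eq_sum[of "pre \<omega> n" i] set_pre[OF \<omega>, of n] by (simp add: sum_divide_distrib)
    moreover have "convergent (\<lambda>n. count (pre \<omega> n) a / n * rate i a)" if "a \<in> E" for a
      using conv[OF that] convergent_const by (rule convergent_mult)
    ultimately show ?thesis by (simp only:) (rule convergent_sum, blast)
  qed
  ultimately obtain h lyap where hl: "\<And>I. (\<lambda>n. log_count I (pre \<omega> n) / n) \<longlonglongrightarrow> h I"
    "\<And>i. (\<lambda>n. mrate i (pre \<omega> n) / n) \<longlonglongrightarrow> lyap i" unfolding convergent_def by metis
  show ?thesis by (rule good_if_convergent[OF \<omega> \<epsilon> c hl])
qed

end

section \<open>The dynamical dimension\<close>

lemma funpow_shift_map: "(shift_map ^^ k) \<omega> l = \<omega> (k + l)"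
  by (induction k arbitrary: l) (simp_all add: shift_map_def)

lemma topspace_symbol_topology: "topspace (symbol_topology E) = (\<Pi>\<^sub>E n\<in>UNIV. E)"
  by (simp add: symbol_topology_def)

lemma space_symbol_space: "space (symbol_space E) = (\<Pi>\<^sub>E n\<in>UNIV. E)"
  unfolding symbol_space_def topspace_symbol_topology[symmetric]
  by (rule space_measure_of) (auto dest: openin_subset)

lemma open_sets_symbol_space: "openin (symbol_topology E) U \<Longrightarrow> U \<in> sets (symbol_space E)"
  unfolding symbol_space_def by (subst sets_measure_of) (auto dest: openin_subset)

lemma measurable_shift_map: "shift_map \<in> measurable (symbol_space E) (symbol_space E)"
proof -
  have cont: "continuous_map (symbol_topology E) (symbol_topology E) shift_map"
    unfolding symbol_topology_def continuous_map_componentwise_UNIV shift_map_def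
    by (auto intro: continuous_map_product_projection)
  have "shift_map \<in> measurable (symbol_space E) (sigma (topspace (symbol_topology E)) {U. openin (symbol_topology E) U})"
  proof (rule measurable_measure_of)
    show "{U. openin (symbol_topology E) U} \<subseteq> Pow (topspace (symbol_topology E))" by (auto dest: openin_subset)
    show "shift_map \<in> space (symbol_space E) \<rightarrow> topspace (symbol_topology E)"
      unfolding space_symbol_space topspace_symbol_topology
      by (rule funcsetI) (simp add: PiE_iff shift_map_def)
    fix U assume "U \<in> {U. openin (symbol_topology E) U}"
    then have "openin (symbol_topology E) {\<omega> \<in> topspace (symbol_topology E). shift_map \<omega> \<in> U}"
      using cont by (auto intro: openin_continuous_map_preimage)
    from open_sets_symbol_space[OF this]
    show "shift_map -` U \<inter> space (symbol_space E) \<in> sets (symbol_space E)"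
      unfolding space_symbol_space topspace_symbol_topology by (simp add: vimage_def Int_def conj_commute)
  qed
  then show ?thesis by (simp only: symbol_space_def)
qed

lemma measurable_letter:
  assumes "finite E" shows "(\<lambda>\<omega>. \<omega> l) \<in> measurable (symbol_space E) (count_space E)"
  unfolding measurable_count_space_eq2[OF assms]
proof (intro conjI ballI)
  show "(\<lambda>\<omega>. \<omega> l) \<in> space (symbol_space E) \<rightarrow> E" by (auto simp: space_symbol_space)
  fix a assume a: "a \<in> E"
  have "openin (symbol_topology E) {\<omega> \<in> topspace (symbol_topology E). \<omega> l \<in> {a}}"
    using a by (intro openin_continuous_map_preimage[of _ "discrete_topology E"])
      (auto simp: symbol_topology_def intro: continuous_map_product_projection)
  from open_sets_symbol_space[OF this]
  show "(\<lambda>\<omega>. \<omega> l) -` {a} \<inter> space (symbol_space E) \<in> sets (symbol_space E)"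
    unfolding space_symbol_space topspace_symbol_topology by (simp add: vimage_def Int_def conj_commute)
qed

context sponge_ifs
begin

lemma measurable_word_map: "(\<lambda>\<omega>. word_map \<phi> \<omega> n x) \<in> borel_measurable (symbol_space E)"
proof (induction n arbitrary: x)
  case (Suc n)
  have "(\<lambda>\<omega>. word_map \<phi> \<omega> n (diag_map \<phi> (\<omega> n) x)) \<in> borel_measurable (symbol_space E)"
    by (rule measurable_compose_countable'[where f="\<lambda>a \<omega>. word_map \<phi> \<omega> n (diag_map \<phi> a x)", OF Suc.IH measurable_letter[OF finite_E]])
      (use finite_E in \<open>simp add: countable_finite\<close>)
  then show ?case by simp
qed simp

lemma measurable_coding_map: "coding_map \<phi> \<in> borel_measurable (symbol_space E)"
proof (rule borel_measurable_LIMSEQ_metric)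
  show "(\<lambda>\<omega>. word_map \<phi> \<omega> n 0) \<in> borel_measurable (symbol_space E)" for n by (rule measurable_word_map)
  show "(\<lambda>n. word_map \<phi> \<omega> n 0) \<longlonglongrightarrow> coding_map \<phi> \<omega>" if "\<omega> \<in> space (symbol_space E)" for \<omega>
    using that unfolding space_symbol_space by (rule coding_map_LIMSEQ)
qed

end

context sponge_bound
begin

text \<open>By the ergodic theorem for the indicators of letters, almost every sequence has letter
  frequencies. They may vary with the sequence, which is harmless because \<open>bound\<close>
  concerns all multisets.\<close>

theorem dynamical_dim_le: "dynamical_dim \<phi> E \<le> ennreal s"
  unfolding dynamical_dim_def
proof (rule SUP_least)
  fix \<mu> assume "\<mu> \<in> shift_invariant_measures E"
  then have \<mu>: "sets \<mu> = sets (symbol_space E)" "prob_space \<mu>" "distr \<mu> \<mu> shift_map = \<mu>"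
    by (auto simp: shift_invariant_measures_def)
  have sp: "space \<mu> = seqs" using sets_eq_imp_space_eq[OF \<mu>(1)] by (simp add: space_symbol_space)
  have meas: "measurable \<mu> N = measurable (symbol_space E) N" for N :: "'z measure"
    by (rule measurable_cong_sets[OF \<mu>(1) refl])
  have T: "shift_map \<in> measurable \<mu> \<mu>"
    using measurable_shift_map[of E] measurable_cong_sets[OF \<mu>(1) \<mu>(1)] by blast
  obtain c C where c: "0 < c" "\<And>i a. a \<in> E \<Longrightarrow> c \<le> rate i a \<and> rate i a \<le> C" using rate_bounds by metis
  define X where "X = {\<omega> \<in> seqs. \<forall>a\<in>E. convergent (\<lambda>n. (\<Sum>l<n. indicat_real {a} (\<omega> l)) / n)}"
  have "AE \<omega> in \<mu>. convergent (\<lambda>n. (\<Sum>l<n. indicat_real {a} (\<omega> l)) / n)" for a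
  proof -
    have "(\<lambda>\<omega>. indicat_real {a} (\<omega> 0)) \<in> borel_measurable \<mu>"
      unfolding meas by (rule measurable_compose[OF measurable_letter[OF finite_E]]) simp
    then have "AE \<omega> in \<mu>. convergent (\<lambda>n. (\<Sum>l<n. indicat_real {a} ((shift_map ^^ l) \<omega> 0)) / n)"
      by (intro birkhoff_AE_convergent \<mu> T) (auto simp: indicator_def)
    then show ?thesis by (simp add: funpow_shift_map)
  qed
  then have "AE \<omega> in \<mu>. \<forall>a\<in>E. convergent (\<lambda>n. (\<Sum>l<n. indicat_real {a} (\<omega> l)) / n)"
    using finite_E by (intro AE_finite_allI) auto
  then have AE_X: "AE \<omega> in \<mu>. \<omega> \<in> X" using AE_space by eventually_elim (simp add: X_def sp del: PiE_UNIV_domain)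
  have dimX: "hausdorff_dim (coding_map \<phi> ` X) \<le> ennreal s"
  proof (rule hausdorff_dim_coding_image_le[OF _ s, of _ "c / 4"])
    show "X \<subseteq> seqs" by (auto simp: X_def)
    show "\<exists>m\<ge>m0. \<exists>n xs L. good (c / 4) (s + \<epsilon>) \<omega> m n xs L" if "\<omega> \<in> X" "0 < \<epsilon>" for \<omega> \<epsilon> m0
      using that c by (intro good_if_frequencies_converge) (auto simp: X_def)
  qed (use c in simp)
  \<comment> \<open>The image of \<open>X\<close> need not be Borel, so the witness for the
    dimension of the measure is a Borel hull of the same dimension.\<close>
  obtain B where B: "B \<in> sets borel" "coding_map \<phi> ` X \<subseteq> B" "hausdorff_dim B \<le> hausdorff_dim (coding_map \<phi> ` X)"
    using hausdorff_dim_borel_hull by blast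
  let ?\<nu> = "distr \<mu> borel (coding_map \<phi>)"
  have "emeasure ?\<nu> (UNIV - B) = emeasure \<mu> (coding_map \<phi> -` (UNIV - B) \<inter> space \<mu>)"
    using B(1) by (intro emeasure_distr) (auto simp: meas measurable_coding_map)
  also have "coding_map \<phi> -` (UNIV - B) \<inter> space \<mu> = {\<omega> \<in> space \<mu>. coding_map \<phi> \<omega> \<notin> B}" by auto
  also have "emeasure \<mu> \<dots> = 0"
    using AE_X B(2) by (intro emeasure_eq_0_AE) (auto elim!: eventually_mono)
  finally have "B \<in> {B \<in> sets ?\<nu>. emeasure ?\<nu> (space ?\<nu> - B) = 0}" using B(1) by simp
  then have "hausdorff_dim_measure ?\<nu> \<le> hausdorff_dim B"
    unfolding hausdorff_dim_measure_def by (rule INF_lower)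
  then show "hausdorff_dim_measure ?\<nu> \<le> ennreal s" using B(3) dimX by simp
qed

end

section \<open>Sierpinski sponges and dimension two\<close>

text \<open>The average of the sum over a long interval is small, because the shifts only matter near its
  ends.\<close>

lemma exists_shift_difference_small:
  fixes w :: "nat \<Rightarrow> real \<Rightarrow> real" and a \<tau> :: "nat \<Rightarrow> real"
  assumes w: "\<And>k. w k \<in> borel_measurable borel" "\<And>k t. \<bar>w k t\<bar> \<le> B" and \<epsilon>: "0 < \<epsilon>"
  shows "\<exists>t\<ge>u. (\<Sum>k<d. a k * (w k (t - \<tau> k) - w k t)) < \<epsilon>"
proof (rule ccontr)
  assume "\<not> ?thesis"
  then have ge: "\<epsilon> \<le> (\<Sum>k<d. a k * (w k (t - \<tau> k) - w k t))" if "u \<le> t" for t using that by (auto simp: not_less)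
  have B: "0 \<le> B" using w(2)[of 0 0] by linarith
  define R where "R = (\<Sum>k<d. \<bar>a k\<bar> * (B * (4 * \<bar>\<tau> k\<bar>)))"
  have R: "0 \<le> R" unfolding R_def using B by (intro sum_nonneg mult_nonneg_nonneg) auto
  \<comment> \<open>Long enough for the lower bound
    \<open>\<Theta> * \<epsilon> = R + \<epsilon>\<close> of the integral to exceed its upper bound
    \<open>R\<close>.\<close>
  define \<Theta> where "\<Theta> = R / \<epsilon> + 1"
  have \<Theta>: "0 < \<Theta>" using R \<epsilon> by (simp add: \<Theta>_def add_nonneg_pos)
  define ind where "ind = indicat_real {u..u + \<Theta>}"
  have int_ind: "integrable lborel (indicat_real {x..y})" for x y :: real
    by (rule integrable_real_indicator) (simp_all add: emeasure_lborel_Icc_eq)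
  have int: "integrable lborel (\<lambda>t. ind (c + t) * g t)" if "g \<in> borel_measurable borel" "\<And>t. \<bar>g t\<bar> \<le> B" for g c
  proof (rule Bochner_Integration.integrable_bound)
    show "integrable lborel (\<lambda>t. B * indicat_real {u - c..u + \<Theta> - c} t)" by (intro integrable_mult_right int_ind)
    show "(\<lambda>t. ind (c + t) * g t) \<in> borel_measurable lborel" using that(1) unfolding ind_def by simp
    show "AE t in lborel. norm (ind (c + t) * g t) \<le> norm (B * indicat_real {u - c..u + \<Theta> - c} t)"
      using that(2) B by (intro AE_I2) (auto simp: ind_def indicator_def abs_mult)
  qed
  have wshift: "(\<lambda>t. w k (t - \<tau> k)) \<in> borel_measurable borel" for k
    by (rule measurable_compose[OF _ w(1)]) simp
  have i1: "integrable lborel (\<lambda>t. ind t * w k (t - \<tau> k))" for k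
    using int[of "\<lambda>t. w k (t - \<tau> k)" 0, OF wshift w(2)] by simp
  have i2: "integrable lborel (\<lambda>t. ind t * w k t)" for k using int[of "w k" 0, OF w] by simp
  have i3: "integrable lborel (\<lambda>t. ind (\<tau> k + t) * w k t)" for k by (rule int[OF w])
  have shift: "(\<integral>t. ind t * w k (t - \<tau> k) \<partial>lborel) - (\<integral>t. ind t * w k t \<partial>lborel) \<le> B * (4 * \<bar>\<tau> k\<bar>)
      \<and> - (B * (4 * \<bar>\<tau> k\<bar>)) \<le> (\<integral>t. ind t * w k (t - \<tau> k) \<partial>lborel) - (\<integral>t. ind t * w k t \<partial>lborel)" for k
  proof -
    let ?h = "\<lambda>t. B * (indicat_real {u - \<bar>\<tau> k\<bar>..u + \<bar>\<tau> k\<bar>} t + indicat_real {u + \<Theta> - \<bar>\<tau> k\<bar>..u + \<Theta> + \<bar>\<tau> k\<bar>} t)"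
    have "(\<integral>t. ind t * w k (t - \<tau> k) \<partial>lborel) = (\<integral>t. ind (\<tau> k + t) * w k t \<partial>lborel)"
      using lborel_integral_real_affine[of 1 "\<lambda>t. ind t * w k (t - \<tau> k)" "\<tau> k"] by simp
    then have eq: "(\<integral>t. ind t * w k (t - \<tau> k) \<partial>lborel) - (\<integral>t. ind t * w k t \<partial>lborel) =
        (\<integral>t. ind (\<tau> k + t) * w k t - ind t * w k t \<partial>lborel)" using i2 i3 by simp
    have pt: "\<bar>ind (\<tau> k + t) * w k t - ind t * w k t\<bar> \<le> ?h t" for t
    proof -
      \<comment> \<open>The interval and its translate differ only within
        \<open>\<bar>\<tau> k\<bar>\<close> of the two end points, hence the total length
        \<open>4 * \<bar>\<tau> k\<bar>\<close>.\<close>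
      have "\<bar>ind (\<tau> k + t) - ind t\<bar> \<le> indicat_real {u - \<bar>\<tau> k\<bar>..u + \<bar>\<tau> k\<bar>} t + indicat_real {u + \<Theta> - \<bar>\<tau> k\<bar>..u + \<Theta> + \<bar>\<tau> k\<bar>} t"
        unfolding ind_def indicator_def by (auto split: if_splits)
      then have "\<bar>ind (\<tau> k + t) - ind t\<bar> * \<bar>w k t\<bar> \<le> (indicat_real {u - \<bar>\<tau> k\<bar>..u + \<bar>\<tau> k\<bar>} t + indicat_real {u + \<Theta> - \<bar>\<tau> k\<bar>..u + \<Theta> + \<bar>\<tau> k\<bar>} t) * B"
        using w(2)[of k t] by (intro mult_mono) auto
      moreover have "ind (\<tau> k + t) * w k t - ind t * w k t = (ind (\<tau> k + t) - ind t) * w k t"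
        by (simp add: left_diff_distrib)
      ultimately show ?thesis by (simp only: abs_mult mult.commute)
    qed
    have inth: "integrable lborel ?h" by (intro integrable_mult_right Bochner_Integration.integrable_add int_ind)
    have intd: "integrable lborel (\<lambda>t. ind (\<tau> k + t) * w k t - ind t * w k t)" using i2 i3 by simp
    have "\<bar>\<integral>t. ind (\<tau> k + t) * w k t - ind t * w k t \<partial>lborel\<bar> \<le> (\<integral>t. ?h t \<partial>lborel)"
      by (rule order_trans[OF integral_abs_bound integral_mono[OF integrable_abs[OF intd] inth pt]])
    also have "(\<integral>t. ?h t \<partial>lborel) = B * (4 * \<bar>\<tau> k\<bar>)"
      by (subst integral_mult_right_zero, subst Bochner_Integration.integral_add[OF int_ind int_ind]) (use \<Theta> in simp)
    finally show ?thesis unfolding eq by (simp add: abs_le_iff)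
  qed
  have "(\<integral>t. ind t * \<epsilon> \<partial>lborel) \<le> (\<integral>t. (\<Sum>k<d. a k * (ind t * w k (t - \<tau> k) - ind t * w k t)) \<partial>lborel)"
  proof (rule integral_mono)
    show "integrable lborel (\<lambda>t. ind t * \<epsilon>)" unfolding ind_def by (intro integrable_mult_left int_ind)
    show "integrable lborel (\<lambda>t. \<Sum>k<d. a k * (ind t * w k (t - \<tau> k) - ind t * w k t))"
      by (intro Bochner_Integration.integrable_sum integrable_mult_right Bochner_Integration.integrable_diff i1 i2)
    fix t
    have "(\<Sum>k<d. a k * (ind t * w k (t - \<tau> k) - ind t * w k t)) = ind t * (\<Sum>k<d. a k * (w k (t - \<tau> k) - w k t))"
      by (simp add: sum_distrib_left algebra_simps)
    then show "ind t * \<epsilon> \<le> (\<Sum>k<d. a k * (ind t * w k (t - \<tau> k) - ind t * w k t))"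
      using ge[of t] by (auto simp: ind_def indicator_def)
  qed
  also have "\<dots> = (\<Sum>k<d. a k * ((\<integral>t. ind t * w k (t - \<tau> k) \<partial>lborel) - (\<integral>t. ind t * w k t \<partial>lborel)))"
    using i1 i2 by (subst Bochner_Integration.integral_sum) auto
  also have "\<dots> \<le> R" unfolding R_def
  proof (rule sum_mono)
    fix k
    have "\<bar>(\<integral>t. ind t * w k (t - \<tau> k) \<partial>lborel) - (\<integral>t. ind t * w k t \<partial>lborel)\<bar> \<le> B * (4 * \<bar>\<tau> k\<bar>)"
      using shift[of k] by (simp add: abs_le_iff)
    then have "\<bar>a k\<bar> * \<bar>(\<integral>t. ind t * w k (t - \<tau> k) \<partial>lborel) - (\<integral>t. ind t * w k t \<partial>lborel)\<bar> \<le> \<bar>a k\<bar> * (B * (4 * \<bar>\<tau> k\<bar>))"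
      by (intro mult_left_mono) auto
    then show "a k * ((\<integral>t. ind t * w k (t - \<tau> k) \<partial>lborel) - (\<integral>t. ind t * w k t \<partial>lborel)) \<le> \<bar>a k\<bar> * (B * (4 * \<bar>\<tau> k\<bar>))"
      unfolding abs_mult[symmetric] by linarith
  qed
  also have "(\<integral>t. ind t * \<epsilon> \<partial>lborel) = \<Theta> * \<epsilon>" using \<Theta> by (simp add: ind_def)
  finally show False using \<epsilon> by (simp add: \<Theta>_def distrib_right)
qed

context sponge_ifs
begin

lemma log_count_le:
  assumes "set_mset M \<subseteq> E" shows "log_count I M \<le> size M * ln (card E)"
proof -
  let ?r = "\<lambda>a. restrict a I"
  have cE: "1 \<le> card E" using finite_E E_ne by (simp add: Suc_le_eq card_gt_0_iff)
  have "perms (image_mset ?r M) \<le> card {v. set v \<subseteq> ?r ` E \<and> length v = size M}"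
  proof (intro card_mono finite_lists_length_eq subsetI CollectI conjI)
    fix v assume v: "v \<in> permutations_of_multiset (image_mset ?r M)"
    have "set_mset (mset v) = set_mset (image_mset ?r M)" by (simp only: permutations_of_multisetD[OF v])
    then show "x \<in> ?r ` E" if "x \<in> set v" for x using that assms by auto
    show "length v = size M" using length_finite_permutations_of_multiset[OF v] by simp
  qed (use finite_E in simp)
  also have "\<dots> = card (?r ` E) ^ size M" using finite_E by (intro card_lists_length_eq) auto
  also have "\<dots> \<le> card E ^ size M" using finite_E by (intro power_mono card_image_le) auto
  finally have "real (perms (image_mset ?r M)) \<le> real (card E) ^ size M" by (metis of_nat_le_iff of_nat_power)
  then have "ln (perms (image_mset ?r M)) \<le> ln (real (card E) ^ size M)"
    using perms_pos[of "image_mset ?r M"] by (intro ln_mono) auto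
  then show ?thesis using cE by (simp add: log_count_def ln_realpow)
qed

end

context sponge_bound
begin

text \<open>On the scale \<open>L = exp t\<close>, the quantity to be bounded by \<open>(s + \<epsilon>) * L\<close> is a sum over the
  coordinates of bounded functions of \<open>t - ln (lam i)\<close>. Without the shifts by \<open>ln (lam i)\<close> it is
  the quantity in the lower bound on the dimension.\<close>

lemma good_if_rates_constant:
  assumes lam: "\<And>i a. a \<in> E \<Longrightarrow> rate i a = lam i" and c: "0 < c" "\<And>i. c \<le> lam i"
    and \<omega>: "\<omega> \<in> seqs" and \<epsilon>: "0 < \<epsilon>"
  shows "\<exists>m\<ge>m0. \<exists>n xs L. good (c / 2) (s + \<epsilon>) \<omega> m n xs L"
proof -
  obtain xs :: "'d list" where xs: "distinct xs" "set xs = UNIV"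
    and inc: "\<And>k k'. k \<le> k' \<Longrightarrow> k' < length xs \<Longrightarrow> lam (xs ! k) \<le> lam (xs ! k')"
    using sorted_enum_exists[of lam] by metis
  have lam0: "0 < lam i" for i using c(1) c(2)[of i] by simp
  define e where "e = card E"
  define K where "K = ln (card E)"
  have cE: "1 \<le> card E" using finite_E E_ne by (simp add: Suc_le_eq card_gt_0_iff)
  have K: "0 \<le> K" using cE by (simp add: K_def)
  have mr: "mrate i (pre \<omega> N) = (e + N) * lam i" for i N
  proof -
    have "mrate i (pre \<omega> N) = (\<Sum>a\<in>#pre \<omega> N. lam i)"
      unfolding mrate_def using lam set_pre[OF \<omega>, of N] by (intro arg_cong[where f=sum_mset] image_mset_cong) auto
    then show ?thesis by (simp add: size_pre e_def)
  qed
  define lc where "lc k N = log_count (set (take k xs)) (pre \<omega> N)" for k N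
  have lc: "0 \<le> lc k N" "lc k N \<le> (e + N) * K" for k N
    using log_count_nonneg log_count_le[of "pre \<omega> N" "set (take k xs)"] set_pre[OF \<omega>, of N]
    by (auto simp: lc_def size_pre e_def K_def)
  \<comment> \<open>The increment of the counts per unit of scale, at logarithmic time
    \<open>t\<close>; setting it to 0 for negative times keeps it bounded.\<close>
  define w where "w k t = (if 0 \<le> t then (lc (Suc k) (nat \<lceil>exp t\<rceil>) - lc k (nat \<lceil>exp t\<rceil>)) / exp t else 0)" for k and t :: real
  have wB: "\<bar>w k t\<bar> \<le> (e + 2) * K" for k t
  proof (cases "0 \<le> t")
    case True
    then have t1: "1 \<le> exp t" by simp
    have "real (nat \<lceil>exp t\<rceil>) \<le> exp t + 1" using t1 by linarith
    then have "real (e + nat \<lceil>exp t\<rceil>) \<le> real e * 1 + exp t + 1" by simp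
    also have "\<dots> \<le> real e * exp t + exp t + exp t" using t1 by (intro add_mono mult_left_mono) auto
    also have "\<dots> = (e + 2) * exp t" by (simp add: algebra_simps)
    finally have "real (e + nat \<lceil>exp t\<rceil>) * K \<le> (e + 2) * exp t * K" using K by (rule mult_right_mono)
    then have "\<bar>lc (Suc k) (nat \<lceil>exp t\<rceil>) - lc k (nat \<lceil>exp t\<rceil>)\<bar> \<le> (e + 2) * K * exp t"
      using lc[of "Suc k" "nat \<lceil>exp t\<rceil>"] lc[of k "nat \<lceil>exp t\<rceil>"] by (simp add: mult_ac)
    then show ?thesis using True by (simp add: w_def abs_divide divide_le_eq)
  qed (use K in \<open>simp add: w_def\<close>)
  have wM: "w k \<in> borel_measurable borel" for k
  proof -
    have "(\<lambda>t::real. nat \<lceil>exp t\<rceil>) \<in> measurable borel (count_space UNIV)" by measurable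
    then have [measurable]: "(\<lambda>t::real. lc j (nat \<lceil>exp t\<rceil>)) \<in> borel_measurable borel" for j
      by (rule measurable_compose) simp
    show ?thesis unfolding w_def[abs_def] by measurable
  qed
  define \<tau> where "\<tau> k = ln (lam (xs ! k))" for k
  \<comment> \<open>The summands ensure, in this order, that the shifted times are nonnegative, that
    the rounding error \<open>s * (e + 1)\<close> is below \<open>L * \<epsilon> / 2\<close>, that
    \<open>c \<le> L\<close>, and that \<open>m \<ge> m0\<close>.\<close>
  define t0 where "t0 = (\<Sum>k<length xs. \<bar>\<tau> k\<bar>) + \<bar>ln (2 * (s * (e + 1) + 1) / \<epsilon>)\<bar> + \<bar>ln c\<bar> + \<bar>ln ((m0 + 1) * lam (xs ! 0))\<bar>"
  obtain t where t: "t0 \<le> t" "(\<Sum>k<length xs. 1 / lam (xs ! k) * (w k (t - \<tau> k) - w k t)) < \<epsilon> / 2"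
    using exists_shift_difference_small[where w=w and u=t0 and d="length xs" and a="\<lambda>k. 1 / lam (xs ! k)" and \<tau>=\<tau>
      and \<epsilon>="\<epsilon> / 2", OF wM wB] \<epsilon> by auto
  have t_\<tau>: "\<bar>\<tau> k\<bar> \<le> t" if "k < length xs" for k
    using member_le_sum[of k "{..<length xs}" "\<lambda>k. \<bar>\<tau> k\<bar>"] that t(1) by (simp add: t0_def)
  have t_pos: "0 \<le> t" and t_s: "ln (2 * (s * (e + 1) + 1) / \<epsilon>) \<le> t" and t_c: "ln c \<le> t"
    and t_m: "ln ((m0 + 1) * lam (xs ! 0)) \<le> t"
    using t(1) sum_nonneg[of "{..<length xs}" "\<lambda>k. \<bar>\<tau> k\<bar>", OF abs_ge_zero] unfolding t0_def by linarith+
  define L where "L = exp t"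
  have L_s: "s * (e + 1) \<le> L * (\<epsilon> / 2)"
  proof -
    have "0 < 2 * (s * (e + 1) + 1) / \<epsilon>" using s \<epsilon> by (auto intro!: divide_pos_pos mult_pos_pos add_nonneg_pos)
    then have "2 * (s * (e + 1) + 1) / \<epsilon> \<le> L" using t_s unfolding L_def by (metis exp_le_cancel_iff exp_ln)
    then have "2 * (s * (e + 1) + 1) \<le> L * \<epsilon>" using \<epsilon> by (simp add: divide_le_eq)
    then show ?thesis by (simp add: distrib_left)
  qed
  have L_c: "c \<le> L" using t_c c(1) unfolding L_def by (metis exp_le_cancel_iff exp_ln)
  have L_m: "(m0 + 1) * lam (xs ! 0) \<le> L"
  proof -
    have "0 < (m0 + 1) * lam (xs ! 0)" using lam0[of "xs ! 0"] by (simp add: add_nonneg_pos)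
    then show ?thesis using t_m unfolding L_def by (metis exp_le_cancel_iff exp_ln)
  qed
  have L0: "0 < L" by (simp add: L_def)
  \<comment> \<open>Since \<open>L / lam (xs ! k) = exp (t - \<tau> k)\<close>, these are the
    prefixes at which \<open>w\<close> is evaluated after the shift.\<close>
  define n where "n i = nat \<lceil>L / lam i\<rceil>" for i
  have n: "L / lam i \<le> n i" "n i \<le> L / lam i + 1" for i
  proof -
    have "0 \<le> L / lam i" using L0 lam0[of i] by simp
    then have "real (n i) = of_int \<lceil>L / lam i\<rceil>" by (simp add: n_def)
    then show "L / lam i \<le> n i" "n i \<le> L / lam i + 1" by linarith+
  qed
  define m where "m = Max (range n)"
  have nm: "n i \<le> m" for i by (simp add: m_def)
  have "m \<in> range n" unfolding m_def by (rule Max_in) auto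
  then obtain i0 where i0: "m = n i0" by blast
  have "m0 \<le> m"
  proof -
    have "real (m0 + 1) \<le> L / lam (xs ! 0)" using L_m lam0[of "xs ! 0"] by (simp add: le_divide_eq)
    then have "m0 \<le> n (xs ! 0)" using n(1)[of "xs ! 0"] by simp
    then show ?thesis using nm le_trans by blast
  qed
  moreover have "good (c / 2) (s + \<epsilon>) \<omega> m n xs L"
    unfolding good_def
  proof (intro conjI allI impI)
    show "n (xs ! k') \<le> n (xs ! k)" if "k \<le> k'" "k' < length xs" for k k'
      unfolding n_def using inc[OF that] lam0 L0 by (intro nat_mono ceiling_mono divide_left_mono) auto
    show "c / 2 * m \<le> L"
    proof -
      have "L / lam i0 \<le> L / c" using c(1) c(2)[of i0] L0 by (intro divide_left_mono) auto
      then have "real m \<le> L / c + 1" using n(2)[of i0] i0 by simp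
      then have "c / 2 * m \<le> c / 2 * (L / c + 1)" using c(1) by (intro mult_left_mono) auto
      also have "\<dots> = L / 2 + c / 2" using c(1) by (simp add: field_simps)
      finally show ?thesis using L_c by simp
    qed
    show "L \<le> mrate i (pre \<omega> (n i))" for i
    proof -
      have "L \<le> n i * lam i" using n(1)[of i] lam0[of i] by (simp add: divide_le_eq)
      also have "\<dots> \<le> (e + n i) * lam i" using lam0[of i] by (intro mult_right_mono) auto
      finally show ?thesis by (simp add: mr)
    qed
    have cost: "lc (Suc k) (n (xs ! k)) - lc k (n (xs ! k)) = L * (1 / lam (xs ! k) * w k (t - \<tau> k))" if "k < length xs" for k
    proof -
      have ex: "exp (t - \<tau> k) = L / lam (xs ! k)" using lam0[of "xs ! k"] by (simp add: exp_diff L_def \<tau>_def)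
      have "0 \<le> t - \<tau> k" using t_\<tau>[OF that] by simp
      then show ?thesis using L0 lam0[of "xs ! k"] by (simp add: w_def ex n_def)
    qed
    have low: "L * (\<Sum>k<length xs. 1 / lam (xs ! k) * w k t) \<le> s * (e + L + 1)"
    proof -
      \<comment> \<open>One prefix for all coordinates, so that \<open>bound\<close> controls the
        sum of the unshifted \<open>w\<close>.\<close>
      define N where "N = nat \<lceil>L\<rceil>"
      have N: "real N \<le> L + 1" using L0 unfolding N_def by linarith
      have eN: "0 < real (e + N)" using cE by (simp add: e_def)
      have "(\<Sum>k<length xs. (lc (Suc k) N - lc k N) / mrate (xs ! k) (pre \<omega> N)) \<le> s"
        unfolding lc_def by (rule bound[OF set_pre[OF \<omega>] xs]) (auto simp: mr inc intro!: mult_left_mono)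
      moreover have "(\<Sum>k<length xs. (lc (Suc k) N - lc k N) / mrate (xs ! k) (pre \<omega> N)) =
          (\<Sum>k<length xs. (lc (Suc k) N - lc k N) / lam (xs ! k)) / (e + N)"
        unfolding mr sum_divide_distrib by (intro sum.cong refl) simp
      ultimately have "(\<Sum>k<length xs. (lc (Suc k) N - lc k N) / lam (xs ! k)) \<le> s * (e + N)"
        using eN by (simp only: divide_le_eq if_True)
      also have "\<dots> \<le> s * (e + L + 1)" using N s by (intro mult_left_mono) auto
      also have "(\<Sum>k<length xs. (lc (Suc k) N - lc k N) / lam (xs ! k)) = L * (\<Sum>k<length xs. 1 / lam (xs ! k) * w k t)"
        unfolding sum_distrib_left using t_pos by (intro sum.cong refl) (simp add: w_def L_def N_def)
      finally show ?thesis .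
    qed
    have "(\<Sum>k<length xs. lc (Suc k) (n (xs ! k)) - lc k (n (xs ! k))) = (\<Sum>k<length xs. L * (1 / lam (xs ! k) * w k (t - \<tau> k)))"
      by (intro sum.cong refl) (simp only: cost lessThan_iff)
    also have "\<dots> = L * (\<Sum>k<length xs. 1 / lam (xs ! k) * (w k (t - \<tau> k) - w k t)) + L * (\<Sum>k<length xs. 1 / lam (xs ! k) * w k t)"
      unfolding sum_distrib_left by (simp add: sum.distrib[symmetric] algebra_simps diff_divide_distrib)
    also have "\<dots> \<le> L * (\<epsilon> / 2) + s * (e + L + 1)"
      using t(2) L0 low by (intro add_mono mult_left_mono) auto
    also have "\<dots> = L * (\<epsilon> / 2) + s * L + s * (e + 1)" by (simp add: algebra_simps)
    also have "\<dots> \<le> L * (\<epsilon> / 2) + s * L + L * (\<epsilon> / 2)" using L_s by simp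
    also have "\<dots> = (s + \<epsilon>) * L" by (simp add: algebra_simps)
    finally show "(\<Sum>k<length xs. log_count (set (take (Suc k) xs)) (pre \<omega> (n (xs ! k))) -
        log_count (set (take k xs)) (pre \<omega> (n (xs ! k)))) \<le> (s + \<epsilon>) * L" by (simp only: lc_def)
  qed (use xs nm in auto)
  ultimately show ?thesis by blast
qed

text \<open>If \<open>i\<close> contracts less than \<open>j\<close> up to time \<open>m\<close>, let \<open>n\<close> be the time at which \<open>j\<close> has contracted
  as much as \<open>i\<close> at time \<open>m\<close>. Then \<open>i\<close> contracts less than \<open>j\<close> up to time \<open>n\<close>, too, and unless the
  levels \<open>m\<close>, \<open>n\<close> are good, the bounded quantity \<open>log_count {i} / mrate i\<close> is larger at \<open>m\<close> than at
  \<open>n\<close> by a fixed amount. Iterating gives a contradiction.\<close>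

lemma good_if_two_coordinates:
  assumes ij: "UNIV = {i, j}" "i \<noteq> j" and c: "0 < c" "\<And>i a. a \<in> E \<Longrightarrow> c \<le> rate i a \<and> rate i a \<le> C"
    and \<omega>: "\<omega> \<in> seqs" and \<epsilon>: "0 < \<epsilon>"
    and bad: "\<And>m n xs L. m0 \<le> m \<Longrightarrow> \<not> good c (s + \<epsilon>) \<omega> m n xs L"
  shows "\<exists>N. \<forall>m\<ge>N. mrate i (pre \<omega> m) \<le> mrate j (pre \<omega> m) \<longrightarrow>
    real q * (\<epsilon> / 2) \<le> log_count {i} (pre \<omega> m) / mrate i (pre \<omega> m)"
proof -
  define S where "S l n = mrate l (pre \<omega> n)" for l n
  define g where "g n = log_count {i} (pre \<omega> n) / S i n" for n
  define e where "e = card E"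
  have cE: "1 \<le> e" using finite_E E_ne by (simp add: e_def Suc_le_eq card_gt_0_iff)
  have setE: "set_mset (pre \<omega> n) \<subseteq> E" for n using set_pre[OF \<omega>] by simp
  have S_lower: "c * (e + n) \<le> S l n" and S_upper: "S l n \<le> C * (e + n)" for l n
    using mrate_bounds[of c C, OF c(2) setE[of n], of l] by (auto simp: S_def size_pre e_def)
  have cC: "c \<le> C" using c(2) E_ne by (meson all_not_in_conv order_trans)
  have S_pos: "0 < S l n" for l n
  proof -
    have "0 < c * (e + n)" using c(1) cE by simp
    then show ?thesis using S_lower[of n l] by simp
  qed
  have S_Suc: "S l (Suc n) \<le> S l n + C" "S l n \<le> S l (Suc n)" for l n
    using c(2)[OF seqsD[OF \<omega>, of n], of l] c(1) by (auto simp: S_def mrate_pre rsum_def)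
  have S_mono: "S l n \<le> S l n'" if "n \<le> n'" for l n n' using S_Suc(2) that by (rule lift_Suc_mono_le)
  have g0: "0 \<le> g n" for n using log_count_nonneg[of "{i}" "pre \<omega> n"] S_pos[of i n] by (simp add: g_def)
  have step: "\<exists>n. N \<le> n \<and> S i n \<le> S j n \<and> g n + \<epsilon> / 2 < g m"
    if m: "m0 \<le> m" "S i m \<le> S j m" "s * C \<le> \<epsilon> / 2 * (c * m)" "C * (e + N + 1) \<le> c * m" for m N
  proof -
    define L where "L = S i m"
    have Lm: "c * m \<le> L" unfolding L_def
      by (rule order_trans[OF mult_left_mono S_lower[of m i]]) (use c(1) in auto)
    \<comment> \<open>Minimality makes \<open>S j n\<close> equal to \<open>L\<close> up to the
      constant \<open>C\<close>.\<close>
    define n where "n = (LEAST n. L \<le> S j n)"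
    have Sm: "L \<le> S j m" using m(2) by (simp add: L_def)
    have n: "L \<le> S j n" unfolding n_def by (rule LeastI[of "\<lambda>n. L \<le> S j n", OF Sm])
    have nm: "n \<le> m" unfolding n_def by (rule Least_le[of "\<lambda>n. L \<le> S j n", OF Sm])
    have Nn: "N < n"
    proof (rule ccontr)
      assume "\<not> N < n"
      then have "S j n \<le> C * (e + N)" using S_upper[of j n] c(1) cC
        by (intro order_trans[OF S_upper] mult_left_mono) auto
      moreover have "C * (e + N) < C * (e + N + 1)" using c(1) cC by simp
      ultimately show False using n Lm m(4) by simp
    qed
    then obtain n' where n': "n = Suc n'" by (cases n) auto
    then have "\<not> L \<le> S j n'" using not_less_Least[of n' "\<lambda>n. L \<le> S j n"] by (simp add: n_def[symmetric])
    then have nC: "S j n \<le> L + C" using S_Suc(1)[of j n'] n' by simp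
    \<comment> \<open>\<open>S i n \<le> S i m = L \<le> S j n\<close>: the order of the coordinates
      at \<open>n\<close> is the same as at \<open>m\<close>, so the argument can be repeated with
      \<open>n\<close>.\<close>
    have case_n: "S i n \<le> S j n" using S_mono[OF nm, of i] n by (simp add: L_def)
    define xs where "xs = [i, j]"
    have xs: "distinct xs" "set xs = UNIV" using ij by (auto simp: xs_def)
    have sum2: "(\<Sum>k<length xs. f k) = f 0 + f (Suc 0)" for f :: "nat \<Rightarrow> real" by (simp add: xs_def lessThan_Suc)
    have sorted: "S (xs ! k) n \<le> S (xs ! k') n" if "k \<le> k'" "k' < length xs" for k k'
      using that case_n by (cases k; cases k') (auto simp: xs_def)
    let ?c1 = "\<lambda>n. log_count {i} (pre \<omega> n)" and ?c2 = "\<lambda>n. log_count UNIV (pre \<omega> n)"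
    have take_xs: "set (take 0 xs) = {}" "set (take (Suc 0) xs) = {i}" "set (take (Suc (Suc 0)) xs) = UNIV"
      using ij by (auto simp: xs_def)
    have "?c1 n / S i n + (?c2 n - ?c1 n) / S j n \<le> s"
      using bound[OF set_pre[OF \<omega>] xs, of n] sorted unfolding sum2 take_xs S_def
      by (simp add: log_count_empty_set xs_def)
    then have "(?c2 n - ?c1 n) / S j n \<le> s - g n" by (simp add: g_def)
    then have "?c2 n - ?c1 n \<le> (s - g n) * S j n" using S_pos[of j n] by (simp add: divide_le_eq)
    also have "\<dots> = (s - g n) * L + (s - g n) * (S j n - L)" by (simp add: algebra_simps)
    also have "(s - g n) * (S j n - L) \<le> s * C" using g0[of n] n nC s c(1) cC by (intro mult_mono) auto
    finally have c2: "?c2 n - ?c1 n \<le> (s - g n) * L + s * C" by simp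
    \<comment> \<open>At these levels the cost is the count of \<open>i\<close> up to
      \<open>m\<close> plus the increment of the count up to \<open>n\<close> when \<open>j\<close>
      is added; \<open>c2\<close> bounds the latter, so badness forces \<open>g m\<close> above
      \<open>g n\<close>.\<close>
    define lv where "lv l = (if l = i then m else n)" for l
    have lvm: "\<forall>l. lv l \<le> m" using nm by (simp add: lv_def)
    have "\<not> good c (s + \<epsilon>) \<omega> m lv xs L" by (rule bad[OF m(1)])
    moreover have "lv (xs ! k') \<le> lv (xs ! k)" if "k \<le> k'" "k' < length xs" for k k'
      using that nm ij(2) by (cases k; cases k') (auto simp: xs_def lv_def)
    moreover have "L \<le> mrate l (pre \<omega> (lv l))" for l
    proof -
      have "l = i \<or> l = j" using ij(1) by auto
      then show ?thesis using n ij(2) by (auto simp: lv_def L_def S_def)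
    qed
    ultimately have "\<not> (\<Sum>k<length xs. log_count (set (take (Suc k) xs)) (pre \<omega> (lv (xs ! k))) -
        log_count (set (take k xs)) (pre \<omega> (lv (xs ! k)))) \<le> (s + \<epsilon>) * L"
      unfolding good_def using xs Lm lvm by blast
    then have "(s + \<epsilon>) * L < ?c1 m + (?c2 n - ?c1 n)"
      unfolding sum2 take_xs using ij(2) by (simp add: log_count_empty_set xs_def lv_def)
    also have "?c1 m = g m * L" using S_pos[of i m] by (simp add: g_def L_def)
    also have "g m * L + (?c2 n - ?c1 n) \<le> g m * L + ((s - g n) * L + \<epsilon> / 2 * L)"
    proof -
      have "s * C \<le> \<epsilon> / 2 * L" using m(3) Lm \<epsilon> by (smt (verit) mult_left_mono divide_pos_pos)
      then show ?thesis using c2 by simp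
    qed
    finally have "(g n + \<epsilon> / 2) * L < g m * L" by (simp add: algebra_simps)
    then have "g n + \<epsilon> / 2 < g m" using S_pos[of i m] unfolding L_def by (simp only: mult_less_cancel_right_pos)
    then show ?thesis using Nn case_n by (intro exI[of _ n]) auto
  qed
  have "\<exists>N. \<forall>m\<ge>N. S i m \<le> S j m \<longrightarrow> real q * (\<epsilon> / 2) \<le> g m"
  proof (induction q)
    case 0
    then show ?case using g0 by simp
  next
    case (Suc q)
    then obtain N where N: "\<And>m. N \<le> m \<Longrightarrow> S i m \<le> S j m \<Longrightarrow> real q * (\<epsilon> / 2) \<le> g m" by blast
    \<comment> \<open>From \<open>M\<close> on, the rounding error \<open>s * C\<close> is at most
      half of \<epsilon> times the scale, and the earlier time \<open>n\<close> is still beyond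
      \<open>N\<close>.\<close>
    obtain M :: nat where M: "(2 * (s * C) / \<epsilon> + C * (e + N + 1)) / c < M" using reals_Archimedean2 by blast
    then have cM: "2 * (s * C) / \<epsilon> + C * (e + N + 1) < c * M" using c(1) by (simp add: divide_less_eq mult.commute)
    have "real (Suc q) * (\<epsilon> / 2) \<le> g m" if m: "max m0 M \<le> m" "S i m \<le> S j m" for m
    proof -
      have "c * M \<le> c * m" using m(1) c(1) by (intro mult_left_mono) auto
      then have a: "2 * (s * C) / \<epsilon> + C * (e + N + 1) < c * m" using cM by simp
      have "0 \<le> 2 * (s * C) / \<epsilon>" "0 \<le> C * (e + N + 1)" using s \<epsilon> c(1) cC by auto
      then have "2 * (s * C) / \<epsilon> \<le> c * m" "C * (e + N + 1) \<le> c * m" using a by auto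
      then have "s * C \<le> \<epsilon> / 2 * (c * m)" "C * (e + N + 1) \<le> c * m" using \<epsilon> by (auto simp: divide_le_eq mult_ac)
      then obtain n where n: "N \<le> n" "S i n \<le> S j n" "g n + \<epsilon> / 2 < g m" using step[of m N] m by auto
      have "real q * (\<epsilon> / 2) \<le> g n" by (rule N[OF n(1,2)])
      then show ?thesis using n(3) by (simp add: algebra_simps)
    qed
    then show ?case by blast
  qed
  then show ?thesis by (simp add: S_def g_def)
qed

theorem hausdorff_dim_sponge_le:
  assumes "CARD('d) = 2 \<or> sierpinski \<phi> E"
  shows "hausdorff_dim (sponge \<phi> E) \<le> ennreal s"
proof -
  obtain c C where c: "0 < c" "c \<le> C" "\<And>i a. a \<in> E \<Longrightarrow> c \<le> rate i a \<and> rate i a \<le> C" using rate_bounds by metis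
  have "\<exists>m\<ge>m0. \<exists>n xs L. good (c / 2) (s + \<epsilon>) \<omega> m n xs L" if \<omega>: "\<omega> \<in> seqs" and \<epsilon>: "0 < \<epsilon>" for \<omega> \<epsilon> m0
    using assms
  proof
    assume "sierpinski \<phi> E"
    moreover obtain a0 where a0: "a0 \<in> E" using E_ne by blast
    ultimately have "rate i a = rate i a0" if "a \<in> E" for i a
      using that unfolding sierpinski_def rate_def by metis
    then show ?thesis using c(1) c(3)[OF a0] \<omega> \<epsilon> by (intro good_if_rates_constant[of "\<lambda>i. rate i a0"]) auto
  next
    assume "CARD('d) = 2"
    then obtain i j :: 'd where ij: "UNIV = {i, j}" "i \<noteq> j" by (auto simp: card_2_iff)
    show ?thesis
    proof (rule ccontr)
      assume neg: "\<not> ?thesis"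
      have bad: "\<not> good c (s + \<epsilon>) \<omega> m n xs L" if "m0 \<le> m" for m n xs L
      proof
        assume g: "good c (s + \<epsilon>) \<omega> m n xs L"
        have "c / 2 * m \<le> c * m" using c(1) by (intro mult_right_mono) auto
        then have "good (c / 2) (s + \<epsilon>) \<omega> m n xs L" using g unfolding good_def by auto
        then show False using neg that by blast
      qed
      \<comment> \<open>A bound for \<open>log_count {l} / mrate l\<close> at all prefixes;
        \<open>q\<close> repetitions of the fixed increase exceed it.\<close>
      define K where "K = ln (card E) / c"
      obtain q :: nat where q: "K / (\<epsilon> / 2) < q" using reals_Archimedean2 by blast
      then have qK: "K < real q * (\<epsilon> / 2)" using \<epsilon> by (simp add: divide_less_eq)
      have gK: "log_count {l} (pre \<omega> n) / mrate l (pre \<omega> n) \<le> K" for l n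
      proof -
        have E: "set_mset (pre \<omega> n) \<subseteq> E" using set_pre[OF \<omega>] by simp
        have sz: "0 < real (size (pre \<omega> n))" using finite_E E_ne by (simp add: size_pre card_gt_0_iff add_pos_nonneg)
        have "log_count {l} (pre \<omega> n) / mrate l (pre \<omega> n) \<le> (size (pre \<omega> n) * ln (card E)) / (c * size (pre \<omega> n))"
          using log_count_le[OF E] mrate_bounds(1)[OF c(3) E] c(1) sz
          by (intro frac_le) (auto intro: order_trans[OF log_count_nonneg])
        also have "\<dots> = K"
        proof -
          have "z * x / (c * z) = x / c" if "0 < z" for x z :: real using that by simp
          then show ?thesis using sz unfolding K_def by blast
        qed
        finally show ?thesis .
      qed
      have "\<exists>N1. \<forall>m\<ge>N1. mrate i (pre \<omega> m) \<le> mrate j (pre \<omega> m) \<longrightarrow>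
          real q * (\<epsilon> / 2) \<le> log_count {i} (pre \<omega> m) / mrate i (pre \<omega> m)"
        by (rule good_if_two_coordinates[OF ij c(1) _ \<omega> \<epsilon>]) (use c(3) bad in blast)+
      then obtain N1 where "\<forall>m\<ge>N1. mrate i (pre \<omega> m) \<le> mrate j (pre \<omega> m) \<longrightarrow>
          real q * (\<epsilon> / 2) \<le> log_count {i} (pre \<omega> m) / mrate i (pre \<omega> m)" by blast
      then have N1: "\<not> mrate i (pre \<omega> m) \<le> mrate j (pre \<omega> m)" if "N1 \<le> m" for m
        using that gK[of i m] qK by (smt (verit))
      have ji: "UNIV = {j, i}" "j \<noteq> i" using ij by auto
      have "\<exists>N2. \<forall>m\<ge>N2. mrate j (pre \<omega> m) \<le> mrate i (pre \<omega> m) \<longrightarrow>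
          real q * (\<epsilon> / 2) \<le> log_count {j} (pre \<omega> m) / mrate j (pre \<omega> m)"
        by (rule good_if_two_coordinates[OF ji c(1) _ \<omega> \<epsilon>]) (use c(3) bad in blast)+
      then obtain N2 where "\<forall>m\<ge>N2. mrate j (pre \<omega> m) \<le> mrate i (pre \<omega> m) \<longrightarrow>
          real q * (\<epsilon> / 2) \<le> log_count {j} (pre \<omega> m) / mrate j (pre \<omega> m)" by blast
      then have N2: "\<not> mrate j (pre \<omega> m) \<le> mrate i (pre \<omega> m)" if "N2 \<le> m" for m
        using that gK[of j m] qK by (smt (verit))
      \<comment> \<open>At every time one of the two coordinates has contracted at most as much as
        the other, but both orders are excluded for large times.\<close>
      show False using N1[of "max N1 N2"] N2[of "max N1 N2"] by auto
    qed
  qed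
  then have "hausdorff_dim (coding_map \<phi> ` seqs) \<le> ennreal s"
    using c(1) by (intro hausdorff_dim_coding_image_le[OF subset_refl s, of "c / 2"]) auto
  then show ?thesis by (simp add: sponge_def)
qed

end

theorem theorem1p5:
  fixes A :: "'d::finite \<Rightarrow> 'a set"
    and \<phi> :: "'d \<Rightarrow> 'a \<Rightarrow> real \<Rightarrow> real"
    and E :: "('d \<Rightarrow> 'a) set"
  assumes "diagonal_IFS A \<phi> E"
    and "baranski A \<phi>"
    and "irreducible_sponge \<phi> E"
    and "distinguishable_coordinates \<phi> E"
  shows "hausdorff_dim (sponge \<phi> E \<inter> badly_approximable) \<ge> dynamical_dim \<phi> E \<and>
    (CARD('d) = 2 \<or> sierpinski \<phi> E \<longrightarrow>
       hausdorff_dim (sponge \<phi> E \<inter> badly_approximable) = hausdorff_dim (sponge \<phi> E))"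
proof -
  interpret sponge_ifs A \<phi> E by standard (rule assms(1))
  let ?D = "hausdorff_dim (sponge \<phi> E \<inter> badly_approximable)"
  have mono: "?D \<le> hausdorff_dim (sponge \<phi> E)" by (rule hausdorff_dim_mono) blast
  show ?thesis
  proof (cases ?D rule: ennreal_cases)
    case (real r)
    \<comment> \<open>The dimension \<open>r\<close> of the badly approximable part is itself the
      bound: the lower bound theorem supplies the assumption for every \<open>M\<close>. An infinite
      \<open>?D\<close> is the trivial case, by monotonicity.\<close>
    interpret sponge_bound A \<phi> E r
    proof
      fix M :: "('d \<Rightarrow> 'a) multiset" and xs :: "'d list"
      assume M: "set_mset M = E" and xs: "set xs = UNIV"
        and inc: "\<And>k k'. k \<le> k' \<Longrightarrow> k' < length xs \<Longrightarrow> mrate (xs ! k) M \<le> mrate (xs ! k') M"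
      show "(\<Sum>k<length xs. (log_count (set (take (Suc k) xs)) M - log_count (set (take k xs)) M) / mrate (xs ! k) M) \<le> r"
        using hausdorff_dim_badly_approximable_ge[OF M assms(2-4) xs inc] real by simp
    qed (rule real(1))
    have "dynamical_dim \<phi> E \<le> ?D" using dynamical_dim_le real(2) by simp
    moreover have "?D = hausdorff_dim (sponge \<phi> E)" if "CARD('d) = 2 \<or> sierpinski \<phi> E"
      using mono hausdorff_dim_sponge_le[OF that] real(2) by (intro antisym) auto
    ultimately show ?thesis by blast
  next
    case top
    then have "hausdorff_dim (sponge \<phi> E) = \<top>" using mono by (simp add: top_unique)
    then show ?thesis using top by simp
  qed
qed

end
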